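(* There exists a numerical constant $C>0$ such that for all integers $n \ge 1$, all real $0 < \varepsilon \le 1$ and all real $\beta \ge 1$: $$\mathbb{P}\Bigl( \lambda_{\max}(H_{\beta}) \ge 2\sqrt{n}\,(1+\varepsilon) \Bigr) \le C e^{-\beta n \varepsilon^{3/2}/C},$$ and $$\mathbb{P}\Bigl( \lambda_{\max}(H_{\beta}) \le 2\sqrt{n}\,(1-\varepsilon) \Bigr) \le C^{\beta} e^{-\beta n^2 \varepsilon^{3}/C}.$$
   Context: For $\beta>0$ and an integer $n\ge 1$, the $\beta$-Hermite ensemble $H_\beta$ is the law of $n$ random real points $(\lambda_1,\dots,\lambda_n)$ with joint density on $\mathbb{R}^n$ $$\frac{1}{Z_{n,\beta}} \prod_{j<k} |\lambda_j-\lambda_k|^{\beta}\, e^{-(\beta/4)\sum_{k=1}^n \lambda_k^2},$$ where $Z_{n,\beta}$ is the normalizing constant. $\lambda_{\max}(H_\beta)=\max_{1\le k\le n}\lambda_k$. A numerical constant is an absolute one, independent of $n$, $\varepsilon$ and $\beta$. *)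

theory Defs
  imports "HOL-Probability.Probability"
begin

text \<open>Since the constant of the theorem must not depend on \<open>n\<close>, points of \<open>n\<close>-dimensional space
  are extensional functions on \<open>{1..n}\<close> with the product Lebesgue measure, not vectors
  over an index type.\<close>

definition hermite_weight :: "nat \<Rightarrow> real \<Rightarrow> (nat \<Rightarrow> real) \<Rightarrow> real" where
  "hermite_weight n \<beta> x =
     (\<Prod>k\<in>{1..n}. \<Prod>j\<in>{1..<k}. \<bar>x j - x k\<bar> powr \<beta>) * exp (- (\<beta> / 4) * (\<Sum>k\<in>{1..n}. (x k)\<^sup>2))"

definition hermite_Z :: "nat \<Rightarrow> real \<Rightarrow> real" where
  "hermite_Z n \<beta> = (LINT x|Pi\<^sub>M {1..n} (\<lambda>_. lborel). hermite_weight n \<beta> x)"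

definition hermite_ensemble :: "nat \<Rightarrow> real \<Rightarrow> (nat \<Rightarrow> real) measure" where
  "hermite_ensemble n \<beta> =
     density (Pi\<^sub>M {1..n} (\<lambda>_. lborel)) (\<lambda>x. ennreal (1 / hermite_Z n \<beta> * hermite_weight n \<beta> x))"

definition lambda_max :: "nat \<Rightarrow> (nat \<Rightarrow> real) \<Rightarrow> real" where
  "lambda_max n x = Max (x ` {1..n})"

text \<open>The Bochner integral and the measure of a set take the value 0 on non-integrable
  functions and non-measurable sets. The following facts show that neither
  default value is used for \<open>\<beta> > 0\<close> and \<open>n \<ge> 1\<close>.\<close>

lemma hermite_weight_nonneg: "0 \<le> hermite_weight n \<beta> x"
  by (simp add: hermite_weight_def prod_nonneg)

lemma hermite_weight_measurable [measurable]:
  "hermite_weight n \<beta> \<in> borel_measurable (Pi\<^sub>M {1..n} (\<lambda>_. lborel))"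
proof -
  have [measurable]: "(\<lambda>x. x j) \<in> borel_measurable (Pi\<^sub>M {1..n} (\<lambda>_. lborel :: real measure))"
    if "j \<in> {1..n}" for j
    using measurable_component_singleton[OF that, of "\<lambda>_. lborel :: real measure"] by simp
  show ?thesis
    unfolding hermite_weight_def
    by (intro borel_measurable_times borel_measurable_prod powr_real_measurable
        borel_measurable_abs borel_measurable_diff borel_measurable_const
        borel_measurable_sum borel_measurable_power measurable_compose[OF _ borel_measurable_exp])
       (auto simp del: One_nat_def)
qed

lemma integrable_one_plus_abs_powr_gauss:
  fixes a b :: real
  assumes "0 \<le> a" "0 < b"
  shows "integrable lborel (\<lambda>t. (1 + \<bar>t\<bar>) powr a * exp (- b * t\<^sup>2))"
proof -
  obtain m :: nat where m: "a \<le> real m" using real_arch_simple by blast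
  define c where "c = sqrt (1 / (2 * b))"
  have c: "0 < c" "2 * c\<^sup>2 = 1 / b" using assms by (simp_all add: c_def)
  have dens: "exp (- b * t\<^sup>2) = sqrt (2 * pi * c\<^sup>2) * normal_density 0 c t" for t
  proof -
    have "t\<^sup>2 / (2 * c\<^sup>2) = b * t\<^sup>2" unfolding c(2) by simp
    then show ?thesis using c(1) by (simp add: normal_density_def)
  qed
  have g: "integrable lborel (\<lambda>t. \<bar>t\<bar> ^ k * exp (- b * t\<^sup>2))" for k
  proof -
    have "integrable lborel (\<lambda>t. normal_density 0 c t * \<bar>t - 0\<bar> ^ k)"
      by (rule integrable_normal_moment_abs[OF c(1)])
    then have "integrable lborel (\<lambda>t. sqrt (2 * pi * c\<^sup>2) * (normal_density 0 c t * \<bar>t - 0\<bar> ^ k))"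
      by (rule integrable_mult_right)
    then show ?thesis unfolding dens by (simp add: ac_simps)
  qed
  have "integrable lborel (\<lambda>t. \<Sum>k\<le>m. of_nat (m choose k) * (\<bar>t\<bar> ^ k * exp (- b * t\<^sup>2)))"
    by (intro Bochner_Integration.integrable_sum integrable_mult_right g)
  moreover have "(\<Sum>k\<le>m. of_nat (m choose k) * (\<bar>t\<bar> ^ k * exp (- b * t\<^sup>2)))
      = (1 + \<bar>t\<bar>) ^ m * exp (- b * t\<^sup>2)" for t :: real
    by (simp add: add.commute[of 1] binomial_ring sum_distrib_right mult.assoc)
  ultimately have "integrable lborel (\<lambda>t. (1 + \<bar>t\<bar>) ^ m * exp (- b * t\<^sup>2))" by simp
  then show ?thesis
  proof (rule Bochner_Integration.integrable_bound)
    show "AE t in lborel. norm ((1 + \<bar>t\<bar>) powr a * exp (- b * t\<^sup>2))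
        \<le> norm ((1 + \<bar>t\<bar>) ^ m * exp (- b * t\<^sup>2))"
    proof (rule AE_I2)
      fix t :: real
      have "(1 + \<bar>t\<bar>) powr a \<le> (1 + \<bar>t\<bar>) powr real m" using m by (intro powr_mono) auto
      then have "(1 + \<bar>t\<bar>) powr a \<le> (1 + \<bar>t\<bar>) ^ m" by (simp add: powr_realpow)
      then show "norm ((1 + \<bar>t\<bar>) powr a * exp (- b * t\<^sup>2))
        \<le> norm ((1 + \<bar>t\<bar>) ^ m * exp (- b * t\<^sup>2))" by (simp add: abs_mult)
    qed
  qed measurable
qed

lemma hermite_weight_integrable:
  assumes "0 < \<beta>"
  shows "integrable (Pi\<^sub>M {1..n} (\<lambda>_. lborel)) (hermite_weight n \<beta>)"
proof -
  interpret product_sigma_finite "\<lambda>_ :: nat. lborel :: real measure"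
    by unfold_locales
  define a where "a = 2 * real n * \<beta>"
  define h where "h t = (1 + \<bar>t\<bar>) powr a * exp (- (\<beta> / 4) * t\<^sup>2)" for t :: real
  have "integrable (Pi\<^sub>M {1..n} (\<lambda>_. lborel)) (\<lambda>x. \<Prod>k\<in>{1..n}. h (x k))"
    unfolding h_def a_def using assms
    by (intro product_integrable_prod integrable_one_plus_abs_powr_gauss) auto
  moreover have "hermite_weight n \<beta> x \<le> (\<Prod>k\<in>{1..n}. h (x k))" for x
  proof -
    let ?u = "\<lambda>k. (1 + \<bar>x k\<bar>) powr \<beta>"
    have u: "1 \<le> ?u k" for k using assms by (intro ge_one_powr_ge_zero) auto
    have "\<bar>x j - x k\<bar> powr \<beta> \<le> ?u j * ?u k" for j k
    proof -
      have "\<bar>x j - x k\<bar> \<le> (1 + \<bar>x j\<bar>) * (1 + \<bar>x k\<bar>)"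
      proof -
        have "0 \<le> \<bar>x j\<bar> * \<bar>x k\<bar>" by simp
        moreover have "\<bar>x j - x k\<bar> \<le> \<bar>x j\<bar> + \<bar>x k\<bar>" by (rule abs_triangle_ineq4)
        moreover have "(1 + \<bar>x j\<bar>) * (1 + \<bar>x k\<bar>) = 1 + \<bar>x j\<bar> + \<bar>x k\<bar> + \<bar>x j\<bar> * \<bar>x k\<bar>"
          by (simp add: algebra_simps)
        ultimately show ?thesis by linarith
      qed
      then have "\<bar>x j - x k\<bar> powr \<beta> \<le> ((1 + \<bar>x j\<bar>) * (1 + \<bar>x k\<bar>)) powr \<beta>"
        using assms by (intro powr_mono2) auto
      then show ?thesis by (simp add: powr_mult)
    qed
    then have "(\<Prod>k\<in>{1..n}. \<Prod>j\<in>{1..<k}. \<bar>x j - x k\<bar> powr \<beta>)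
        \<le> (\<Prod>k\<in>{1..n}. \<Prod>j\<in>{1..<k}. ?u j * ?u k)"
      by (intro prod_mono conjI prod_nonneg) auto
    also have "\<dots> \<le> (\<Prod>k\<in>{1..n}. \<Prod>j\<in>{1..n}. ?u j * ?u k)"
    proof (intro prod_mono conjI prod_nonneg)
      fix k assume k: "k \<in> {1..n}"
      show "(\<Prod>j\<in>{1..<k}. ?u j * ?u k) \<le> (\<Prod>j\<in>{1..n}. ?u j * ?u k)"
      proof (rule prod_mono2)
        show "1 \<le> ?u j * ?u k" for j using mult_mono[OF u u, of j k] by simp
      qed (use k in auto)
    qed auto
    also have "\<dots> = (\<Prod>k\<in>{1..n}. ?u k) ^ n * (\<Prod>k\<in>{1..n}. ?u k) ^ n"
      by (simp add: prod.distrib prod_power_distrib)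
    also have "\<dots> = (\<Prod>k\<in>{1..n}. (1 + \<bar>x k\<bar>) powr a)"
    proof -
      have "(1 + \<bar>x k\<bar>) powr a = ?u k ^ n * ?u k ^ n" for k
      proof -
        have "?u k ^ n * ?u k ^ n = ?u k ^ (2 * n)" by (simp add: mult_2 power_add)
        also have "\<dots> = ?u k powr real (2 * n)"
          using u[of k] by (intro powr_realpow[symmetric]) linarith
        also have "\<dots> = (1 + \<bar>x k\<bar>) powr a" by (simp add: powr_powr a_def ac_simps)
        finally show ?thesis by simp
      qed
      then show ?thesis by (simp add: prod.distrib prod_power_distrib)
    qed
    finally have 1: "(\<Prod>k\<in>{1..n}. \<Prod>j\<in>{1..<k}. \<bar>x j - x k\<bar> powr \<beta>)
        \<le> (\<Prod>k\<in>{1..n}. (1 + \<bar>x k\<bar>) powr a)" .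
    have 2: "exp (- (\<beta> / 4) * (\<Sum>k\<in>{1..n}. (x k)\<^sup>2)) = (\<Prod>k\<in>{1..n}. exp (- (\<beta> / 4) * (x k)\<^sup>2))"
      by (simp add: exp_sum[symmetric] sum_distrib_left del: mult_minus_left)
    show ?thesis
      unfolding hermite_weight_def h_def prod.distrib 2
      by (intro mult_right_mono 1 prod_nonneg) auto
  qed
  ultimately show ?thesis
    by (elim Bochner_Integration.integrable_bound)
       (auto intro!: AE_I2 intro: order_trans[OF _ abs_ge_self] simp: hermite_weight_nonneg
         simp del: One_nat_def)
qed

lemma hermite_Z_pos:
  assumes "0 < \<beta>"
  shows "0 < hermite_Z n \<beta>"
proof -
  interpret product_sigma_finite "\<lambda>_ :: nat. lborel :: real measure"
    by unfold_locales
  let ?M = "Pi\<^sub>M {1..n} (\<lambda>_. lborel :: real measure)"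
  let ?B = "\<lambda>k. {real k<..<real k + 1}"
  have pos: "0 < hermite_weight n \<beta> x" if x: "x \<in> Pi\<^sub>E {1..n} ?B" for x
  proof -
    have "x j \<noteq> x k" if jk: "k \<in> {1..n}" "j \<in> {1..<k}" for j k
    proof -
      have "x k \<in> ?B k" "x j \<in> ?B j" using x jk by (auto simp: PiE_iff)
      moreover have "real j + 1 \<le> real k" using jk by auto
      ultimately show ?thesis by auto
    qed
    then show ?thesis
      unfolding hermite_weight_def by (intro mult_pos_pos prod_pos) auto
  qed
  have "0 \<le> hermite_Z n \<beta>"
    unfolding hermite_Z_def by (simp add: hermite_weight_nonneg)
  moreover have "hermite_Z n \<beta> \<noteq> 0"
  proof
    assume "hermite_Z n \<beta> = 0"
    then have "AE x in ?M. hermite_weight n \<beta> x = 0"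
      unfolding hermite_Z_def
      using integral_nonneg_eq_0_iff_AE[OF hermite_weight_integrable[OF assms, of n]]
      by (simp add: hermite_weight_nonneg)
    then have "AE x in ?M. x \<notin> Pi\<^sub>E {1..n} ?B"
      by eventually_elim (use pos in force)
    moreover have S: "Pi\<^sub>E {1..n} ?B \<in> sets ?M" by (intro sets_PiM_I_finite) auto
    ultimately have "emeasure ?M (Pi\<^sub>E {1..n} ?B) = 0"
      using AE_iff_measurable[OF S, of "\<lambda>x. x \<notin> Pi\<^sub>E {1..n} ?B"] sets.sets_into_space[OF S] by auto
    moreover have "emeasure ?M (Pi\<^sub>E {1..n} ?B) = 1"
      by (subst emeasure_PiM) auto
    ultimately show False by simp
  qed
  ultimately show ?thesis by simp
qed

lemma prob_space_hermite_ensemble: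
  assumes "0 < \<beta>"
  shows "prob_space (hermite_ensemble n \<beta>)"
proof
  let ?M = "Pi\<^sub>M {1..n} (\<lambda>_. lborel :: real measure)"
  have Z: "0 < hermite_Z n \<beta>" by (rule hermite_Z_pos[OF assms])
  have "emeasure (hermite_ensemble n \<beta>) (space (hermite_ensemble n \<beta>))
      = (\<integral>\<^sup>+ x. ennreal (1 / hermite_Z n \<beta> * hermite_weight n \<beta> x) * indicator (space ?M) x \<partial>?M)"
    unfolding hermite_ensemble_def by (subst emeasure_density)
      (auto intro!: measurable_compose[OF _ measurable_ennreal] borel_measurable_times
        borel_measurable_const hermite_weight_measurable simp del: One_nat_def)
  also have "\<dots> = (\<integral>\<^sup>+ x. ennreal (1 / hermite_Z n \<beta> * hermite_weight n \<beta> x) \<partial>?M)"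
    by (intro nn_integral_cong) auto
  also have "\<dots> = ennreal (LINT x|?M. 1 / hermite_Z n \<beta> * hermite_weight n \<beta> x)"
    using Z by (intro nn_integral_eq_integral integrable_mult_right
        hermite_weight_integrable[OF assms] AE_I2) (auto simp: hermite_weight_nonneg)
  also have "\<dots> = 1" using Z by (simp add: hermite_Z_def[symmetric] del: One_nat_def)
  finally show "emeasure (hermite_ensemble n \<beta>) (space (hermite_ensemble n \<beta>)) = 1" .
qed

lemma lambda_max_measurable [measurable]:
  "lambda_max n \<in> borel_measurable (hermite_ensemble n \<beta>)" if "1 \<le> n"
proof -
  have "(\<lambda>x. x j) \<in> borel_measurable (Pi\<^sub>M {1..n} (\<lambda>_. lborel :: real measure))"
    if "j \<in> {1..n}" for j
    using measurable_component_singleton[OF that, of "\<lambda>_. lborel :: real measure"] by simp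
  then have "(\<lambda>x. Max ((\<lambda>j. x j) ` {1..n})) \<in> borel_measurable (Pi\<^sub>M {1..n} (\<lambda>_. lborel :: real measure))"
    by (intro borel_measurable_Max) auto
  then show ?thesis
    unfolding hermite_ensemble_def lambda_max_def by simp
qed

end

theory Submission
  imports Defs
begin

text \<open>
  Both tails are read off from integration by parts against the unnormalised density
  \<open>\<Prod>\<bar>\<lambda>\<^sub>i - \<lambda>\<^sub>j\<bar>\<^sup>\<beta> exp (- (\<beta>/4) \<Sum>\<lambda>\<^sub>i\<^sup>2)\<close>. For a vector field \<open>f\<close> such an integration says that
  \<open>\<Sum>\<^sub>i \<partial>\<^sub>i f\<^sub>i + f\<^sub>i (\<beta> \<Sum>\<^sub>j 1/(\<lambda>\<^sub>i - \<lambda>\<^sub>j) - \<beta>\<lambda>\<^sub>i/2)\<close> has integral zero (a loop equation). For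
  \<open>\<beta> \<ge> 1\<close> the singular factors \<open>1/(\<lambda>\<^sub>i - \<lambda>\<^sub>j)\<close> are absorbed by the density, so every term is integrable
  for fields of polynomial growth.

  Upper tail. Let \<open>F\<close> be the density of the largest particle up to normalisation. Freeze the largest particle at \<open>x\<close>,
  write \<open>m\<close> for minus the sum of the others and \<open>S = \<Sum> 1/(x - \<lambda>\<^sub>j)\<close>. Translating all particles
  expresses \<open>F''\<close> through the conditional second moment of \<open>m - x\<close>; moving only the others with the
  fields \<open>1\<close>, \<open>m\<close>, \<open>S\<close> and \<open>1/(x - \<lambda>\<^sub>i)\<close> bounds that moment from below, the remainder
  being formally \<open>(12 - 12/\<beta>) \<Sum> 1/(x - \<lambda>\<^sub>j)\<^sup>2 \<ge> 0\<close>. To keep the last two fields bounded, \<open>x\<close> is replaced in them by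
  \<open>x + d\<close> with \<open>d \<longlonglongrightarrow> 0\<close>. The outcome is
  \<open>F'' \<ge> (\<beta>\<^sup>2/4)(x\<^sup>2 - 4(n - 1) - 2/\<beta>) F\<close>, stated in weak form as \<open>top_second_order\<close>. An integrable
  function with \<open>F'' \<ge> K\<^sup>2 F\<close> on a half-line decays there like \<open>exp (- K x)\<close>; with
  \<open>K = \<beta> \<surd>(n\<epsilon>)\<close>, which is admissible beyond \<open>2\<surd>n (1 + \<epsilon>/2)\<close>, and a further length \<open>\<surd>n \<epsilon>\<close>
  this gives the factor \<open>exp (- \<beta> n \<epsilon>\<^bsup>3/2\<^esup>)\<close> (\<open>top_tail\<close>). Testing against an explicit
  barrier function replaces the discussion of \<open>F\<close> itself.

  Lower tail. Let \<open>Q t\<close> be the integral of the density over configurations below a wall at \<open>t\<close>. Shifting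
  the wall gives \<open>(log Q)' = (\<beta>/2) \<mu>\<close>, where \<open>\<mu>\<close> is the conditional mean of \<open>- \<Sum>\<lambda>\<^sub>i\<close>
  (\<open>weighted_integral_below_shift\<close>). The loop equation for a field that vanishes at the wall yields, for
  the conditional mean \<open>s\<close> of \<open>\<Sum> 1/(z - \<lambda>\<^sub>i)\<close> with \<open>z = t + d\<close> above the wall, the Riccati inequality
  \<open>s' \<le> - (s - z/2)\<^sup>2 - (n - z\<^sup>2/4 - \<mu>/d)\<close>. Solutions blow up on an interval of length \<open>\<pi>/c\<close> if the
  last bracket is at least \<open>c\<^sup>2\<close>, so for \<open>t = 2\<surd>n (1 - \<epsilon>)\<close> and \<open>n \<epsilon>\<^bsup>3/2\<^esup>\<close> large, \<open>\<mu>\<close> is at least of order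
  \<open>n\<^bsup>3/2\<^esup> \<epsilon>\<^sup>2\<close> (\<open>pressed_mean_ge\<close>). Accumulating this over a wall displacement \<open>\<surd>n \<epsilon>\<close> gives
  \<open>exp (- \<beta> n\<^sup>2 \<epsilon>\<^sup>3 / 128)\<close>; for bounded \<open>n \<epsilon>\<^bsup>3/2\<^esup>\<close> the factor \<open>C\<^sup>\<beta>\<close> makes the bound trivial.
\<close>

section \<open>Functions of polynomial growth and Gaussian integrability\<close>

text \<open>The product \<open>\<Prod>(1 + \<bar>x\<^sub>i\<bar>)\<close> serves as the size of a configuration: it dominates every
  coordinate, its square dominates every \<open>1 + \<bar>x\<^sub>i - x\<^sub>j\<bar>\<close>, and it factorises over the coordinates, so that powers of it are
  integrable against a Gaussian by Fubini.\<close>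

definition poly_bounded :: "nat set \<Rightarrow> ((nat \<Rightarrow> real) \<Rightarrow> real) \<Rightarrow> bool" where
  "poly_bounded J f \<longleftrightarrow> f \<in> borel_measurable (Pi\<^sub>M J (\<lambda>_. lborel)) \<and>
     (\<exists>C a. \<forall>x. \<bar>f x\<bar> \<le> C * (\<Prod>i\<in>J. 1 + \<bar>x i\<bar>) ^ a)"

lemma poly_boundedI:
  assumes "f \<in> borel_measurable (Pi\<^sub>M J (\<lambda>_. lborel))"
    and "\<And>x. \<bar>f x\<bar> \<le> C * (\<Prod>i\<in>J. 1 + \<bar>x i\<bar>) ^ a"
  shows "poly_bounded J f"
  using assms unfolding poly_bounded_def by blast

lemma poly_bounded_measurable:
  "poly_bounded J f \<Longrightarrow> f \<in> borel_measurable (Pi\<^sub>M J (\<lambda>_. lborel))"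
  by (simp add: poly_bounded_def)

lemma one_le_prod_one_plus_abs: "1 \<le> (\<Prod>i\<in>J. 1 + \<bar>x i :: real\<bar>)"
  by (rule prod_ge_1) simp

lemma poly_bounded_obtain:
  assumes "poly_bounded J f"
  obtains C a where "0 \<le> C" "\<And>x. \<bar>f x\<bar> \<le> C * (\<Prod>i\<in>J. 1 + \<bar>x i\<bar>) ^ a"
proof -
  obtain C a where Ca: "\<And>x. \<bar>f x\<bar> \<le> C * (\<Prod>i\<in>J. 1 + \<bar>x i\<bar>) ^ a"
    using assms unfolding poly_bounded_def by blast
  have "0 \<le> C" using Ca[of "\<lambda>_. 0"] by simp
  then show ?thesis using Ca that by blast
qed

lemma poly_bounded_add:
  assumes "poly_bounded J f" "poly_bounded J g"
  shows "poly_bounded J (\<lambda>x. f x + g x)"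
proof -
  from poly_bounded_obtain[OF assms(1)] obtain C a
    where f: "0 \<le> C" "\<And>x. \<bar>f x\<bar> \<le> C * (\<Prod>i\<in>J. 1 + \<bar>x i\<bar>) ^ a" by metis
  from poly_bounded_obtain[OF assms(2)] obtain D b
    where g: "0 \<le> D" "\<And>x. \<bar>g x\<bar> \<le> D * (\<Prod>i\<in>J. 1 + \<bar>x i\<bar>) ^ b" by metis
  show ?thesis
  proof (rule poly_boundedI[where C = "C + D" and a = "max a b"])
    show "(\<lambda>x. f x + g x) \<in> borel_measurable (Pi\<^sub>M J (\<lambda>_. lborel))"
      by (intro borel_measurable_add borel_measurable_times poly_bounded_measurable assms)
    fix x :: "nat \<Rightarrow> real"
    let ?P = "\<Prod>i\<in>J. 1 + \<bar>x i\<bar>"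
    have "\<bar>f x\<bar> \<le> C * ?P ^ max a b"
      by (rule order_trans[OF f(2) mult_left_mono[OF power_increasing]])
         (use f(1) one_le_prod_one_plus_abs in auto)
    moreover have "\<bar>g x\<bar> \<le> D * ?P ^ max a b"
      by (rule order_trans[OF g(2) mult_left_mono[OF power_increasing]])
         (use g(1) one_le_prod_one_plus_abs in auto)
    ultimately show "\<bar>f x + g x\<bar> \<le> (C + D) * ?P ^ max a b"
      by (simp add: algebra_simps)
  qed
qed

lemma poly_bounded_mult:
  assumes "poly_bounded J f" "poly_bounded J g"
  shows "poly_bounded J (\<lambda>x. f x * g x)"
proof -
  from poly_bounded_obtain[OF assms(1)] obtain C a
    where f: "0 \<le> C" "\<And>x. \<bar>f x\<bar> \<le> C * (\<Prod>i\<in>J. 1 + \<bar>x i\<bar>) ^ a" by metis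
  from poly_bounded_obtain[OF assms(2)] obtain D b
    where g: "0 \<le> D" "\<And>x. \<bar>g x\<bar> \<le> D * (\<Prod>i\<in>J. 1 + \<bar>x i\<bar>) ^ b" by metis
  show ?thesis
  proof (rule poly_boundedI[where C = "C * D" and a = "a + b"])
    show "(\<lambda>x. f x * g x) \<in> borel_measurable (Pi\<^sub>M J (\<lambda>_. lborel))"
      by (intro borel_measurable_add borel_measurable_times poly_bounded_measurable assms)
    fix x :: "nat \<Rightarrow> real"
    let ?P = "\<Prod>i\<in>J. 1 + \<bar>x i\<bar>"
    have "\<bar>f x * g x\<bar> \<le> (C * ?P ^ a) * (D * ?P ^ b)"
      unfolding abs_mult using f g order_trans[OF abs_ge_zero f(2)] by (intro mult_mono) auto
    then show "\<bar>f x * g x\<bar> \<le> (C * D) * ?P ^ (a + b)"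
      by (simp add: power_add mult_ac)
  qed
qed

lemma poly_bounded_bounded:
  assumes "f \<in> borel_measurable (Pi\<^sub>M J (\<lambda>_. lborel))" "\<And>x. \<bar>f x\<bar> \<le> C"
  shows "poly_bounded J f"
  by (rule poly_boundedI[where C = C and a = 0]) (use assms in auto)

lemma poly_bounded_const: "poly_bounded J (\<lambda>_. c)"
  by (rule poly_bounded_bounded[where C = "\<bar>c\<bar>"]) auto

lemma poly_bounded_uminus: "poly_bounded J f \<Longrightarrow> poly_bounded J (\<lambda>x. - f x)"
  using poly_bounded_mult[OF poly_bounded_const[of J "-1"]] by simp

lemma poly_bounded_diff:
  "poly_bounded J f \<Longrightarrow> poly_bounded J g \<Longrightarrow> poly_bounded J (\<lambda>x. f x - g x)"
  using poly_bounded_add[OF _ poly_bounded_uminus] by fastforce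

lemma poly_bounded_power: "poly_bounded J f \<Longrightarrow> poly_bounded J (\<lambda>x. f x ^ m)"
  by (induction m) (auto intro: poly_bounded_const poly_bounded_mult)

lemma poly_bounded_sum:
  "(\<And>k. k \<in> K \<Longrightarrow> poly_bounded J (f k)) \<Longrightarrow> poly_bounded J (\<lambda>x. \<Sum>k\<in>K. f k x)"
  by (induction K rule: infinite_finite_induct)
     (auto intro: poly_bounded_const poly_bounded_add)

lemma poly_bounded_prod:
  "(\<And>k. k \<in> K \<Longrightarrow> poly_bounded J (f k)) \<Longrightarrow> poly_bounded J (\<lambda>x. \<Prod>k\<in>K. f k x)"
  by (induction K rule: infinite_finite_induct)
     (auto intro: poly_bounded_const poly_bounded_mult)

lemma measurable_coordinate [measurable]:
  "i \<in> J \<Longrightarrow> (\<lambda>x. x i) \<in> borel_measurable (Pi\<^sub>M J (\<lambda>_. lborel :: real measure))"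
  using measurable_component_singleton[of i J "\<lambda>_. lborel :: real measure"] by simp

lemma abs_coordinate_le_prod:
  assumes "finite J" "i \<in> J"
  shows "1 + \<bar>x i :: real\<bar> \<le> (\<Prod>i\<in>J. 1 + \<bar>x i\<bar>)"
proof -
  have "(1 + \<bar>x i\<bar>) * 1 \<le> (1 + \<bar>x i\<bar>) * (\<Prod>i\<in>J - {i}. 1 + \<bar>x i\<bar>)"
    by (intro mult_left_mono one_le_prod_one_plus_abs) auto
  then show ?thesis using prod.remove[OF assms, of "\<lambda>i. 1 + \<bar>x i\<bar>"] by simp
qed

lemma poly_bounded_coordinate:
  assumes "finite J" "i \<in> J"
  shows "poly_bounded J (\<lambda>x. x i)"
proof (rule poly_boundedI[where C = 1 and a = 1])
  show "\<bar>x i\<bar> \<le> 1 * (\<Prod>i\<in>J. 1 + \<bar>x i\<bar>) ^ 1" for x :: "nat \<Rightarrow> real"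
    using abs_coordinate_le_prod[OF assms, of x] by simp
qed (use assms in measurable)

lemma poly_bounded_pair:
  assumes "finite J" "i \<in> J" "j \<in> J" and "h \<in> borel_measurable borel"
    and h: "\<And>d. \<bar>h d\<bar> \<le> (1 + \<bar>d :: real\<bar>) ^ m"
  shows "poly_bounded J (\<lambda>x. h (x i - x j))"
proof (rule poly_boundedI[where C = 1 and a = "m + m"])
  show "(\<lambda>x. h (x i - x j)) \<in> borel_measurable (Pi\<^sub>M J (\<lambda>_. lborel))"
    by (intro measurable_compose[OF _ assms(4)] borel_measurable_diff measurable_coordinate assms)
  fix x :: "nat \<Rightarrow> real"
  let ?P = "\<Prod>i\<in>J. 1 + \<bar>x i\<bar>"
  have "1 + \<bar>x i - x j\<bar> \<le> (1 + \<bar>x i\<bar>) * (1 + \<bar>x j\<bar>)"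
  proof -
    have "0 \<le> \<bar>x i\<bar> * \<bar>x j\<bar>" by simp
    moreover have "(1 + \<bar>x i\<bar>) * (1 + \<bar>x j\<bar>) = 1 + \<bar>x i\<bar> + \<bar>x j\<bar> + \<bar>x i\<bar> * \<bar>x j\<bar>"
      by (simp add: algebra_simps)
    ultimately show ?thesis using abs_triangle_ineq4[of "x i" "x j"] by linarith
  qed
  also have "\<dots> \<le> ?P * ?P"
    by (intro mult_mono abs_coordinate_le_prod assms order_trans[OF _ one_le_prod_one_plus_abs]) auto
  finally have "(1 + \<bar>x i - x j\<bar>) ^ m \<le> (?P * ?P) ^ m" by (intro power_mono) auto
  then show "\<bar>h (x i - x j)\<bar> \<le> 1 * ?P ^ (m + m)"
    using h[of "x i - x j"] by (simp add: power_mult_distrib power_add)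
qed

definition gauss :: "nat set \<Rightarrow> real \<Rightarrow> (nat \<Rightarrow> real) \<Rightarrow> real" where
  "gauss J b x = exp (- b * (\<Sum>i\<in>J. (x i)\<^sup>2))"

lemma gauss_pos: "0 < gauss J b x"
  by (simp add: gauss_def)

lemma gauss_measurable [measurable]:
  "gauss J b \<in> borel_measurable (Pi\<^sub>M J (\<lambda>_. lborel))"
  unfolding gauss_def by measurable

lemma gauss_eq_prod: "gauss J b x = (\<Prod>i\<in>J. exp (- b * (x i)\<^sup>2))"
  unfolding gauss_def by (cases "finite J") (simp_all add: exp_sum[symmetric] sum_distrib_left del: mult_minus_left)

lemma poly_bounded_gauss_integrable:
  assumes J: "finite J" and b: "0 < b" and f: "poly_bounded J f"
  shows "integrable (Pi\<^sub>M J (\<lambda>_. lborel)) (\<lambda>x. f x * gauss J b x)"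
proof -
  interpret product_sigma_finite "\<lambda>_ :: nat. lborel :: real measure"
    by unfold_locales
  from poly_bounded_obtain[OF f] obtain C a
    where C: "0 \<le> C" "\<And>x. \<bar>f x\<bar> \<le> C * (\<Prod>i\<in>J. 1 + \<bar>x i\<bar>) ^ a" by metis
  have "integrable (Pi\<^sub>M J (\<lambda>_. lborel)) (\<lambda>x. \<Prod>i\<in>J. (1 + \<bar>x i\<bar>) powr real a * exp (- b * (x i)\<^sup>2))"
    using J b by (intro product_integrable_prod integrable_one_plus_abs_powr_gauss) auto
  then have "integrable (Pi\<^sub>M J (\<lambda>_. lborel)) (\<lambda>x. C * (\<Prod>i\<in>J. (1 + \<bar>x i\<bar>) powr real a * exp (- b * (x i)\<^sup>2)))"
    by (rule integrable_mult_right)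
  then show ?thesis
  proof (rule Bochner_Integration.integrable_bound)
    show "(\<lambda>x. f x * gauss J b x) \<in> borel_measurable (Pi\<^sub>M J (\<lambda>_. lborel))"
      by (intro borel_measurable_times poly_bounded_measurable f gauss_measurable)
    show "AE x in Pi\<^sub>M J (\<lambda>_. lborel). norm (f x * gauss J b x)
        \<le> norm (C * (\<Prod>i\<in>J. (1 + \<bar>x i\<bar>) powr real a * exp (- b * (x i)\<^sup>2)))"
    proof (rule AE_I2)
      fix x :: "nat \<Rightarrow> real"
      have "(\<Prod>i\<in>J. (1 + \<bar>x i\<bar>) powr real a * exp (- b * (x i)\<^sup>2))
          = (\<Prod>i\<in>J. 1 + \<bar>x i\<bar>) ^ a * gauss J b x"
        by (simp add: gauss_eq_prod prod.distrib prod_power_distrib powr_realpow add_pos_nonneg)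
      moreover have "0 \<le> (\<Prod>i\<in>J. 1 + \<bar>x i\<bar>)" by (intro prod_nonneg) auto
      ultimately show "norm (f x * gauss J b x)
        \<le> norm (C * (\<Prod>i\<in>J. (1 + \<bar>x i\<bar>) powr real a * exp (- b * (x i)\<^sup>2)))"
        using C(1) mult_right_mono[OF C(2) less_imp_le[OF gauss_pos], of x J b]
        by (simp add: abs_mult gauss_pos less_imp_le mult_ac)
    qed
  qed
qed

section \<open>Integration by parts against a Gaussian weight\<close>

lemma poly_gauss_tendsto_0:
  fixes b :: real
  assumes "0 < b"
  shows "((\<lambda>y. (1 + \<bar>y\<bar>) ^ a * exp (- b * y\<^sup>2)) \<longlongrightarrow> 0) at_top"
    and "((\<lambda>y. (1 + \<bar>y\<bar>) ^ a * exp (- b * y\<^sup>2)) \<longlongrightarrow> 0) at_bot"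
proof -
  have lim: "((\<lambda>y. (1 + \<bar>y\<bar>) ^ a * exp (- b * y\<^sup>2)) \<longlongrightarrow> 0) at_top"
  proof (rule tendsto_sandwich[OF always_eventually _ tendsto_const])
    show "\<forall>\<^sub>F y in at_top. (1 + \<bar>y\<bar>) ^ a * exp (- b * y\<^sup>2) \<le> 2 ^ a * (y ^ a * exp (- b * y))"
      using eventually_ge_at_top[of 1]
    proof eventually_elim
      case (elim y)
      have "(1 + \<bar>y\<bar>) ^ a \<le> (2 * y) ^ a" using elim by (intro power_mono) auto
      moreover have "exp (- b * y\<^sup>2) \<le> exp (- b * y)"
        using elim assms by (simp add: power2_eq_square)
      ultimately have "(1 + \<bar>y\<bar>) ^ a * exp (- b * y\<^sup>2) \<le> (2 * y) ^ a * exp (- b * y)"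
        using elim by (intro mult_mono) auto
      then show ?case by (simp add: power_mult_distrib mult.assoc)
    qed
    have "((\<lambda>y. (b * y) ^ a / exp (b * y)) \<longlongrightarrow> 0) at_top"
      by (rule filterlim_compose[OF tendsto_power_div_exp_0])
         (use assms in \<open>auto intro!: filterlim_tendsto_pos_mult_at_top[OF tendsto_const] filterlim_ident\<close>)
    then have "((\<lambda>y. (2 ^ a / b ^ a) * ((b * y) ^ a / exp (b * y))) \<longlongrightarrow> (2 ^ a / b ^ a) * 0) at_top"
      by (intro tendsto_intros)
    then show "((\<lambda>y. 2 ^ a * (y ^ a * exp (- b * y))) \<longlongrightarrow> 0) at_top"
      using assms by (simp add: power_mult_distrib exp_minus field_simps)
  qed simp
  show "((\<lambda>y. (1 + \<bar>y\<bar>) ^ a * exp (- b * y\<^sup>2)) \<longlongrightarrow> 0) at_top" by (rule lim)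
  show "((\<lambda>y. (1 + \<bar>y\<bar>) ^ a * exp (- b * y\<^sup>2)) \<longlongrightarrow> 0) at_bot"
    using filterlim_compose[OF lim filterlim_uminus_at_top_at_bot] by simp
qed

text \<open>Finitely many points without derivative are allowed because \<open>\<bar>d\<bar> powr \<beta>\<close> has a kink at
  \<open>d = 0\<close> when \<open>\<beta> = 1\<close>, and because walls and barriers are only piecewise smooth.\<close>

lemma integral_derivative_eq_0:
  fixes g g' :: "real \<Rightarrow> real"
  assumes cont: "continuous_on UNIV g" and S: "finite S"
    and deriv: "\<And>y. y \<notin> S \<Longrightarrow> (g has_real_derivative g' y) (at y)"
    and int: "integrable lborel g'"
    and top: "(g \<longlongrightarrow> 0) at_top" and bot: "(g \<longlongrightarrow> 0) at_bot"
  shows "(LINT y|lborel. g' y) = 0"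
proof -
  let ?I = "\<lambda>n::nat. {- real n..real n}"
  have eq: "(LINT y|lborel. indicator (?I n) y * g' y) = g (real n) - g (- real n)" for n
  proof -
    have si: "set_integrable lborel (?I n) g'"
      using int unfolding set_integrable_def by (intro integrable_mult_indicator) auto
    have "(g' has_integral g (real n) - g (- real n)) (?I n)"
      using deriv
      by (intro fundamental_theorem_of_calculus_interior_strong[OF S] continuous_on_subset[OF cont])
         (auto simp: has_real_derivative_iff_has_vector_derivative)
    then show ?thesis
      using set_borel_integral_eq_integral(2)[OF si] 
      by (simp add: integral_unique set_lebesgue_integral_def)
  qed
  have "(\<lambda>n. LINT y|lborel. indicator (?I n) y * g' y) \<longlonglongrightarrow> (LINT y|lborel. g' y)"
  proof (rule integral_dominated_convergence[where w = "\<lambda>y. \<bar>g' y\<bar>"])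
    show "AE y in lborel. (\<lambda>n. indicator (?I n) y * g' y) \<longlonglongrightarrow> g' y"
    proof (rule AE_I2, rule tendsto_eventually)
      fix y :: real
      obtain N :: nat where "\<bar>y\<bar> \<le> real N" using real_arch_simple by blast
      then show "\<forall>\<^sub>F n in sequentially. indicator (?I n) y * g' y = g' y"
        by (intro eventually_sequentiallyI[of N]) (auto simp: indicator_def abs_le_iff)
    qed
    show "AE y in lborel. norm (indicator (?I n) y * g' y) \<le> \<bar>g' y\<bar>" for n
      by (auto simp: indicator_def)
  qed (use int in auto)
  moreover have "(\<lambda>n. g (real n) - g (- real n)) \<longlonglongrightarrow> 0 - 0"
    by (intro tendsto_diff filterlim_compose[OF top] filterlim_compose[OF bot] filterlim_real_sequentially
        filterlim_compose[OF filterlim_uminus_at_bot_at_top])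
  ultimately show ?thesis unfolding eq using LIMSEQ_unique by fastforce
qed

text \<open>Freezing all coordinates but one leaves a function of one variable with Gaussian decay, which is what
  the one-dimensional fundamental theorem of calculus asks for.\<close>

lemma poly_bounded_slice:
  assumes "finite J" "k \<in> J" "0 < b" "poly_bounded J f" "x \<in> space (Pi\<^sub>M (J - {k}) (\<lambda>_. lborel))"
  obtains C a where
    "\<And>y. \<bar>f (x(k := y)) * gauss (J) b (x(k := y))\<bar> \<le> C * ((1 + \<bar>y\<bar>) ^ a * exp (- b * y\<^sup>2))"
    "integrable lborel (\<lambda>y. f (x(k := y)) * gauss (J) b (x(k := y)))"
proof -
  define K where "K = J - {k}"
  have K: "finite K" "k \<notin> K" "J = insert k K" using assms by (auto simp: K_def)
  from poly_bounded_obtain[OF assms(4)] obtain C a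
    where C: "0 \<le> C" "\<And>x. \<bar>f x\<bar> \<le> C * (\<Prod>i\<in>J. 1 + \<bar>x i\<bar>) ^ a" by metis
  let ?P = "\<Prod>i\<in>K. 1 + \<bar>x i\<bar>"
  have P: "0 \<le> ?P" by (intro prod_nonneg) auto
  define D where "D = C * ?P ^ a * gauss K b x"
  have g: "gauss (J) b (x(k := y)) = exp (- b * y\<^sup>2) * gauss K b x" for y
  proof -
    have "(\<Prod>i\<in>K. exp (- b * ((x(k := y)) i)\<^sup>2)) = (\<Prod>i\<in>K. exp (- b * (x i)\<^sup>2))"
      using K(2) by (intro prod.cong) auto
    then show ?thesis using K by (simp add: gauss_eq_prod)
  qed
  have bound: "\<bar>f (x(k := y)) * gauss (J) b (x(k := y))\<bar> \<le> D * ((1 + \<bar>y\<bar>) ^ a * exp (- b * y\<^sup>2))" for y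
  proof -
    have "(\<Prod>i\<in>J. 1 + \<bar>(x(k := y)) i\<bar>) = (1 + \<bar>y\<bar>) * ?P"
    proof -
      have "(\<Prod>i\<in>K. 1 + \<bar>(x(k := y)) i\<bar>) = ?P" using K(2) by (intro prod.cong) auto
      then show ?thesis using K by simp
    qed
    then have "\<bar>f (x(k := y))\<bar> \<le> C * ((1 + \<bar>y\<bar>) * ?P) ^ a" using C(2)[of "x(k := y)"] by simp
    then have "\<bar>f (x(k := y))\<bar> * (exp (- b * y\<^sup>2) * gauss K b x)
        \<le> C * ((1 + \<bar>y\<bar>) * ?P) ^ a * (exp (- b * y\<^sup>2) * gauss K b x)"
      by (intro mult_right_mono) (auto simp: gauss_pos less_imp_le)
    then show ?thesis
      unfolding g D_def by (simp add: abs_mult gauss_pos less_imp_le power_mult_distrib mult_ac)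
  qed
  have int: "integrable lborel (\<lambda>y. D * ((1 + \<bar>y\<bar>) powr real a * exp (- b * y\<^sup>2)))"
    using assms(3) by (intro integrable_mult_right integrable_one_plus_abs_powr_gauss) auto
  have "(\<lambda>y. x(k := y)) \<in> measurable lborel (Pi\<^sub>M (J) (\<lambda>_. lborel))"
    using measurable_component_update[of x K "\<lambda>_. lborel" k] assms(5) K by simp
  then have "(\<lambda>y. f (x(k := y)) * gauss (J) b (x(k := y))) \<in> borel_measurable lborel"
    by (intro borel_measurable_times measurable_compose[OF _ gauss_measurable]
        measurable_compose[OF _ poly_bounded_measurable[OF assms(4)]])
  then have "integrable lborel (\<lambda>y. f (x(k := y)) * gauss (J) b (x(k := y)))"
  proof (intro Bochner_Integration.integrable_bound[OF int] AE_I2)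
    fix y :: real
    have "(1 + \<bar>y\<bar>) powr real a = (1 + \<bar>y\<bar>) ^ a" by (simp add: powr_realpow add_pos_nonneg)
    then show "norm (f (x(k := y)) * gauss J b (x(k := y))) \<le> norm (D * ((1 + \<bar>y\<bar>) powr real a * exp (- b * y\<^sup>2)))"
      unfolding real_norm_def using order_trans[OF bound[of y] abs_ge_self] by (simp only:)
  qed
  with bound show ?thesis by (rule that)
qed

text \<open>By Fubini it is enough to integrate over the \<open>k\<close>-th coordinate first; there the integrand is the
  derivative of a function that vanishes at infinity.\<close>

lemma gaussian_integration_by_parts:
  assumes J: "finite J" "k \<in> J" and b: "0 < b"
    and f: "poly_bounded J f" and f': "poly_bounded J f'"
    and cont: "\<And>x. continuous_on UNIV (\<lambda>y. f (x(k := y)))"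
    and deriv: "\<And>x. \<exists>S. finite S \<and>
      (\<forall>y. y \<notin> S \<longrightarrow> ((\<lambda>y. f (x(k := y))) has_real_derivative f' (x(k := y))) (at y))"
  shows "has_bochner_integral (Pi\<^sub>M J (\<lambda>_. lborel)) (\<lambda>x. (f' x - 2 * b * x k * f x) * gauss J b x) 0"
proof -
  interpret product_sigma_finite "\<lambda>_ :: nat. lborel :: real measure"
    by unfold_locales
  define K where "K = J - {k}"
  have K: "finite K" "k \<notin> K" "J = insert k K" using J by (auto simp: K_def)
  let ?F = "\<lambda>x. f' x - 2 * b * x k * f x"
  have pF: "poly_bounded J ?F"
    by (intro poly_bounded_diff poly_bounded_mult poly_bounded_const poly_bounded_coordinate f f' J)
  have int: "integrable (Pi\<^sub>M J (\<lambda>_. lborel)) (\<lambda>x. ?F x * gauss J b x)"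
    by (rule poly_bounded_gauss_integrable[OF J(1) b pF])
  have zero: "(LINT y|lborel. ?F (x(k := y)) * gauss J b (x(k := y))) = 0"
    if x: "x \<in> space (Pi\<^sub>M K (\<lambda>_. lborel))" for x
  proof -
    from deriv[of x] obtain S where S: "finite S"
      "\<And>y. y \<notin> S \<Longrightarrow> ((\<lambda>y. f (x(k := y))) has_real_derivative f' (x(k := y))) (at y)" by blast
    have g: "gauss J b (x(k := y)) = exp (- b * (y\<^sup>2 + (\<Sum>i\<in>K. (x i)\<^sup>2)))" for y
    proof -
      have "(\<Sum>i\<in>K. ((x(k := y)) i)\<^sup>2) = (\<Sum>i\<in>K. (x i)\<^sup>2)" using K(2) by (intro sum.cong) auto
      then show ?thesis using K by (simp add: gauss_def)
    qed
    have dg: "((\<lambda>y. gauss J b (x(k := y))) has_real_derivative - 2 * b * y * gauss J b (x(k := y))) (at y)" for y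
      unfolding g by (auto intro!: derivative_eq_intros)
    obtain C a where C: "\<And>y. \<bar>f (x(k := y)) * gauss J b (x(k := y))\<bar> \<le> C * ((1 + \<bar>y\<bar>) ^ a * exp (- b * y\<^sup>2))"
      by (rule poly_bounded_slice[OF J b f x[unfolded K_def]]) (rule that)
    have lim: "((\<lambda>y. f (x(k := y)) * gauss J b (x(k := y))) \<longlongrightarrow> 0) F"
      if "((\<lambda>y. (1 + \<bar>y\<bar>) ^ a * exp (- b * y\<^sup>2)) \<longlongrightarrow> 0) F" for F
    proof (rule Lim_null_comparison)
      show "\<forall>\<^sub>F y in F. norm (f (x(k := y)) * gauss J b (x(k := y))) \<le> C * ((1 + \<bar>y\<bar>) ^ a * exp (- b * y\<^sup>2))"
        using C by (intro always_eventually) (auto simp: real_norm_def)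
      show "((\<lambda>y. C * ((1 + \<bar>y\<bar>) ^ a * exp (- b * y\<^sup>2))) \<longlongrightarrow> 0) F"
        using tendsto_mult_right_zero[OF that, of C] by simp
    qed
    show ?thesis
    proof (rule integral_derivative_eq_0[OF _ S(1)])
      show "continuous_on UNIV (\<lambda>y. f (x(k := y)) * gauss J b (x(k := y)))"
        unfolding g by (intro continuous_intros cont)
      show "((\<lambda>y. f (x(k := y)) * gauss J b (x(k := y))) has_real_derivative
          ?F (x(k := y)) * gauss J b (x(k := y))) (at y)" if "y \<notin> S" for y
        by (rule DERIV_cong[OF DERIV_mult'[OF S(2)[OF that] dg]]) (simp add: algebra_simps)
      show "integrable lborel (\<lambda>y. ?F (x(k := y)) * gauss J b (x(k := y)))"
        by (rule poly_bounded_slice[OF J b pF x[unfolded K_def]])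
    qed (intro lim poly_gauss_tendsto_0 b)+
  qed
  have "(LINT x|Pi\<^sub>M J (\<lambda>_. lborel). ?F x * gauss J b x)
      = (LINT x|Pi\<^sub>M K (\<lambda>_. lborel). LINT y|lborel. ?F (x(k := y)) * gauss J b (x(k := y)))"
    using product_integral_insert[OF K(1,2), of "\<lambda>x. ?F x * gauss J b x"] int unfolding K(3) by simp
  also have "\<dots> = (LINT x|Pi\<^sub>M K (\<lambda>_. lborel :: real measure). 0)"
    by (rule Bochner_Integration.integral_cong[OF refl]) (rule zero)
  finally show ?thesis using int by (simp add: has_bochner_integral_iff)
qed

section \<open>Particles with a pair interaction\<close>

text \<open>Besides \<open>q i j d = \<bar>d\<bar> powr \<beta>\<close> the locale has a second kind of instance, in which some of the factors are set
  to zero on a half-line; this restricts the particles to an order chamber. Such a cut leaves the function continuous and its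
  logarithmic derivative \<open>\<beta> / d\<close> unchanged, so that the same loop equations hold in the chamber
  without boundary terms.\<close>

locale pair_interaction =
  fixes J :: "nat set" and \<beta> :: real and q :: "nat \<Rightarrow> nat \<Rightarrow> real \<Rightarrow> real"
  assumes finite_J: "finite J" and beta_ge_1: "1 \<le> \<beta>"
    and q_sym: "q i j d = q j i (- d)"
    and q_nonneg: "0 \<le> q i j d"
    and q_le: "q i j d \<le> \<bar>d\<bar> powr \<beta>"
    and q_deriv: "d \<noteq> 0 \<Longrightarrow> (q i j has_real_derivative \<beta> / d * q i j d) (at d)"
begin

definition interaction :: "nat set \<Rightarrow> (nat \<Rightarrow> real) \<Rightarrow> real" where
  "interaction K x = (\<Prod>i\<in>K. \<Prod>j\<in>{j\<in>K. j < i}. q j i (x j - x i))"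

lemma interaction_nonneg: "0 \<le> interaction K x"
  unfolding interaction_def by (intro prod_nonneg q_nonneg)

lemma q_0: "q i j 0 = 0"
  using q_nonneg[of i j 0] q_le[of i j 0] by simp

lemma q_cont: "isCont (q i j) d"
proof (cases "d = 0")
  case True
  have "((\<lambda>d. \<bar>d\<bar> powr \<beta>) \<longlongrightarrow> 0) (at (0::real))"
    using beta_ge_1 by (intro tendsto_zero_powrI[where b = \<beta>] tendsto_rabs_zero tendsto_const tendsto_ident_at) auto
  then have "(q i j \<longlongrightarrow> 0) (at 0)"
    by (rule Lim_null_comparison[rotated]) (use q_nonneg q_le in \<open>auto intro!: always_eventually\<close>)
  then show ?thesis using True q_0 by (simp add: isCont_def)
qed (auto intro: DERIV_isCont q_deriv)

text \<open>The symmetry of \<open>q\<close> makes it irrelevant which particle is singled out, so the dependence on one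
  coordinate is a plain product over the others.\<close>

lemma interaction_insert:
  assumes "finite K" "k \<notin> K"
  shows "interaction (insert k K) x = interaction K x * (\<Prod>j\<in>K. q k j (x k - x j))"
proof -
  let ?r = "\<lambda>j. q k j (x k - x j)"
  have inner: "(\<Prod>j\<in>{j\<in>insert k K. j < i}. q j i (x j - x i))
      = (if k < i then ?r i else 1) * (\<Prod>j\<in>{j\<in>K. j < i}. q j i (x j - x i))" if "i \<in> K" for i
  proof -
    have "{j\<in>insert k K. j < i} = (if k < i then insert k {j\<in>K. j < i} else {j\<in>K. j < i})" by auto
    then show ?thesis using assms by simp
  qed
  have first: "(\<Prod>j\<in>{j\<in>insert k K. j < k}. q j k (x j - x k)) = (\<Prod>j\<in>{j\<in>K. j < k}. ?r j)"
  proof (rule prod.cong)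
    show "q j k (x j - x k) = ?r j" for j using q_sym[of j k "x j - x k"] by simp
  qed auto
  have "interaction (insert k K) x = (\<Prod>j\<in>{j\<in>K. j < k}. ?r j) *
      ((\<Prod>i\<in>K. if k < i then ?r i else 1) * interaction K x)"
    unfolding interaction_def using assms first inner by (simp add: prod.distrib)
  also have "(\<Prod>i\<in>K. if k < i then ?r i else 1) = (\<Prod>i\<in>{i\<in>K. k < i}. ?r i)"
    using assms by (simp add: prod.inter_filter)
  also have "(\<Prod>j\<in>{j\<in>K. j < k}. ?r j) * ((\<Prod>i\<in>{i\<in>K. k < i}. ?r i) * interaction K x)
      = ((\<Prod>j\<in>{j\<in>K. j < k}. ?r j) * (\<Prod>i\<in>{i\<in>K. k < i}. ?r i)) * interaction K x" by simp
  also have "(\<Prod>j\<in>{j\<in>K. j < k}. ?r j) * (\<Prod>i\<in>{i\<in>K. k < i}. ?r i) = (\<Prod>j\<in>K. ?r j)"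
  proof -
    have eq: "{j\<in>K. j < k} \<union> {i\<in>K. k < i} = K" using assms(2) by (auto simp: not_less le_less)
    have "prod ?r ({j\<in>K. j < k} \<union> {i\<in>K. k < i}) = prod ?r {j\<in>K. j < k} * prod ?r {i\<in>K. k < i}"
      using assms(1) by (intro prod.union_disjoint) auto
    then show ?thesis unfolding eq by (rule sym)
  qed
  finally show ?thesis by simp
qed

lemma interaction_upd: "k \<notin> K \<Longrightarrow> interaction K (x(k := y)) = interaction K x"
  unfolding interaction_def by (intro prod.cong refl) auto

lemma poly_bounded_q:
  assumes "i \<in> J" "j \<in> J"
  shows "poly_bounded J (\<lambda>x. q a b (x i - x j))"
    and "poly_bounded J (\<lambda>x. q a b (x i - x j) / (x i - x j))"
proof -
  obtain m :: nat where m: "\<beta> \<le> real m" using real_arch_simple by blast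
  have qm: "q a b \<in> borel_measurable borel"
    by (rule borel_measurable_continuous_onI) (simp add: continuous_on_eq_continuous_at q_cont)
  have le: "\<bar>d\<bar> powr s \<le> (1 + \<bar>d\<bar>) ^ m" if "0 \<le> s" "s \<le> \<beta>" for d s :: real
  proof -
    have "\<bar>d\<bar> powr s \<le> (1 + \<bar>d\<bar>) powr s" using that by (intro powr_mono2) auto
    also have "\<dots> \<le> (1 + \<bar>d\<bar>) powr real m" using that m by (intro powr_mono) auto
    finally show ?thesis by (simp add: powr_realpow add_pos_nonneg)
  qed
  show "poly_bounded J (\<lambda>x. q a b (x i - x j))"
    using q_le[of a b] q_nonneg[of a b] le[of \<beta>] beta_ge_1
    by (intro poly_bounded_pair[OF finite_J assms qm, of m]) (auto intro: order_trans)
  have "\<bar>q a b d / d\<bar> \<le> (1 + \<bar>d\<bar>) ^ m" for d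
  proof (cases "d = 0")
    case False
    have "\<bar>q a b d / d\<bar> \<le> \<bar>d\<bar> powr \<beta> / \<bar>d\<bar>"
      using q_le[of a b d] q_nonneg[of a b d] by (simp add: abs_divide divide_right_mono)
    also have "\<dots> = \<bar>d\<bar> powr (\<beta> - 1)" using False by (simp add: powr_diff)
    finally show ?thesis using le[of "\<beta> - 1" d] beta_ge_1 by simp
  qed simp
  then show "poly_bounded J (\<lambda>x. q a b (x i - x j) / (x i - x j))"
    by (intro poly_bounded_pair[OF finite_J assms, of "\<lambda>d. q a b d / d" m] borel_measurable_divide qm) auto
qed

lemma poly_bounded_interaction: "K \<subseteq> J \<Longrightarrow> poly_bounded J (interaction K)"
  unfolding interaction_def by (intro poly_bounded_prod poly_bounded_q) auto

text \<open>This is where \<open>\<beta> \<ge> 1\<close> enters the integrability: dividing the factor of the pair \<open>k, j\<close> by its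
  argument leaves at most \<open>\<bar>d\<bar> powr (\<beta> - 1)\<close>, which is bounded near \<open>0\<close>.\<close>

lemma poly_bounded_interaction_div:
  assumes "k \<in> J" "j \<in> J" "j \<noteq> k"
  shows "poly_bounded J (\<lambda>x. interaction J x / (x k - x j))"
proof -
  define K where "K = J - {k}"
  have K: "finite K" "k \<notin> K" "J = insert k K" "j \<in> K" using assms finite_J by (auto simp: K_def)
  have eq: "(\<lambda>x. interaction J x / (x k - x j)) = (\<lambda>x. interaction K x *
      ((q k j (x k - x j) / (x k - x j)) * (\<Prod>l\<in>K - {j}. q k l (x k - x l))))"
    unfolding K(3) interaction_insert[OF K(1,2)] prod.remove[OF K(1,4)] by simp
  show ?thesis
    unfolding eq using assms K
    by (intro poly_bounded_mult poly_bounded_interaction poly_bounded_prod poly_bounded_q) auto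
qed

lemma interaction_slice_deriv:
  assumes "k \<in> J" "\<And>j. j \<in> J - {k} \<Longrightarrow> y \<noteq> x j"
  shows "((\<lambda>y. interaction J (x(k := y))) has_real_derivative
    interaction J (x(k := y)) * (\<Sum>j\<in>J - {k}. \<beta> / (y - x j))) (at y)"
proof -
  define K where "K = J - {k}"
  have K: "finite K" "k \<notin> K" "J = insert k K" using assms finite_J by (auto simp: K_def)
  have eq: "interaction J (x(k := y)) = interaction K x * (\<Prod>j\<in>K. q k j (y - x j))" for y
  proof -
    have "(\<Prod>j\<in>K. q k j ((x(k := y)) k - (x(k := y)) j)) = (\<Prod>j\<in>K. q k j (y - x j))"
      using K(2) by (intro prod.cong) auto
    then show ?thesis unfolding K(3) interaction_insert[OF K(1,2)] interaction_upd[OF K(2)] by simp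
  qed
  have "((\<lambda>y. \<Prod>j\<in>K. q k j (y - x j)) has_real_derivative
      (\<Sum>j\<in>K. (\<beta> / (y - x j) * q k j (y - x j)) * (\<Prod>l\<in>K - {j}. q k l (y - x l)))) (at y)"
  proof (rule has_field_derivative_prod)
    fix j assume "j \<in> K"
    then have "y - x j \<noteq> 0" using assms(2) by (auto simp: K_def)
    have "((\<lambda>y. y - x j) has_real_derivative 1) (at y)" by (auto intro!: derivative_eq_intros)
    from DERIV_chain2[where f = "q k j" and g = "\<lambda>y. y - x j", OF q_deriv[OF \<open>y - x j \<noteq> 0\<close>] this]
    show "((\<lambda>y. q k j (y - x j)) has_real_derivative \<beta> / (y - x j) * q k j (y - x j)) (at y)"
      by simp
  qed
  also have "(\<Sum>j\<in>K. (\<beta> / (y - x j) * q k j (y - x j)) * (\<Prod>l\<in>K - {j}. q k l (y - x l)))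
      = (\<Prod>j\<in>K. q k j (y - x j)) * (\<Sum>j\<in>K. \<beta> / (y - x j))"
    unfolding sum_distrib_left
    by (intro sum.cong refl) (simp add: prod.remove[OF K(1)] mult_ac)
  finally have "((\<lambda>y. interaction K x * (\<Prod>j\<in>K. q k j (y - x j))) has_real_derivative
      interaction K x * ((\<Prod>j\<in>K. q k j (y - x j)) * (\<Sum>j\<in>K. \<beta> / (y - x j)))) (at y)"
    by (rule DERIV_cmult)
  then show ?thesis unfolding eq K_def[symmetric] by (simp add: mult.assoc)
qed

lemma interaction_slice_cont: "continuous_on UNIV (\<lambda>y. interaction J (x(k := y)))"
proof -
  have "continuous_on UNIV (\<lambda>y. q i j ((x(k := y)) i - (x(k := y)) j))" for i j
  proof (rule continuous_on_compose2[of UNIV "q i j"])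
    show "continuous_on UNIV (\<lambda>y. (x(k := y)) i - (x(k := y)) j)"
      by (cases "i = k"; cases "j = k") (auto intro!: continuous_intros)
  qed (auto simp: continuous_on_eq_continuous_at q_cont)
  then show ?thesis unfolding interaction_def by (intro continuous_on_prod)
qed

definition gibbs_weight :: "(nat \<Rightarrow> real) \<Rightarrow> real" where
  "gibbs_weight x = interaction J x * gauss J (\<beta> / 4) x"

lemma gibbs_weight_nonneg: "0 \<le> gibbs_weight x"
  by (simp add: gibbs_weight_def interaction_nonneg gauss_pos less_imp_le)

lemma poly_bounded_integrable:
  assumes "poly_bounded J f"
  shows "integrable (Pi\<^sub>M J (\<lambda>_. lborel)) (\<lambda>x. f x * gibbs_weight x)"
  using poly_bounded_gauss_integrable[OF finite_J _ poly_bounded_mult[OF assms poly_bounded_interaction[OF subset_refl]], of "\<beta> / 4"]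
    beta_ge_1 by (simp add: gibbs_weight_def mult.assoc)

lemma poly_bounded_integrable_div:
  assumes "poly_bounded J f" "k \<in> J" "j \<in> J" "j \<noteq> k"
  shows "integrable (Pi\<^sub>M J (\<lambda>_. lborel)) (\<lambda>x. f x / (x k - x j) * gibbs_weight x)"
  using poly_bounded_gauss_integrable[OF finite_J _ poly_bounded_mult[OF assms(1) poly_bounded_interaction_div[OF assms(2-4)]], of "\<beta> / 4"]
    beta_ge_1 by (simp add: gibbs_weight_def mult_ac)

text \<open>The elementary loop equation: the field is \<open>f\<close> in direction \<open>k\<close>. The logarithmic derivative of
  the weight is the pair force minus the linear confining force.\<close>

lemma integration_by_parts:
  assumes k: "k \<in> J" and f: "poly_bounded J f" and f': "poly_bounded J f'"
    and cont: "\<And>x. continuous_on UNIV (\<lambda>y. f (x(k := y)))"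
    and deriv: "\<And>x. \<exists>S. finite S \<and>
      (\<forall>y. y \<notin> S \<longrightarrow> ((\<lambda>y. f (x(k := y))) has_real_derivative f' (x(k := y))) (at y))"
  shows "has_bochner_integral (Pi\<^sub>M J (\<lambda>_. lborel))
    (\<lambda>x. (f' x + f x * (\<beta> * (\<Sum>j\<in>J - {k}. 1 / (x k - x j)) - \<beta> / 2 * x k)) * gibbs_weight x) 0"
proof -
  let ?f = "\<lambda>x. f x * interaction J x"
  let ?f' = "\<lambda>x. f' x * interaction J x + f x * (\<Sum>j\<in>J - {k}. \<beta> * (interaction J x / (x k - x j)))"
  have "has_bochner_integral (Pi\<^sub>M J (\<lambda>_. lborel)) (\<lambda>x. (?f' x - 2 * (\<beta> / 4) * x k * ?f x) * gauss J (\<beta> / 4) x) 0"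
  proof (rule gaussian_integration_by_parts[OF finite_J k])
    show "poly_bounded J ?f" by (intro poly_bounded_mult f poly_bounded_interaction subset_refl)
    show "poly_bounded J ?f'"
      using k by (intro poly_bounded_add poly_bounded_mult f f' poly_bounded_interaction subset_refl
        poly_bounded_sum poly_bounded_const poly_bounded_interaction_div) auto
    show "continuous_on UNIV (\<lambda>y. ?f (x(k := y)))" for x
      by (intro continuous_on_mult cont interaction_slice_cont)
    fix x
    from deriv[of x] obtain S where S: "finite S"
      "\<And>y. y \<notin> S \<Longrightarrow> ((\<lambda>y. f (x(k := y))) has_real_derivative f' (x(k := y))) (at y)" by blast
    show "\<exists>S. finite S \<and> (\<forall>y. y \<notin> S \<longrightarrow> ((\<lambda>y. ?f (x(k := y))) has_real_derivative ?f' (x(k := y))) (at y))"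
    proof (intro exI conjI allI impI)
      show "finite (S \<union> x ` J)" using S finite_J by simp
      fix y assume y: "y \<notin> S \<union> x ` J"
      have "(\<Sum>j\<in>J - {k}. \<beta> * (interaction J (x(k := y)) / ((x(k := y)) k - (x(k := y)) j)))
          = interaction J (x(k := y)) * (\<Sum>j\<in>J - {k}. \<beta> / (y - x j))"
        unfolding sum_distrib_left by (intro sum.cong) auto
      then show "((\<lambda>y. ?f (x(k := y))) has_real_derivative ?f' (x(k := y))) (at y)"
        using y by (intro DERIV_cong[OF DERIV_mult'[OF S(2) interaction_slice_deriv[OF k]]]) auto
    qed
  qed (use beta_ge_1 in auto)
  moreover have "(?f' x - 2 * (\<beta> / 4) * x k * ?f x) * gauss J (\<beta> / 4) x
      = (f' x + f x * (\<beta> * (\<Sum>j\<in>J - {k}. 1 / (x k - x j)) - \<beta> / 2 * x k)) * gibbs_weight x" for x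
  proof -
    have "(\<Sum>j\<in>J - {k}. \<beta> * (interaction J x / (x k - x j))) = interaction J x * (\<beta> * (\<Sum>j\<in>J - {k}. 1 / (x k - x j)))"
      unfolding sum_distrib_left by (intro sum.cong) auto
    then show ?thesis by (simp add: gibbs_weight_def algebra_simps)
  qed
  ultimately show ?thesis by simp
qed

end

section \<open>Sums of pair forces, resolvents and a Riccati inequality\<close>

lemma sum_antisymmetric_eq_0:
  fixes f :: "'a \<Rightarrow> 'a \<Rightarrow> real"
  assumes "\<And>i j. f i j = - f j i"
  shows "(\<Sum>i\<in>K. \<Sum>j\<in>K. f i j) = 0"
proof -
  have "(\<Sum>i\<in>K. \<Sum>j\<in>K. f i j) = (\<Sum>j\<in>K. \<Sum>i\<in>K. f i j)" by (rule sum.swap)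
  also have "\<dots> = (\<Sum>j\<in>K. \<Sum>i\<in>K. - f j i)" by (intro sum.cong refl) (rule assms)
  also have "\<dots> = - (\<Sum>i\<in>K. \<Sum>j\<in>K. f i j)" by (simp add: sum_negf)
  finally show ?thesis by simp
qed

text \<open>Action equals reaction. The convention \<open>1 / 0 = 0\<close> makes this hold for coinciding points as well.\<close>

lemma sum_pair_forces_eq_0:
  fixes x :: "'a \<Rightarrow> real"
  assumes "finite K"
  shows "(\<Sum>i\<in>K. \<Sum>j\<in>K - {i}. 1 / (x i - x j)) = 0"
proof -
  have "(\<Sum>i\<in>K. \<Sum>j\<in>K - {i}. 1 / (x i - x j)) = (\<Sum>i\<in>K. \<Sum>j\<in>K. 1 / (x i - x j))"
  proof (rule sum.cong[OF refl])
    fix i assume "i \<in> K"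
    then show "(\<Sum>j\<in>K - {i}. 1 / (x i - x j)) = (\<Sum>j\<in>K. 1 / (x i - x j))"
      using sum.remove[OF assms, of i "\<lambda>j. 1 / (x i - x j)"] by simp
  qed
  also have "\<dots> = 0"
    by (rule sum_antisymmetric_eq_0) (metis divide_minus_right minus_diff_eq)
  finally show ?thesis .
qed

text \<open>The hypothesis on \<open>a\<close> is the resolvent identity, satisfied by \<open>a i = 1 / (z - x i)\<close>. Symmetrising in \<open>i\<close> and
  \<open>j\<close> turns each singular quotient \<open>(a i - a j) / (x i - x j)\<close> into the product \<open>a i * a j\<close>.\<close>

lemma sum_resolvent_pair_forces:
  fixes x a :: "'a \<Rightarrow> real"
  assumes K: "finite K" and inj: "inj_on x K"
    and a: "\<And>i j. i \<in> K \<Longrightarrow> j \<in> K \<Longrightarrow> a i - a j = (x i - x j) * (a i * a j)"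
  shows "(\<Sum>i\<in>K. a i * (\<Sum>j\<in>K - {i}. 1 / (x i - x j))) = ((\<Sum>i\<in>K. a i)\<^sup>2 - (\<Sum>i\<in>K. (a i)\<^sup>2)) / 2"
proof -
  let ?f = "\<lambda>i j. a i / (x i - x j)"
  let ?T = "\<Sum>i\<in>K. \<Sum>j\<in>K. ?f i j"
  have "(\<Sum>i\<in>K. a i * (\<Sum>j\<in>K - {i}. 1 / (x i - x j))) = ?T"
  proof (intro sum.cong refl)
    fix i assume "i \<in> K"
    then show "a i * (\<Sum>j\<in>K - {i}. 1 / (x i - x j)) = (\<Sum>j\<in>K. ?f i j)"
      using sum.remove[OF K, of i "?f i"] by (simp add: sum_distrib_left)
  qed
  moreover have "2 * ?T = (\<Sum>i\<in>K. a i)\<^sup>2 - (\<Sum>i\<in>K. (a i)\<^sup>2)"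
  proof -
    have "2 * ?T = ?T + (\<Sum>j\<in>K. \<Sum>i\<in>K. ?f i j)" using sum.swap[of ?f K K] by simp
    also have "\<dots> = (\<Sum>i\<in>K. \<Sum>j\<in>K. ?f i j + ?f j i)" by (simp add: sum.distrib)
    also have "\<dots> = (\<Sum>i\<in>K. \<Sum>j\<in>K. a i * a j - (if j = i then (a i)\<^sup>2 else 0))"
    proof (intro sum.cong refl)
      fix i j assume ij: "i \<in> K" "j \<in> K"
      show "?f i j + ?f j i = a i * a j - (if j = i then (a i)\<^sup>2 else 0)"
      proof (cases "j = i")
        case False
        then have ne: "x i - x j \<noteq> 0" using inj ij by (auto simp: inj_on_def)
        have "?f j i = - (a j / (x i - x j))" by (metis divide_minus_right minus_diff_eq)
        then have "?f i j + ?f j i = (a i - a j) / (x i - x j)" by (simp add: diff_divide_distrib)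
        also have "\<dots> = a i * a j" using a[OF ij] ne by simp
        finally show ?thesis using False by simp
      qed (simp add: power2_eq_square)
    qed
    also have "\<dots> = (\<Sum>i\<in>K. a i)\<^sup>2 - (\<Sum>i\<in>K. (a i)\<^sup>2)"
      using K by (simp add: sum_subtractf power2_eq_square sum_product)
    finally show ?thesis .
  qed
  ultimately show ?thesis by simp
qed

text \<open>Gives differentiability of integrals that depend on a parameter, with an error estimate that passes
  through the integral.\<close>

lemma DERIV_from_quadratic_error:
  fixes f :: "real \<Rightarrow> real"
  assumes "0 < r" "\<And>h. \<bar>h\<bar> < r \<Longrightarrow> \<bar>f (x + h) - f x - h * D\<bar> \<le> C * h\<^sup>2"
  shows "(f has_real_derivative D) (at x)"
proof -
  have "((\<lambda>h. (f (x + h) - f x) / h - D) \<longlongrightarrow> 0) (at 0)"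
  proof (rule Lim_null_comparison)
    show "\<forall>\<^sub>F h in at 0. norm ((f (x + h) - f x) / h - D) \<le> C * \<bar>h\<bar>"
      unfolding eventually_at
    proof (intro exI conjI ballI impI)
      fix h :: real assume h: "h \<noteq> 0 \<and> dist h 0 < r"
      then have "\<bar>f (x + h) - f x - h * D\<bar> / \<bar>h\<bar> \<le> C * h\<^sup>2 / \<bar>h\<bar>"
        by (intro divide_right_mono assms(2)) auto
      moreover have "(f (x + h) - f x) / h - D = (f (x + h) - f x - h * D) / h"
        using h by (simp add: field_simps)
      moreover have "C * h\<^sup>2 / \<bar>h\<bar> = C * \<bar>h\<bar>" using h by (simp add: power2_eq_square abs_if)
      ultimately show "norm ((f (x + h) - f x) / h - D) \<le> C * \<bar>h\<bar>" by (simp add: abs_divide)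
    qed (use assms in auto)
    show "((\<lambda>h. C * \<bar>h\<bar>) \<longlongrightarrow> 0) (at 0)"
      by (intro tendsto_mult_right_zero tendsto_rabs_zero tendsto_ident_at)
  qed
  then show ?thesis
    unfolding DERIV_def by (rule LIM_zero_cancel)
qed

text \<open>The derivative of \<open>arctan (f / c)\<close> is at most \<open>- c\<close>, while \<open>arctan\<close> takes its values in an interval of length \<open>\<pi>\<close>.\<close>

lemma riccati_blow_up:
  fixes f f' :: "real \<Rightarrow> real"
  assumes "a \<le> b" and c: "0 < c"
    and deriv: "\<And>x. a \<le> x \<Longrightarrow> x \<le> b \<Longrightarrow> (f has_real_derivative f' x) (at x)"
    and le: "\<And>x. a \<le> x \<Longrightarrow> x \<le> b \<Longrightarrow> f' x \<le> - ((f x)\<^sup>2 + c\<^sup>2)"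
  shows "c * (b - a) < pi"
proof -
  let ?g = "\<lambda>x. arctan (f x / c) + c * x"
  have "?g b \<le> ?g a"
  proof (rule DERIV_nonpos_imp_nonincreasing[OF assms(1)])
    fix x assume x: "a \<le> x" "x \<le> b"
    have pos: "0 < (f x)\<^sup>2 + c\<^sup>2" using c by (simp add: add_nonneg_pos)
    have "(?g has_real_derivative f' x / c / (1 + (f x / c)\<^sup>2) + c) (at x)"
      using deriv[OF x] c by (auto intro!: derivative_eq_intros simp: field_simps)
    moreover have "f' x / c / (1 + (f x / c)\<^sup>2) + c = c * ((f' x + ((f x)\<^sup>2 + c\<^sup>2)) / ((f x)\<^sup>2 + c\<^sup>2))"
      using c pos by (simp add: field_simps power2_eq_square)
    moreover have "c * ((f' x + ((f x)\<^sup>2 + c\<^sup>2)) / ((f x)\<^sup>2 + c\<^sup>2)) \<le> 0"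
      using c pos le[OF x] by (intro mult_nonneg_nonpos divide_nonpos_pos) auto
    ultimately show "\<exists>y. (?g has_real_derivative y) (at x) \<and> y \<le> 0" by auto
  qed
  then show ?thesis
    using arctan_bounded[of "f a / c"] arctan_bounded[of "f b / c"] by (simp add: algebra_simps)
qed

text \<open>On points \<open>y \<le> t\<close> this is the resolvent \<open>1 / (z - y)\<close> with \<open>z = t + d\<close>. It is extended by a constant beyond
  \<open>t\<close>, which keeps it bounded and continuous.\<close>

definition resolvent :: "real \<Rightarrow> real \<Rightarrow> real \<Rightarrow> real" where
  "resolvent t d y = 1 / (d + max 0 (t - y))"

lemma resolvent_pos: "0 < d \<Longrightarrow> 0 < resolvent t d y"
  by (simp add: resolvent_def)

lemma resolvent_le: "0 < d \<Longrightarrow> resolvent t d y \<le> 1 / d"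
  by (simp add: resolvent_def frac_le)

definition resolvent_slope :: "real \<Rightarrow> real \<Rightarrow> real \<Rightarrow> real" where
  "resolvent_slope t d y = (if y < t then (resolvent t d y)\<^sup>2 else 0)"

lemma resolvent_cont: "0 < d \<Longrightarrow> continuous_on UNIV (resolvent t d)"
  unfolding resolvent_def by (intro continuous_intros) (auto simp: add_pos_nonneg less_imp_neq[symmetric])

lemma resolvent_deriv:
  assumes d: "0 < d" and "y \<noteq> t"
  shows "(resolvent t d has_real_derivative resolvent_slope t d y) (at y)"
proof -
  consider "y < t" | "t < y" using assms(2) by fastforce
  then show ?thesis
  proof cases
    case 1
    have "((\<lambda>y. 1 / (d + (t - y))) has_real_derivative (1 / (d + (t - y)))\<^sup>2) (at y)"
      using 1 d by (auto intro!: derivative_eq_intros simp: power2_eq_square field_simps)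
    then show ?thesis
      by (rule has_field_derivative_transform_within_open[where S = "{..<t}", THEN DERIV_cong])
         (use 1 in \<open>auto simp: resolvent_def resolvent_slope_def\<close>)
  next
    case 2
    have "((\<lambda>y. 1 / d) has_real_derivative 0) (at y)" by simp
    then show ?thesis
      by (rule has_field_derivative_transform_within_open[where S = "{t<..}", THEN DERIV_cong])
         (use 2 in \<open>auto simp: resolvent_def resolvent_slope_def\<close>)
  qed
qed

section \<open>The loop equation for particles behind a wall\<close>

context pair_interaction
begin

definition weighted_integral :: "((nat \<Rightarrow> real) \<Rightarrow> real) \<Rightarrow> real" where
  "weighted_integral f = (LINT x|Pi\<^sub>M J (\<lambda>_. lborel). f x * gibbs_weight x)"

lemma weighted_integral_add:
  "poly_bounded J f \<Longrightarrow> poly_bounded J g \<Longrightarrow> weighted_integral (\<lambda>x. f x + g x) = weighted_integral f + weighted_integral g"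
  unfolding weighted_integral_def by (simp add: distrib_right poly_bounded_integrable)

lemma weighted_integral_diff:
  "poly_bounded J f \<Longrightarrow> poly_bounded J g \<Longrightarrow> weighted_integral (\<lambda>x. f x - g x) = weighted_integral f - weighted_integral g"
  unfolding weighted_integral_def by (simp add: left_diff_distrib poly_bounded_integrable)

lemma weighted_integral_cmult: "weighted_integral (\<lambda>x. c * f x) = c * weighted_integral f"
  unfolding weighted_integral_def by (simp add: mult.assoc)

lemma weighted_integral_mono:
  assumes "poly_bounded J f" "poly_bounded J g" "\<And>x. f x \<le> g x"
  shows "weighted_integral f \<le> weighted_integral g"
  unfolding weighted_integral_def using assms
  by (intro integral_mono poly_bounded_integrable mult_right_mono gibbs_weight_nonneg) auto

text \<open>The kernel vanishes at \<open>0\<close>, so coinciding particles carry no weight and the pointwise identities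
  below may assume distinct points.\<close>

lemma gibbs_weight_support:
  assumes "gibbs_weight x \<noteq> 0" shows "inj_on x J"
proof (rule inj_onI, rule ccontr)
  fix i j assume ij: "i \<in> J" "j \<in> J" "x i = x j" "i \<noteq> j"
  have "interaction J x = interaction (J - {i}) x * (\<Prod>j\<in>J - {i}. q i j (x i - x j))"
    using interaction_insert[of "J - {i}" i x] finite_J ij by (simp add: insert_absorb)
  moreover have "(\<Prod>j\<in>J - {i}. q i j (x i - x j)) = 0"
    using ij finite_J by (intro prod_zero bexI[of _ j]) (auto simp: q_0)
  ultimately show False using assms by (simp add: gibbs_weight_def)
qed

definition below :: "real \<Rightarrow> (nat \<Rightarrow> real) \<Rightarrow> real" where
  "below t x = (\<Prod>i\<in>J. if x i \<le> t then 1 else 0)"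

lemma below_eq: "below t x = (if \<forall>i\<in>J. x i \<le> t then 1 else 0)"
  unfolding below_def using finite_J by (auto intro: prod.neutral prod_zero)

lemma poly_bounded_step: "i \<in> J \<Longrightarrow> poly_bounded J (\<lambda>x. if x i \<le> t then 1 else 0)"
  by (rule poly_bounded_bounded[where C = 1])
     (auto intro!: measurable_If borel_measurable_le measurable_coordinate)

lemma poly_bounded_below: "poly_bounded J (below t)"
  unfolding below_def by (intro poly_bounded_prod poly_bounded_step)

lemma poly_bounded_resolvent:
  assumes "0 < d" "i \<in> J" shows "poly_bounded J (\<lambda>x. resolvent t d (x i))"
proof (rule poly_bounded_bounded[where C = "1 / d"])
  show "(\<lambda>x. resolvent t d (x i)) \<in> borel_measurable (Pi\<^sub>M J (\<lambda>_. lborel))"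
    unfolding resolvent_def
    by (intro borel_measurable_divide borel_measurable_add borel_measurable_max borel_measurable_diff
        borel_measurable_const measurable_coordinate assms)
qed (use resolvent_pos[OF assms(1)] resolvent_le[OF assms(1)] in \<open>simp add: less_imp_le\<close>)

text \<open>The field \<open>1 - d / (z - y)\<close> with \<open>z = t + d\<close> vanishes at \<open>y = t\<close>. It can therefore be cut off at
  the wall without losing continuity, and the wall contributes no boundary term.\<close>

lemma wall_field_ibp:
  assumes d: "0 < d" and k: "k \<in> J"
  shows "has_bochner_integral (Pi\<^sub>M J (\<lambda>_. lborel))
    (\<lambda>x. (- d * (resolvent t d (x k))\<^sup>2 * below t x + (1 - d * resolvent t d (x k)) * below t x *
       (\<beta> * (\<Sum>j\<in>J - {k}. 1 / (x k - x j)) - \<beta> / 2 * x k)) * gibbs_weight x) 0"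
proof (rule integration_by_parts[OF k])
  show "poly_bounded J (\<lambda>x. (1 - d * resolvent t d (x k)) * below t x)"
    by (intro poly_bounded_mult poly_bounded_diff poly_bounded_const poly_bounded_resolvent poly_bounded_below d k)
  show "poly_bounded J (\<lambda>x. - d * (resolvent t d (x k))\<^sup>2 * below t x)"
    by (intro poly_bounded_mult poly_bounded_power poly_bounded_const poly_bounded_resolvent poly_bounded_below d k)
  fix x :: "nat \<Rightarrow> real"
  define c :: real where "c = (\<Prod>i\<in>J - {k}. if x i \<le> t then 1 else 0)"
  have below: "below t (x(k := y)) = (if y \<le> t then 1 else 0) * c" for y
    unfolding below_def c_def prod.remove[OF finite_J k] by (intro arg_cong2[where f = "(*)"] prod.cong) auto
  have f: "(1 - d * resolvent t d ((x(k := y)) k)) * below t (x(k := y))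
      = (max 0 (t - y) / (d + max 0 (t - y))) * c" for y
    using d unfolding below by (auto simp: resolvent_def field_simps max_def)
  show "continuous_on UNIV (\<lambda>y. (1 - d * resolvent t d ((x(k := y)) k)) * below t (x(k := y)))"
    unfolding f using d by (intro continuous_intros) (auto simp: add_pos_nonneg less_imp_neq[symmetric])
  show "\<exists>S. finite S \<and> (\<forall>y. y \<notin> S \<longrightarrow>
      ((\<lambda>y. (1 - d * resolvent t d ((x(k := y)) k)) * below t (x(k := y))) has_real_derivative
        - d * (resolvent t d ((x(k := y)) k))\<^sup>2 * below t (x(k := y))) (at y))"
  proof (intro exI[of _ "{t}"] conjI allI impI)
    fix y assume "y \<notin> {t}"
    then consider "y < t" | "t < y" by fastforce
    then show "((\<lambda>y. (1 - d * resolvent t d ((x(k := y)) k)) * below t (x(k := y))) has_real_derivative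
        - d * (resolvent t d ((x(k := y)) k))\<^sup>2 * below t (x(k := y))) (at y)"
    proof cases
      case 1
      have "((\<lambda>y. ((t - y) / (d + (t - y))) * c) has_real_derivative - d * (1 / (d + (t - y)))\<^sup>2 * c) (at y)"
        using 1 d by (auto intro!: derivative_eq_intros simp: power2_eq_square field_simps)
      then show ?thesis unfolding f unfolding below
        by (rule has_field_derivative_transform_within_open[where S = "{..<t}", THEN DERIV_cong])
           (use 1 in \<open>auto simp: resolvent_def\<close>)
    next
      case 2
      have "((\<lambda>y. 0) has_real_derivative 0) (at y)" by simp
      then show ?thesis unfolding f unfolding below
        by (rule has_field_derivative_transform_within_open[where S = "{t<..}", THEN DERIV_cong])
           (use 2 in \<open>auto simp: resolvent_def\<close>)
    qed
  qed simp
qed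

text \<open>Sum of the preceding identities over all particles, divided by \<open>- d * \<beta> / 2\<close>. The pair forces
  contribute through \<open>sum_resolvent_pair_forces\<close> for the resolvent part and cancel for the constant part of the field.\<close>

lemma wall_loop_equation:
  assumes d: "0 < d"
  shows "weighted_integral (\<lambda>x. below t x * ((2 / \<beta> - 1) * (\<Sum>i\<in>J. (resolvent t d (x i))\<^sup>2)
      + (\<Sum>i\<in>J. resolvent t d (x i))\<^sup>2 - (t + d) * (\<Sum>i\<in>J. resolvent t d (x i))
      + real (card J) + (\<Sum>i\<in>J. x i) / d)) = 0"
proof -
  let ?a = "\<lambda>x i. resolvent t d (x i)"
  let ?X = "\<lambda>k x. (- d * (?a x k)\<^sup>2 * below t x + (1 - d * ?a x k) * below t x *
       (\<beta> * (\<Sum>j\<in>J - {k}. 1 / (x k - x j)) - \<beta> / 2 * x k)) * gibbs_weight x"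
  have hb: "has_bochner_integral (Pi\<^sub>M J (\<lambda>_. lborel)) (\<lambda>x. (- 2 / (d * \<beta>)) * (\<Sum>k\<in>J. ?X k x))
      ((- 2 / (d * \<beta>)) * (\<Sum>k\<in>J. 0))"
    using wall_field_ibp[OF d] by (intro has_bochner_integral_mult_right has_bochner_integral_sum) auto
  have eq: "(- 2 / (d * \<beta>)) * (\<Sum>k\<in>J. ?X k x) =
      below t x * ((2 / \<beta> - 1) * (\<Sum>i\<in>J. (?a x i)\<^sup>2) + (\<Sum>i\<in>J. ?a x i)\<^sup>2
        - (t + d) * (\<Sum>i\<in>J. ?a x i) + real (card J) + (\<Sum>i\<in>J. x i) / d) * gibbs_weight x" for x
  proof (cases "gibbs_weight x = 0 \<or> below t x = 0")
    case True
    then show ?thesis by auto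
  next
    case False
    then have inj: "inj_on x J" and b: "below t x = 1" and le: "\<And>i. i \<in> J \<Longrightarrow> x i \<le> t"
      using gibbs_weight_support by (auto simp: below_eq split: if_splits)
    have a: "?a x i * (t + d - x i) = 1" if "i \<in> J" for i
      using le[OF that] d by (simp add: resolvent_def field_simps)
    let ?F = "\<lambda>k. \<Sum>j\<in>J - {k}. 1 / (x k - x j)"
    let ?S = "\<Sum>i\<in>J. ?a x i" and ?S2 = "\<Sum>i\<in>J. (?a x i)\<^sup>2"
    have 1: "(\<Sum>k\<in>J. ?F k) = 0" by (rule sum_pair_forces_eq_0[OF finite_J])
    have 2: "(\<Sum>k\<in>J. ?a x k * ?F k) = (?S\<^sup>2 - ?S2) / 2"
    proof (rule sum_resolvent_pair_forces[OF finite_J inj])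
      fix i j assume "i \<in> J" "j \<in> J"
      then show "?a x i - ?a x j = (x i - x j) * (?a x i * ?a x j)"
        using a[of i] a[of j] by algebra
    qed
    have 3: "(\<Sum>k\<in>J. ?a x k * x k) = (t + d) * ?S - real (card J)"
    proof -
      have "?a x k * x k = (t + d) * ?a x k - 1" if "k \<in> J" for k
        using a[OF that] by (simp add: algebra_simps)
      then show ?thesis by (simp add: sum_subtractf sum_distrib_left)
    qed
    have "(\<Sum>k\<in>J. - d * (?a x k)\<^sup>2 * below t x + (1 - d * ?a x k) * below t x * (\<beta> * ?F k - \<beta> / 2 * x k))
      = (\<Sum>k\<in>J. - d * (?a x k)\<^sup>2 + \<beta> * ?F k - \<beta> / 2 * x k - d * \<beta> * (?a x k * ?F k)
          + d * \<beta> / 2 * (?a x k * x k))"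
      unfolding b by (intro sum.cong refl) (simp add: algebra_simps)
    also have "\<dots> = - d * ?S2 + \<beta> * (\<Sum>k\<in>J. ?F k) - \<beta> / 2 * (\<Sum>k\<in>J. x k) - d * \<beta> * (\<Sum>k\<in>J. ?a x k * ?F k)
          + d * \<beta> / 2 * (\<Sum>k\<in>J. ?a x k * x k)"
      by (simp only: sum.distrib sum_subtractf sum_distrib_left)
    also have "\<dots> = - d * ?S2 - \<beta> / 2 * (\<Sum>k\<in>J. x k) - d * \<beta> * ((?S\<^sup>2 - ?S2) / 2)
          + d * \<beta> / 2 * ((t + d) * ?S - real (card J))"
      unfolding 1 2 3 by simp
    finally have sum: "(\<Sum>k\<in>J. ?X k x) = (- d * ?S2 - \<beta> / 2 * (\<Sum>k\<in>J. x k) - d * \<beta> * ((?S\<^sup>2 - ?S2) / 2)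
          + d * \<beta> / 2 * ((t + d) * ?S - real (card J))) * gibbs_weight x"
      by (simp only: sum_distrib_right[symmetric])
    show ?thesis
      unfolding sum unfolding b using d beta_ge_1 by (simp add: field_simps)
  qed
  have "has_bochner_integral (Pi\<^sub>M J (\<lambda>_. lborel)) (\<lambda>x. below t x *
      ((2 / \<beta> - 1) * (\<Sum>i\<in>J. (?a x i)\<^sup>2) + (\<Sum>i\<in>J. ?a x i)\<^sup>2
        - (t + d) * (\<Sum>i\<in>J. ?a x i) + real (card J) + (\<Sum>i\<in>J. x i) / d) * gibbs_weight x) 0"
    using hb by (simp only: eq sum.neutral_const mult_zero_right)
  then show ?thesis
    unfolding weighted_integral_def by (rule has_bochner_integral_integral_eq)
qed

lemma weighted_integral_abs_le:
  assumes "poly_bounded J f" "poly_bounded J g" "\<And>x. \<bar>f x\<bar> \<le> g x"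
  shows "\<bar>weighted_integral f\<bar> \<le> weighted_integral g"
proof -
  have "weighted_integral f \<le> weighted_integral g"
    using assms by (intro weighted_integral_mono) (auto intro: order_trans[OF abs_ge_self])
  moreover have "weighted_integral (\<lambda>x. - 1 * f x) \<le> weighted_integral g"
    using assms by (intro weighted_integral_mono poly_bounded_mult poly_bounded_const) (auto intro: order_trans[OF abs_ge_minus_self])
  ultimately show ?thesis unfolding weighted_integral_cmult by simp
qed

lemmas poly_bounded_intros =
  poly_bounded_add poly_bounded_diff poly_bounded_mult poly_bounded_const poly_bounded_power
  poly_bounded_sum

lemma poly_bounded_sum_resolvent:
  "0 < d \<Longrightarrow> poly_bounded J (\<lambda>x. \<Sum>i\<in>J. resolvent t d (x i))"
  by (intro poly_bounded_sum poly_bounded_resolvent)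

lemma poly_bounded_sum_resolvent_sq:
  "0 < d \<Longrightarrow> poly_bounded J (\<lambda>x. \<Sum>i\<in>J. (resolvent t d (x i))\<^sup>2)"
  by (intro poly_bounded_sum poly_bounded_power poly_bounded_resolvent)

lemma poly_bounded_sum_coordinates: "poly_bounded J (\<lambda>x. \<Sum>i\<in>J. x i)"
  by (intro poly_bounded_sum poly_bounded_coordinate finite_J)

lemma wall_stieltjes_deriv:
  assumes d: "0 < d"
  shows "((\<lambda>d. weighted_integral (\<lambda>x. below t x * (\<Sum>i\<in>J. resolvent t d (x i)))) has_real_derivative
    - weighted_integral (\<lambda>x. below t x * (\<Sum>i\<in>J. (resolvent t d (x i))\<^sup>2))) (at d)"
proof (rule DERIV_from_quadratic_error[where r = "d / 2"])
  let ?S = "\<lambda>d x. \<Sum>i\<in>J. resolvent t d (x i)" and ?S2 = "\<lambda>x. \<Sum>i\<in>J. (resolvent t d (x i))\<^sup>2"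
  define C where "C = real (card J) * ((1 / d)\<^sup>2 * (2 / d))"
  fix h :: real assume h: "\<bar>h\<bar> < d / 2"
  then have dh: "0 < d + h" by linarith
  have r: "\<bar>resolvent t (d + h) y - resolvent t d y + h * (resolvent t d y)\<^sup>2\<bar> \<le> h\<^sup>2 * ((1 / d)\<^sup>2 * (2 / d))" for y
  proof -
    define u where "u = d + max 0 (t - y)"
    have u: "0 < u" "0 < u + h" using d dh h by (auto simp: u_def)
    have "1 / v - 1 / u + (v - u) * (1 / u)\<^sup>2 = (v - u)\<^sup>2 * ((1 / u)\<^sup>2 * (1 / v))" if "v \<noteq> 0" for v
      using that u by (simp add: field_simps power2_eq_square)
    from this[of "u + h"] u have "1 / (u + h) - 1 / u + h * (1 / u)\<^sup>2 = h\<^sup>2 * ((1 / u)\<^sup>2 * (1 / (u + h)))"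
      by simp
    then have eq: "resolvent t (d + h) y - resolvent t d y + h * (resolvent t d y)\<^sup>2
        = h\<^sup>2 * ((resolvent t d y)\<^sup>2 * resolvent t (d + h) y)"
      by (simp add: resolvent_def u_def add_ac)
    have "resolvent t (d + h) y \<le> 2 / d"
    proof -
      have "1 / (d + h) \<le> 1 / (d / 2)" using d h by (intro divide_left_mono) auto
      then show ?thesis using resolvent_le[OF dh, of t y] by simp
    qed
    moreover have "(resolvent t d y)\<^sup>2 \<le> (1 / d)\<^sup>2"
      using resolvent_le[OF d] resolvent_pos[OF d] by (intro power_mono) (auto simp: less_imp_le)
    ultimately have "(resolvent t d y)\<^sup>2 * resolvent t (d + h) y \<le> (1 / d)\<^sup>2 * (2 / d)"
      using resolvent_pos[OF dh, of t y] by (intro mult_mono) auto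
    from mult_left_mono[OF this, of "h\<^sup>2"] show ?thesis
      unfolding eq using resolvent_pos[OF dh, of t y] by (simp add: abs_mult)
  qed
  have bound: "\<bar>below t x * ?S (d + h) x - below t x * ?S d x + h * (below t x * ?S2 x)\<bar> \<le> C * h\<^sup>2 * below t x" for x
  proof -
    have "\<bar>?S (d + h) x - ?S d x + h * ?S2 x\<bar>
        = \<bar>\<Sum>i\<in>J. resolvent t (d + h) (x i) - resolvent t d (x i) + h * (resolvent t d (x i))\<^sup>2\<bar>"
      by (simp add: sum.distrib sum_subtractf sum_distrib_left)
    also have "\<dots> \<le> (\<Sum>i\<in>J. h\<^sup>2 * ((1 / d)\<^sup>2 * (2 / d)))"
      by (rule order_trans[OF sum_abs sum_mono]) (rule r)
    finally have "\<bar>?S (d + h) x - ?S d x + h * ?S2 x\<bar> \<le> C * h\<^sup>2" by (simp add: C_def mult_ac)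
    then show ?thesis by (simp add: below_eq)
  qed
  have "\<bar>weighted_integral (\<lambda>x. below t x * ?S (d + h) x - below t x * ?S d x + h * (below t x * ?S2 x))\<bar>
      \<le> weighted_integral (\<lambda>x. C * h\<^sup>2 * below t x)"
    by (rule weighted_integral_abs_le[OF _ _ bound])
       (intro poly_bounded_intros poly_bounded_below poly_bounded_resolvent d dh; assumption)+
  also have "weighted_integral (\<lambda>x. below t x * ?S (d + h) x - below t x * ?S d x + h * (below t x * ?S2 x))
      = weighted_integral (\<lambda>x. below t x * ?S (d + h) x) - weighted_integral (\<lambda>x. below t x * ?S d x) + h * weighted_integral (\<lambda>x. below t x * ?S2 x)"
    using d dh by (simp add: weighted_integral_add weighted_integral_diff weighted_integral_cmult poly_bounded_add poly_bounded_diff poly_bounded_mult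
      poly_bounded_const poly_bounded_below poly_bounded_sum_resolvent poly_bounded_sum_resolvent_sq)
  finally show "\<bar>weighted_integral (\<lambda>x. below t x * ?S (d + h) x) - weighted_integral (\<lambda>x. below t x * ?S d x)
      - h * - weighted_integral (\<lambda>x. below t x * ?S2 x)\<bar> \<le> (C * weighted_integral (below t)) * h\<^sup>2"
    unfolding weighted_integral_cmult by (simp add: mult_ac)
qed (use d in simp)

text \<open>Mean of \<open>- \<Sum>\<^sub>i x\<^sub>i\<close> under the weight conditioned to lie below \<open>t\<close>: how far the wall pushes the particles to the left.\<close>

definition pressed_mean :: "real \<Rightarrow> real" where
  "pressed_mean t = - weighted_integral (\<lambda>x. below t x * (\<Sum>i\<in>J. x i)) / weighted_integral (below t)"

text \<open>Take means in the loop equation and bound the mean of the squared resolvent sum below by the square of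
  its mean. The coefficient of \<open>s2\<close> is \<open>1 - 2 / \<beta> \<le> 1\<close>. Since \<open>s2\<close> is minus the derivative of \<open>s\<close> in \<open>d\<close>,
  this is a Riccati inequality.\<close>

lemma wall_resolvent_riccati:
  assumes Q: "0 < weighted_integral (below t)" and d: "0 < d"
  defines "s \<equiv> weighted_integral (\<lambda>x. below t x * (\<Sum>i\<in>J. resolvent t d (x i))) / weighted_integral (below t)"
    and "s2 \<equiv> weighted_integral (\<lambda>x. below t x * (\<Sum>i\<in>J. (resolvent t d (x i))\<^sup>2)) / weighted_integral (below t)"
  shows "s\<^sup>2 - (t + d) * s + real (card J) - pressed_mean t / d \<le> s2"
proof -
  let ?Q = "weighted_integral (below t)" and ?n = "real (card J)"
  let ?b = "below t"
  let ?S = "\<lambda>x. \<Sum>i\<in>J. resolvent t d (x i)" and ?S2 = "\<lambda>x. \<Sum>i\<in>J. (resolvent t d (x i))\<^sup>2"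
  let ?X = "\<lambda>x. \<Sum>i\<in>J. x i"
  note pb = weighted_integral_add weighted_integral_diff weighted_integral_cmult poly_bounded_add poly_bounded_diff poly_bounded_mult poly_bounded_power
    poly_bounded_const poly_bounded_below poly_bounded_sum_resolvent[OF d] poly_bounded_sum_resolvent_sq[OF d]
    poly_bounded_sum_coordinates
  have E1: "weighted_integral (\<lambda>x. ?b x * ?S x) = s * ?Q" and E2: "weighted_integral (\<lambda>x. ?b x * ?S2 x) = s2 * ?Q"
    using Q by (simp_all add: s_def s2_def)
  have EX: "weighted_integral (\<lambda>x. ?b x * ?X x) = - pressed_mean t * ?Q"
    using Q by (simp add: pressed_mean_def)
  have "0 \<le> weighted_integral (\<lambda>x. ?b x * (?S x - s)\<^sup>2)"
    unfolding weighted_integral_def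
    by (intro integral_nonneg_AE AE_I2 mult_nonneg_nonneg gibbs_weight_nonneg) (auto simp: below_eq)
  also have "(\<lambda>x. ?b x * (?S x - s)\<^sup>2) = (\<lambda>x. ?b x * (?S x)\<^sup>2 - 2 * s * (?b x * ?S x) + s\<^sup>2 * ?b x)"
    by (simp add: fun_eq_iff power2_eq_square algebra_simps)
  also have "weighted_integral \<dots> = weighted_integral (\<lambda>x. ?b x * (?S x)\<^sup>2) - 2 * s * weighted_integral (\<lambda>x. ?b x * ?S x) + s\<^sup>2 * ?Q"
    by (simp add: pb)
  finally have jensen: "s\<^sup>2 * ?Q \<le> weighted_integral (\<lambda>x. ?b x * (?S x)\<^sup>2)"
    unfolding E1 by (simp add: power2_eq_square algebra_simps)
  have "0 = weighted_integral (\<lambda>x. ?b x * ((2 / \<beta> - 1) * ?S2 x + (?S x)\<^sup>2 - (t + d) * ?S x + ?n + ?X x / d))"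
    by (rule wall_loop_equation[OF d, symmetric])
  also have "(\<lambda>x. ?b x * ((2 / \<beta> - 1) * ?S2 x + (?S x)\<^sup>2 - (t + d) * ?S x + ?n + ?X x / d))
      = (\<lambda>x. (2 / \<beta> - 1) * (?b x * ?S2 x) + ?b x * (?S x)\<^sup>2 - (t + d) * (?b x * ?S x) + ?n * ?b x + (1 / d) * (?b x * ?X x))"
    by (simp add: fun_eq_iff algebra_simps)
  also have "weighted_integral \<dots> = (2 / \<beta> - 1) * weighted_integral (\<lambda>x. ?b x * ?S2 x) + weighted_integral (\<lambda>x. ?b x * (?S x)\<^sup>2)
      - (t + d) * weighted_integral (\<lambda>x. ?b x * ?S x) + ?n * ?Q + (1 / d) * weighted_integral (\<lambda>x. ?b x * ?X x)"
    by (simp only: pb)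
  also have "\<dots> \<ge> (2 / \<beta> - 1) * (s2 * ?Q) + s\<^sup>2 * ?Q - (t + d) * (s * ?Q) + ?n * ?Q + (1 / d) * (- pressed_mean t * ?Q)"
    unfolding E1 E2 EX using jensen by simp
  finally have "((2 / \<beta> - 1) * s2 + s\<^sup>2 - (t + d) * s + ?n - pressed_mean t / d) * ?Q \<le> 0"
    by (simp add: algebra_simps)
  then have "(2 / \<beta> - 1) * s2 + s\<^sup>2 - (t + d) * s + ?n - pressed_mean t / d \<le> 0"
    using Q by (simp add: mult_le_0_iff)
  moreover have "0 \<le> s2"
    unfolding s2_def weighted_integral_def
    by (intro divide_nonneg_nonneg integral_nonneg_AE AE_I2 mult_nonneg_nonneg gibbs_weight_nonneg sum_nonneg)
       (auto simp: below_eq)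
  then have "0 \<le> 2 / \<beta> * s2" using beta_ge_1 by simp
  ultimately show ?thesis by (simp add: algebra_simps)
qed

text \<open>After completing the square the Riccati inequality for \<open>s - (t + d) / 2\<close> has the form
  \<open>f' \<le> - (f\<^sup>2 + c\<^sup>2)\<close> on the whole window, which must then be short.\<close>

lemma wall_window_bound:
  assumes Q: "0 < weighted_integral (below t)" and c: "0 < c" and ab: "0 < a" "a \<le> b"
    and gap: "\<And>d. a \<le> d \<Longrightarrow> d \<le> b \<Longrightarrow> c\<^sup>2 \<le> real (card J) - (t + d)\<^sup>2 / 4 - pressed_mean t / d"
  shows "c * (b - a) < pi"
proof (rule riccati_blow_up[OF ab(2) c])
  let ?s = "\<lambda>d. weighted_integral (\<lambda>x. below t x * (\<Sum>i\<in>J. resolvent t d (x i))) / weighted_integral (below t)"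
  let ?s2 = "\<lambda>d. weighted_integral (\<lambda>x. below t x * (\<Sum>i\<in>J. (resolvent t d (x i))\<^sup>2)) / weighted_integral (below t)"
  fix d assume d: "a \<le> d" "d \<le> b"
  then have d0: "0 < d" using ab by simp
  show "((\<lambda>d. ?s d - (t + d) / 2) has_real_derivative - ?s2 d - 1 / 2) (at d)"
    using wall_stieltjes_deriv[OF d0, of t] Q by (auto intro!: derivative_eq_intros)
  have "(r - w / 2)\<^sup>2 = r\<^sup>2 - w * r + w\<^sup>2 / 4" for r w :: real
    by (simp add: power2_eq_square field_simps)
  from this[of "?s d" "t + d"]
  show "- ?s2 d - 1 / 2 \<le> - ((?s d - (t + d) / 2)\<^sup>2 + c\<^sup>2)"
    using wall_resolvent_riccati[OF Q d0] gap[OF d] by linarith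
qed

end

section \<open>Moving the wall: the lower tail\<close>

lemma distr_PiM_lborel_shift:
  fixes J :: "nat set"
  assumes J: "finite J"
  shows "distr (Pi\<^sub>M J (\<lambda>_. lborel :: real measure)) (Pi\<^sub>M J (\<lambda>_. lborel)) (\<lambda>x. \<lambda>i\<in>J. x i + h)
    = Pi\<^sub>M J (\<lambda>_. lborel)" (is "distr ?M ?M ?T = _")
proof -
  interpret product_sigma_finite "\<lambda>_ :: nat. lborel :: real measure"
    by unfold_locales
  have T: "?T \<in> measurable ?M ?M"
    by (rule measurable_restrict) (auto intro!: borel_measurable_add measurable_coordinate)
  show ?thesis
  proof (rule PiM_eqI[OF J])
    fix A :: "nat \<Rightarrow> real set" assume A: "\<And>i. i \<in> J \<Longrightarrow> A i \<in> sets lborel"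
    have shift: "(+) h -` A i \<in> sets lborel" "emeasure lborel ((+) h -` A i) = emeasure lborel (A i)"
      if "i \<in> J" for i
    proof -
      have m: "(+) h \<in> measurable lborel borel" by simp
      show "(+) h -` A i \<in> sets lborel" using measurable_sets[OF m, of "A i"] A[OF that] by simp
      have "emeasure lborel (A i) = emeasure (distr lborel borel ((+) h)) (A i)"
        by (simp add: lborel_distr_plus)
      then show "emeasure lborel ((+) h -` A i) = emeasure lborel (A i)"
        using A[OF that] by (simp add: emeasure_distr)
    qed
    have "?T -` Pi\<^sub>E J A \<inter> space ?M = Pi\<^sub>E J (\<lambda>i. (+) h -` A i)"
      by (auto simp: space_PiM PiE_iff extensional_def add.commute)
    then have "emeasure (distr ?M ?M ?T) (Pi\<^sub>E J A) = emeasure ?M (Pi\<^sub>E J (\<lambda>i. (+) h -` A i))"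
      using T A J by (subst emeasure_distr) (auto intro!: sets_PiM_I_finite)
    also have "\<dots> = (\<Prod>i\<in>J. emeasure lborel (A i))"
      using J shift by (subst emeasure_PiM) auto
    finally show "emeasure (distr ?M ?M ?T) (Pi\<^sub>E J A) = (\<Prod>i\<in>J. emeasure lborel (A i))" .
  qed simp
qed

context pair_interaction
begin

text \<open>Translation leaves the interaction unchanged and multiplies the Gaussian weight by
  \<open>exp (- (\<beta>/2) h \<Sum>x\<^sub>i - (\<beta>/4) n h\<^sup>2)\<close>; Jensen's inequality moves the mean into the exponent.\<close>

lemma weighted_integral_below_shift:
  assumes Q: "0 < weighted_integral (below t)"
  shows "weighted_integral (below t) * exp (\<beta> / 2 * h * pressed_mean t - \<beta> / 4 * real (card J) * h\<^sup>2) \<le> weighted_integral (below (t + h))"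
proof -
  let ?M = "Pi\<^sub>M J (\<lambda>_. lborel :: real measure)"
  let ?T = "\<lambda>x. \<lambda>i\<in>J. x i + h"
  let ?n = "real (card J)" and ?X = "\<lambda>x. \<Sum>i\<in>J. x i"
  define c where "c = exp (- (\<beta> / 4) * ?n * h\<^sup>2)"
  define m where "m = \<beta> / 2 * h * pressed_mean t"
  let ?e = "\<lambda>x. - (\<beta> / 2) * h * ?X x"
  have T: "?T \<in> measurable ?M ?M"
    by (rule measurable_restrict) (auto intro!: borel_measurable_add measurable_coordinate)
  have int: "integrable ?M (\<lambda>x. below (t + h) x * gibbs_weight x)"
    by (intro poly_bounded_integrable poly_bounded_below)
  have shifted: "below (t + h) (?T x) * gibbs_weight (?T x) = c * (below t x * exp (?e x) * gibbs_weight x)" for x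
  proof -
    have "below (t + h) (?T x) = below t x" by (auto simp: below_eq)
    moreover have "interaction J (?T x) = interaction J x"
      unfolding interaction_def by (intro prod.cong) auto
    moreover have "gauss J (\<beta> / 4) (?T x) = c * exp (?e x) * gauss J (\<beta> / 4) x"
    proof -
      have "(\<Sum>i\<in>J. (?T x i)\<^sup>2) = (\<Sum>i\<in>J. (x i)\<^sup>2 + 2 * h * x i + h\<^sup>2)"
        by (intro sum.cong) (auto simp: power2_eq_square algebra_simps)
      also have "\<dots> = (\<Sum>i\<in>J. (x i)\<^sup>2) + 2 * h * ?X x + ?n * h\<^sup>2"
        by (simp add: sum.distrib sum_distrib_left)
      finally show ?thesis by (simp add: gauss_def c_def exp_add[symmetric] algebra_simps)
    qed
    ultimately show ?thesis by (simp add: gibbs_weight_def)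
  qed
  have int2: "integrable ?M (\<lambda>x. c * (below t x * exp (?e x) * gibbs_weight x))"
  proof -
    have "integrable (distr ?M ?M ?T) (\<lambda>x. below (t + h) x * gibbs_weight x)"
      unfolding distr_PiM_lborel_shift[OF finite_J] by (rule int)
    from integrable_distr[OF T this] show ?thesis by (simp only: shifted)
  qed
  have eq: "weighted_integral (below (t + h)) = (LINT x|?M. c * (below t x * exp (?e x) * gibbs_weight x))"
  proof -
    have "weighted_integral (below (t + h)) = (LINT x|distr ?M ?M ?T. below (t + h) x * gibbs_weight x)"
      unfolding weighted_integral_def distr_PiM_lborel_shift[OF finite_J] ..
    also have "\<dots> = (LINT x|?M. below (t + h) (?T x) * gibbs_weight (?T x))"
      using T int by (intro integral_distr) auto
    finally show ?thesis unfolding shifted .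
  qed
  let ?g = "\<lambda>x. c * exp m * ((1 - m) * below t x - \<beta> / 2 * h * (below t x * ?X x))"
  have pg: "poly_bounded J ?g"
    by (intro poly_bounded_mult poly_bounded_diff poly_bounded_const poly_bounded_below poly_bounded_sum_coordinates)
  have "weighted_integral ?g = c * exp m * ((1 - m) * weighted_integral (below t) - \<beta> / 2 * h * weighted_integral (\<lambda>x. below t x * ?X x))"
    by (simp only: weighted_integral_cmult weighted_integral_diff poly_bounded_mult poly_bounded_const poly_bounded_below poly_bounded_sum_coordinates)
  also have "weighted_integral (\<lambda>x. below t x * ?X x) = - pressed_mean t * weighted_integral (below t)"
    using Q by (simp add: pressed_mean_def)
  finally have "weighted_integral ?g = c * exp m * weighted_integral (below t)"
    by (simp add: m_def algebra_simps)
  moreover have "weighted_integral ?g \<le> weighted_integral (below (t + h))"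
    unfolding eq unfolding weighted_integral_def
  proof (rule integral_mono[OF poly_bounded_integrable[OF pg] int2])
    fix x
    have "exp m * (1 + (?e x - m)) \<le> exp m * exp (?e x - m)"
      by (intro mult_left_mono exp_ge_add_one_self) auto
    then have "exp m * (1 - m - \<beta> / 2 * h * ?X x) \<le> exp (?e x)"
      by (simp add: exp_add[symmetric] algebra_simps)
    then have "c * below t x * gibbs_weight x * (exp m * (1 - m - \<beta> / 2 * h * ?X x)) \<le> c * below t x * gibbs_weight x * exp (?e x)"
      by (intro mult_left_mono mult_nonneg_nonneg gibbs_weight_nonneg) (auto simp: c_def below_eq)
    then show "?g x * gibbs_weight x \<le> c * (below t x * exp (?e x) * gibbs_weight x)"
      by (simp add: algebra_simps)
  qed
  moreover have "exp (\<beta> / 2 * h * pressed_mean t - \<beta> / 4 * ?n * h\<^sup>2) = c * exp m"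
    by (simp add: c_def m_def exp_add[symmetric] algebra_simps)
  ultimately show ?thesis by (simp only: mult.commute)
qed

text \<open>If the wall pushed less than this, then for \<open>z = t + d\<close> at distance between \<open>\<surd>n \<epsilon> / 2\<close> and
  \<open>\<surd>n \<epsilon>\<close> from the wall the bracket \<open>n - z\<^sup>2/4 - \<mu>/d\<close> would be at least \<open>n \<epsilon> / 2\<close>. The window would have
  length times rate \<open>n \<epsilon>\<^bsup>3/2\<^esup> / (2 \<surd>2) \<ge> 4 > \<pi>\<close>, which is too long.\<close>

lemma pressed_mean_ge:
  fixes t \<epsilon> :: real
  defines "n \<equiv> real (card J)"
  assumes Q: "0 < weighted_integral (below t)" and eps: "0 < \<epsilon>" "\<epsilon> \<le> 1"
    and t: "t = 2 * sqrt n * (1 - \<epsilon>)" and large: "12 \<le> n * (\<epsilon> * sqrt \<epsilon>)"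
  shows "n * sqrt n * \<epsilon>\<^sup>2 / 8 \<le> pressed_mean t"
proof (rule ccontr)
  assume "\<not> ?thesis"
  then have less: "pressed_mean t < n * sqrt n * \<epsilon>\<^sup>2 / 8" by simp
  have n: "0 < n" using large eps by (cases "n = 0") (auto simp: n_def)
  define r where "r = sqrt n"
  have r: "0 < r" "n = r\<^sup>2" using n by (auto simp: r_def)
  define a where "a = r * \<epsilon> / 2"
  define b where "b = r * \<epsilon>"
  have "sqrt (n * \<epsilon> / 2) * (b - a) < pi"
  proof (rule wall_window_bound[OF Q])
    show "0 < sqrt (n * \<epsilon> / 2)" "0 < a" "a \<le> b" using n eps r by (auto simp: a_def b_def)
    fix d assume d: "a \<le> d" "d \<le> b"
    have "0 < a" using r eps by (simp add: a_def)
    then have "0 < d" using d by linarith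
    have "pressed_mean t / d \<le> (n * sqrt n * \<epsilon>\<^sup>2 / 8) / d"
      using less \<open>0 < d\<close> by (intro divide_right_mono) auto
    also have "\<dots> \<le> (n * sqrt n * \<epsilon>\<^sup>2 / 8) / a"
      using d(1) \<open>0 < a\<close> \<open>0 < d\<close> n eps by (intro divide_left_mono mult_pos_pos) auto
    also have "\<dots> = n * \<epsilon> / 4"
      using r eps unfolding a_def r_def[symmetric] by (simp add: field_simps power2_eq_square)
    finally have 1: "pressed_mean t / d \<le> n * \<epsilon> / 4" .
    have "(t + d)\<^sup>2 \<le> (2 * r * (1 - \<epsilon> / 2))\<^sup>2"
    proof (rule power_mono)
      show "t + d \<le> 2 * r * (1 - \<epsilon> / 2)"
        using d unfolding t r_def[symmetric] b_def by (simp add: algebra_simps)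
      show "0 \<le> t + d" using \<open>0 < d\<close> eps r unfolding t r_def[symmetric] by simp
    qed
    also have "\<dots> = 4 * (n * (1 - \<epsilon> + \<epsilon> * \<epsilon> / 4))"
      unfolding r(2) by (simp add: power2_eq_square algebra_simps)
    finally have "(t + d)\<^sup>2 / 4 \<le> n * (1 - \<epsilon> + \<epsilon> * \<epsilon> / 4)" by simp
    also have "\<dots> \<le> n * (1 - 3 / 4 * \<epsilon>)"
    proof (rule mult_left_mono)
      show "1 - \<epsilon> + \<epsilon> * \<epsilon> / 4 \<le> 1 - 3 / 4 * \<epsilon>"
      proof -
        have "\<epsilon> * \<epsilon> \<le> 1 * \<epsilon>" using eps by (intro mult_right_mono) auto
        then show ?thesis by linarith
      qed
    qed (use n in simp)
    finally have "(t + d)\<^sup>2 / 4 \<le> n * (1 - 3 / 4 * \<epsilon>)" .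
    then show "(sqrt (n * \<epsilon> / 2))\<^sup>2 \<le> real (card J) - (t + d)\<^sup>2 / 4 - pressed_mean t / d"
      using 1 n eps unfolding n_def[symmetric] by (simp add: algebra_simps)
  qed
  moreover have "4 \<le> sqrt (n * \<epsilon> / 2) * (b - a)"
  proof -
    have "sqrt (n * \<epsilon> / 2) = r * sqrt \<epsilon> / sqrt 2" by (simp add: real_sqrt_mult real_sqrt_divide r_def)
    then have eq: "sqrt (n * \<epsilon> / 2) * (b - a) = n * (\<epsilon> * sqrt \<epsilon>) / (2 * sqrt 2)"
      by (simp add: a_def b_def r(2) power2_eq_square field_simps)
    have "sqrt 2 \<le> 3 / 2" by (rule real_le_lsqrt) (auto simp: power2_eq_square)
    then have "4 * (2 * sqrt 2) \<le> n * (\<epsilon> * sqrt \<epsilon>)" using large by linarith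
    then show ?thesis unfolding eq by (simp add: field_simps)
  qed
  ultimately show False using pi_less_4 by linarith
qed

lemma weighted_integral_below_nonneg: "0 \<le> weighted_integral (below t)"
  unfolding weighted_integral_def by (intro integral_nonneg_AE AE_I2 mult_nonneg_nonneg gibbs_weight_nonneg) (auto simp: below_eq)

lemma weighted_integral_below_mono: "s \<le> t \<Longrightarrow> weighted_integral (below s) \<le> weighted_integral (below t)"
  by (intro weighted_integral_mono poly_bounded_below) (auto simp: below_eq intro: order_trans)

text \<open>Discrete integration of \<open>(log Q)' = (\<beta>/2) \<mu>\<close>: all walls between \<open>t\<close> and \<open>t + \<surd>n \<epsilon>\<close> correspond to a relative
  depth between \<open>\<epsilon>/2\<close> and \<open>\<epsilon>\<close>, where the push is at least \<open>n \<surd>n \<epsilon>\<^sup>2 / 32\<close>. The bound \<open>34 \<ge> 12 * 2 * \<surd>2\<close> keeps the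
  hypothesis of \<open>pressed_mean_ge\<close> valid at depth \<open>\<epsilon>/2\<close>.\<close>

lemma weighted_integral_below_left_tail:
  fixes t \<epsilon> :: real
  defines "n \<equiv> real (card J)"
  assumes eps: "0 < \<epsilon>" "\<epsilon> \<le> 1"
    and t: "t = 2 * sqrt n * (1 - \<epsilon>)" and large: "34 \<le> n * (\<epsilon> * sqrt \<epsilon>)"
  shows "weighted_integral (below t) * exp (\<beta> * n\<^sup>2 * \<epsilon> ^ 3 / 128) \<le> weighted_integral (below (t + sqrt n * \<epsilon>))"
proof (cases "weighted_integral (below t) = 0")
  case True
  then show ?thesis by (simp add: weighted_integral_below_nonneg)
next
  case False
  then have Q: "0 < weighted_integral (below t)" using weighted_integral_below_nonneg[of t] by simp
  have n: "0 < n" using large eps by (cases "n = 0") (auto simp: n_def)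
  define r where "r = sqrt n"
  have r: "0 < r" "n = r\<^sup>2" using n by (auto simp: r_def)
  define \<mu> where "\<mu> = n * sqrt n * \<epsilon>\<^sup>2 / 32"
  have \<mu>: "0 < \<mu>" using n eps by (simp add: \<mu>_def)
  define L where "L = sqrt n * \<epsilon>"
  have L: "0 < L" using n eps by (simp add: L_def)
  have mean: "\<mu> \<le> pressed_mean s" if s: "t \<le> s" "s \<le> t + L" for s
  proof -
    define e where "e = 1 - s / (2 * r)"
    have se: "s = 2 * sqrt n * (1 - e)" using r by (simp add: e_def r_def[symmetric] field_simps)
    have "r * e \<le> r * \<epsilon>" using s(1) unfolding se t r_def[symmetric] by (simp add: algebra_simps)
    moreover have "r * (\<epsilon> / 2) \<le> r * e"
      using s(2) unfolding se t L_def r_def[symmetric] by (simp add: algebra_simps)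
    ultimately have e: "\<epsilon> / 2 \<le> e" "e \<le> \<epsilon>" using r by auto
    have "12 \<le> n * (\<epsilon> / 2 * sqrt (\<epsilon> / 2))"
    proof -
      have eq: "n * (\<epsilon> / 2 * sqrt (\<epsilon> / 2)) = n * (\<epsilon> * sqrt \<epsilon>) / (2 * sqrt 2)"
        by (simp add: real_sqrt_divide)
      have "sqrt 2 \<le> 17 / 12" by (rule real_le_lsqrt) (auto simp: power2_eq_square)
      then have "12 * (2 * sqrt 2) \<le> n * (\<epsilon> * sqrt \<epsilon>)" using large by linarith
      then show ?thesis unfolding eq by (simp add: field_simps)
    qed
    also have "\<dots> \<le> n * (e * sqrt e)"
      using e eps n by (intro mult_left_mono mult_mono) auto
    finally have "n * sqrt n * e\<^sup>2 / 8 \<le> pressed_mean s"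
      using e eps less_le_trans[OF Q weighted_integral_below_mono[OF s(1)]] se unfolding n_def
      by (intro pressed_mean_ge) auto
    moreover have "n * sqrt n * (\<epsilon> / 2)\<^sup>2 \<le> n * sqrt n * e\<^sup>2"
      using e eps n by (intro mult_left_mono power_mono) auto
    ultimately show ?thesis by (simp add: \<mu>_def power_divide)
  qed
  \<comment> \<open>steps \<open>h \<le> \<mu> / n\<close>, so that the Gaussian loss \<open>(\<beta>/4) n h\<^sup>2\<close> is at most half of the gain \<open>(\<beta>/2) h \<mu>\<close>\<close>
  obtain N :: nat where N: "n * L / \<mu> \<le> real N" using real_arch_simple by blast
  have N0: "0 < real N" using N n L \<mu> by (intro less_le_trans[OF _ N]) auto
  define h where "h = L / real N"
  have h: "0 < h" "real N * h = L" "n * h \<le> \<mu>"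
    using N N0 L \<mu> by (auto simp: h_def field_simps)
  have "weighted_integral (below t) * exp (real i * (\<beta> / 4 * h * \<mu>)) \<le> weighted_integral (below (t + real i * h))" if "i \<le> N" for i
    using that
  proof (induction i)
    case (Suc i)
    let ?s = "t + real i * h"
    have "real i * h \<le> L" using Suc.prems h by (metis Suc_leD less_imp_le mult_right_mono of_nat_le_iff)
    then have s: "t \<le> ?s" "?s \<le> t + L" using h by auto
    have Qs: "0 < weighted_integral (below ?s)" using Q weighted_integral_below_mono[OF s(1)] by simp
    have "\<beta> / 4 * h * \<mu> \<le> \<beta> / 2 * h * pressed_mean ?s - \<beta> / 4 * n * h\<^sup>2"
    proof -
      have "\<beta> / 4 * h * (n * h) \<le> \<beta> / 4 * h * \<mu>" using h beta_ge_1 by (intro mult_left_mono) auto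
      moreover have "\<beta> / 2 * h * \<mu> \<le> \<beta> / 2 * h * pressed_mean ?s"
        using h beta_ge_1 mean[OF s] by (intro mult_left_mono) auto
      ultimately show ?thesis by (simp add: power2_eq_square mult_ac)
    qed
    then have "weighted_integral (below ?s) * exp (\<beta> / 4 * h * \<mu>)
        \<le> weighted_integral (below ?s) * exp (\<beta> / 2 * h * pressed_mean ?s - \<beta> / 4 * n * h\<^sup>2)"
      using Qs by (intro mult_left_mono) auto
    also have "\<dots> \<le> weighted_integral (below (?s + h))"
      unfolding n_def by (rule weighted_integral_below_shift[OF Qs])
    finally have step: "weighted_integral (below ?s) * exp (\<beta> / 4 * h * \<mu>) \<le> weighted_integral (below (?s + h))" .
    have "weighted_integral (below t) * exp (real (Suc i) * (\<beta> / 4 * h * \<mu>))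
        = weighted_integral (below t) * exp (real i * (\<beta> / 4 * h * \<mu>)) * exp (\<beta> / 4 * h * \<mu>)"
      by (simp add: exp_add[symmetric] algebra_simps)
    also have "\<dots> \<le> weighted_integral (below ?s) * exp (\<beta> / 4 * h * \<mu>)"
      using Suc by (intro mult_right_mono) auto
    also note step
    also have "?s + h = t + real (Suc i) * h" by (simp add: algebra_simps)
    finally show ?case .
  qed simp
  from this[of N] have "weighted_integral (below t) * exp (\<beta> / 4 * L * \<mu>) \<le> weighted_integral (below (t + L))"
    using h(2) by (simp add: mult_ac)
  moreover have "\<beta> / 4 * L * \<mu> = \<beta> * n\<^sup>2 * \<epsilon> ^ 3 / 128"
  proof -
    have "sqrt n * sqrt n = n" using n by simp
    then show ?thesis by (simp add: L_def \<mu>_def power2_eq_square power3_eq_cube)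
  qed
  ultimately show ?thesis by (simp only: L_def)
qed

end

section \<open>Loop equations for the largest particle\<close>

context pair_interaction
begin

text \<open>Loop equation for a field with the same component in all directions of \<open>K\<close>, such as a translation.\<close>

lemma common_field_ibp:
  assumes K: "K \<subseteq> J" and f: "poly_bounded J f" and f': "\<And>i. i \<in> K \<Longrightarrow> poly_bounded J (f' i)"
    and cont: "\<And>i x. i \<in> K \<Longrightarrow> continuous_on UNIV (\<lambda>y. f (x(i := y)))"
    and deriv: "\<And>i x. i \<in> K \<Longrightarrow> \<exists>S. finite S \<and>
      (\<forall>y. y \<notin> S \<longrightarrow> ((\<lambda>y. f (x(i := y))) has_real_derivative f' i (x(i := y))) (at y))"
  shows "has_bochner_integral (Pi\<^sub>M J (\<lambda>_. lborel)) (\<lambda>x. ((\<Sum>i\<in>K. f' i x) + f x *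
    (\<beta> * (\<Sum>i\<in>K. \<Sum>j\<in>J - {i}. 1 / (x i - x j)) - \<beta> / 2 * (\<Sum>i\<in>K. x i))) * gibbs_weight x) 0"
proof -
  have "has_bochner_integral (Pi\<^sub>M J (\<lambda>_. lborel)) (\<lambda>x. \<Sum>i\<in>K. (f' i x + f x *
      (\<beta> * (\<Sum>j\<in>J - {i}. 1 / (x i - x j)) - \<beta> / 2 * x i)) * gibbs_weight x) (\<Sum>i\<in>K. 0)"
    by (intro has_bochner_integral_sum integration_by_parts f f' cont deriv) (use K in auto)
  moreover have "(\<Sum>i\<in>K. (f' i x + f x * (\<beta> * (\<Sum>j\<in>J - {i}. 1 / (x i - x j)) - \<beta> / 2 * x i)) * gibbs_weight x)
     = ((\<Sum>i\<in>K. f' i x) + f x * (\<beta> * (\<Sum>i\<in>K. \<Sum>j\<in>J - {i}. 1 / (x i - x j)) - \<beta> / 2 * (\<Sum>i\<in>K. x i))) * gibbs_weight x" for x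
    by (simp only: sum_distrib_right[symmetric] sum.distrib sum_distrib_left[symmetric] sum_subtractf)
  ultimately show ?thesis by simp
qed

end

text \<open>The kernel confines the configurations to the chamber where particle \<open>k\<close> lies strictly above all
  others.\<close>

locale top_particle = pair_interaction +
  fixes k :: nat
  assumes k: "k \<in> J" and q_top: "d \<le> 0 \<Longrightarrow> q k j d = 0"
begin

definition others :: "nat set" where "others = J - {k}"

lemma finite_others: "finite others" and k_notin_others: "k \<notin> others" and J_eq: "J = insert k others"
  and others_subset: "i \<in> others \<Longrightarrow> i \<in> J" and others_neq: "i \<in> others \<Longrightarrow> i \<noteq> k"
  using finite_J k by (auto simp: others_def)

lemma sum_J: "(\<Sum>i\<in>J. f i) = f k + (\<Sum>i\<in>others. f i)"
  using sum.remove[OF finite_J k] by (simp add: others_def)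

lemma top_support:
  assumes "gibbs_weight x \<noteq> 0" "i \<in> others"
  shows "x i < x k"
proof (rule ccontr)
  assume le: "\<not> x i < x k"
  have "interaction J x = interaction others x * (\<Prod>j\<in>others. q k j (x k - x j))"
    using interaction_insert[OF finite_others k_notin_others, of x] unfolding J_eq[symmetric] .
  moreover have "(\<Prod>j\<in>others. q k j (x k - x j)) = 0"
    using finite_others assms(2) le by (intro prod_zero bexI[of _ i] q_top) auto
  ultimately show False using assms by (simp add: gibbs_weight_def)
qed

definition stieltjes :: "(nat \<Rightarrow> real) \<Rightarrow> real" where
  "stieltjes x = (\<Sum>j\<in>others. 1 / (x k - x j))"

text \<open>Regularisation of \<open>stieltjes\<close> by moving the spectral point from \<open>x k\<close> up to \<open>x k + d\<close>. It is
  bounded, so it may serve as a field.\<close>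

definition stieltjes_reg :: "real \<Rightarrow> (nat \<Rightarrow> real) \<Rightarrow> real" where
  "stieltjes_reg d x = (\<Sum>j\<in>others. resolvent (x k) d (x j))"

text \<open>Internal forces cancel; what remains is the repulsion from the top particle.\<close>

lemma sum_forces_others:
  "(\<Sum>i\<in>others. \<Sum>j\<in>J - {i}. 1 / (x i - x j)) = - stieltjes x"
proof -
  have "(\<Sum>j\<in>J - {i}. 1 / (x i - x j)) = - (1 / (x k - x i)) + (\<Sum>j\<in>others - {i}. 1 / (x i - x j))"
    if i: "i \<in> others" for i
  proof -
    have eq: "J - {i} = insert k (others - {i})" using others_neq[OF i] k by (auto simp: others_def)
    have "1 / (x i - x k) = - (1 / (x k - x i))" by (metis divide_minus_right minus_diff_eq)
    then show ?thesis unfolding eq using finite_others k_notin_others by simp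
  qed
  then have "(\<Sum>i\<in>others. \<Sum>j\<in>J - {i}. 1 / (x i - x j))
      = (\<Sum>i\<in>others. - (1 / (x k - x i)) + (\<Sum>j\<in>others - {i}. 1 / (x i - x j)))"
    by (rule sum.cong[OF refl])
  also have "\<dots> = - stieltjes x"
    unfolding sum.distrib sum_pair_forces_eq_0[OF finite_others] by (simp add: sum_negf stieltjes_def)
  finally show ?thesis .
qed

lemma poly_bounded_resolvent_top:
  assumes "0 < d" "i \<in> others" shows "poly_bounded J (\<lambda>x. resolvent (x k) d (x i))"
proof (rule poly_bounded_bounded[where C = "1 / d"])
  show "(\<lambda>x. resolvent (x k) d (x i)) \<in> borel_measurable (Pi\<^sub>M J (\<lambda>_. lborel))"
    unfolding resolvent_def
    by (intro borel_measurable_divide borel_measurable_add borel_measurable_max borel_measurable_diff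
        borel_measurable_const measurable_coordinate assms k others_subset)
qed (use resolvent_pos[OF assms(1)] resolvent_le[OF assms(1)] in \<open>simp add: less_imp_le\<close>)

lemma poly_bounded_stieltjes_reg: "0 < d \<Longrightarrow> poly_bounded J (stieltjes_reg d)"
  unfolding stieltjes_reg_def by (intro poly_bounded_sum poly_bounded_resolvent_top)

lemma poly_bounded_resolvent_slope_top:
  assumes "0 < d" "i \<in> others" shows "poly_bounded J (\<lambda>x. resolvent_slope (x k) d (x i))"
proof -
  have "poly_bounded J (\<lambda>x. (\<lambda>u. if 0 < u then 1 else 0) (x k - x i))"
    by (rule poly_bounded_pair[OF finite_J k others_subset[OF assms(2)], where m = 0]) auto
  then have "poly_bounded J (\<lambda>x. if x i < x k then 1 else 0)" by simp
  then have "poly_bounded J (\<lambda>x. (if x i < x k then 1 else 0) * (resolvent (x k) d (x i))\<^sup>2)"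
    by (intro poly_bounded_mult poly_bounded_power poly_bounded_resolvent_top assms)
  moreover have "(\<lambda>x. (if x i < x k then 1 else 0) * (resolvent (x k) d (x i))\<^sup>2)
      = (\<lambda>x. resolvent_slope (x k) d (x i))"
    by (auto simp: fun_eq_iff resolvent_slope_def)
  ultimately show ?thesis by simp
qed

text \<open>The field \<open>1 / (x k + d - x i)\<close> on each particle below the top one. The repulsion from the top particle
  contributes the mixed sum with \<open>1 / (x k - x i)\<close>.\<close>

lemma resolvent_field_ibp:
  assumes d: "0 < d" and g: "poly_bounded J (\<lambda>x. g (x k))"
  shows "has_bochner_integral (Pi\<^sub>M J (\<lambda>_. lborel)) (\<lambda>x. g (x k) *
    ((\<Sum>i\<in>others. (resolvent (x k) d (x i))\<^sup>2) - \<beta> * (\<Sum>i\<in>others. resolvent (x k) d (x i) / (x k - x i))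
     + \<beta> / 2 * ((stieltjes_reg d x)\<^sup>2 - (\<Sum>i\<in>others. (resolvent (x k) d (x i))\<^sup>2))
     - \<beta> / 2 * ((x k + d) * stieltjes_reg d x - real (card others))) * gibbs_weight x) 0"
proof -
  let ?r = "\<lambda>x i. resolvent (x k) d (x i)"
  let ?X = "\<lambda>i x. (g (x k) * resolvent_slope (x k) d (x i) + g (x k) * ?r x i *
      (\<beta> * (\<Sum>j\<in>J - {i}. 1 / (x i - x j)) - \<beta> / 2 * x i)) * gibbs_weight x"
  have "has_bochner_integral (Pi\<^sub>M J (\<lambda>_. lborel)) (?X i) 0" if i: "i \<in> others" for i
  proof (rule integration_by_parts[OF others_subset[OF i]])
    have ki: "k \<noteq> i" using others_neq[OF i] by simp
    show "poly_bounded J (\<lambda>x. g (x k) * ?r x i)"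
      by (intro poly_bounded_mult g poly_bounded_resolvent_top d i)
    show "poly_bounded J (\<lambda>x. g (x k) * resolvent_slope (x k) d (x i))"
      by (intro poly_bounded_mult g poly_bounded_resolvent_slope_top d i)
    fix x :: "nat \<Rightarrow> real"
    show "continuous_on UNIV (\<lambda>y. g ((x(i := y)) k) * ?r (x(i := y)) i)"
      using ki by (auto intro!: continuous_intros resolvent_cont d)
    show "\<exists>S. finite S \<and> (\<forall>y. y \<notin> S \<longrightarrow> ((\<lambda>y. g ((x(i := y)) k) * ?r (x(i := y)) i) has_real_derivative
        g ((x(i := y)) k) * resolvent_slope ((x(i := y)) k) d ((x(i := y)) i)) (at y))"
      using ki by (intro exI[of _ "{x k}"]) (auto intro!: DERIV_cmult resolvent_deriv d)
  qed
  then have "has_bochner_integral (Pi\<^sub>M J (\<lambda>_. lborel)) (\<lambda>x. \<Sum>i\<in>others. ?X i x) (\<Sum>i\<in>others. 0)"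
    by (intro has_bochner_integral_sum)
  moreover have "(\<Sum>i\<in>others. ?X i x) = g (x k) *
    ((\<Sum>i\<in>others. (?r x i)\<^sup>2) - \<beta> * (\<Sum>i\<in>others. ?r x i / (x k - x i))
     + \<beta> / 2 * ((stieltjes_reg d x)\<^sup>2 - (\<Sum>i\<in>others. (?r x i)\<^sup>2))
     - \<beta> / 2 * ((x k + d) * stieltjes_reg d x - real (card others))) * gibbs_weight x" for x
  proof (cases "gibbs_weight x = 0")
    case False
    have lt: "x i < x k" if "i \<in> others" for i using top_support[OF False that] .
    have inj: "inj_on x others" using gibbs_weight_support[OF False] by (auto simp: inj_on_def others_def)
    have a: "?r x i * (x k + d - x i) = 1" if "i \<in> others" for i
      using lt[OF that] d by (simp add: resolvent_def field_simps)
    let ?F = "\<lambda>i. \<Sum>j\<in>others - {i}. 1 / (x i - x j)"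
    have F: "(\<Sum>j\<in>J - {i}. 1 / (x i - x j)) = - (1 / (x k - x i)) + ?F i" if i: "i \<in> others" for i
    proof -
      have eq: "J - {i} = insert k (others - {i})" using others_neq[OF i] k by (auto simp: others_def)
      have "1 / (x i - x k) = - (1 / (x k - x i))" by (metis divide_minus_right minus_diff_eq)
      then show ?thesis unfolding eq using finite_others k_notin_others by simp
    qed
    have 2: "(\<Sum>i\<in>others. ?r x i * ?F i) = ((\<Sum>i\<in>others. ?r x i)\<^sup>2 - (\<Sum>i\<in>others. (?r x i)\<^sup>2)) / 2"
    proof (rule sum_resolvent_pair_forces[OF finite_others inj])
      fix i j assume "i \<in> others" "j \<in> others"
      then show "?r x i - ?r x j = (x i - x j) * (?r x i * ?r x j)"
        using a[of i] a[of j] by algebra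
    qed
    have 3: "(\<Sum>i\<in>others. ?r x i * x i) = (x k + d) * stieltjes_reg d x - real (card others)"
    proof -
      have "?r x i * x i = (x k + d) * ?r x i - 1" if "i \<in> others" for i
        using a[OF that] by (simp add: algebra_simps)
      then show ?thesis by (simp add: sum_subtractf sum_distrib_left stieltjes_reg_def)
    qed
    have "(\<Sum>i\<in>others. ?X i x) = (\<Sum>i\<in>others. ((?r x i)\<^sup>2 - \<beta> * (?r x i / (x k - x i)) + \<beta> * (?r x i * ?F i)
        - \<beta> / 2 * (?r x i * x i)) * (g (x k) * gibbs_weight x))"
    proof (rule sum.cong[OF refl])
      fix i assume i: "i \<in> others"
      show "?X i x = ((?r x i)\<^sup>2 - \<beta> * (?r x i / (x k - x i)) + \<beta> * (?r x i * ?F i)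
        - \<beta> / 2 * (?r x i * x i)) * (g (x k) * gibbs_weight x)"
        unfolding F[OF i] using lt[OF i] by (simp add: resolvent_slope_def algebra_simps)
    qed
    also have "\<dots> = ((\<Sum>i\<in>others. (?r x i)\<^sup>2) - \<beta> * (\<Sum>i\<in>others. ?r x i / (x k - x i)) + \<beta> * (\<Sum>i\<in>others. ?r x i * ?F i)
        - \<beta> / 2 * (\<Sum>i\<in>others. ?r x i * x i)) * (g (x k) * gibbs_weight x)"
      by (simp only: sum_distrib_right[symmetric] sum.distrib sum_subtractf sum_distrib_left)
    finally show ?thesis unfolding 2 3 stieltjes_reg_def[symmetric] by (simp add: mult_ac)
  qed simp
  ultimately show ?thesis by simp
qed

text \<open>The position of the top particle is held fixed, so an arbitrary function of it factors out.\<close>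

lemma top_field_ibp:
  assumes g: "poly_bounded J (\<lambda>x. g (x k))" and f: "poly_bounded J f"
    and f': "\<And>i. i \<in> others \<Longrightarrow> poly_bounded J (f' i)"
    and cont: "\<And>i x. i \<in> others \<Longrightarrow> continuous_on UNIV (\<lambda>y. f (x(i := y)))"
    and deriv: "\<And>i x y. i \<in> others \<Longrightarrow> y \<noteq> x k \<Longrightarrow>
      ((\<lambda>y. f (x(i := y))) has_real_derivative f' i (x(i := y))) (at y)"
  shows "has_bochner_integral (Pi\<^sub>M J (\<lambda>_. lborel)) (\<lambda>x. g (x k) * ((\<Sum>i\<in>others. f' i x)
    + f x * (- \<beta> * stieltjes x - \<beta> / 2 * (\<Sum>i\<in>others. x i))) * gibbs_weight x) 0"
proof -
  have hb: "has_bochner_integral (Pi\<^sub>M J (\<lambda>_. lborel)) (\<lambda>x. ((\<Sum>i\<in>others. g (x k) * f' i x) + g (x k) * f x *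
    (\<beta> * (\<Sum>i\<in>others. \<Sum>j\<in>J - {i}. 1 / (x i - x j)) - \<beta> / 2 * (\<Sum>i\<in>others. x i))) * gibbs_weight x) 0"
  proof (rule common_field_ibp)
    fix i x assume i: "i \<in> others"
    then have ki: "k \<noteq> i" using others_neq by auto
    show "continuous_on UNIV (\<lambda>y. g ((x(i := y)) k) * f (x(i := y)))"
      using ki by (auto intro!: continuous_intros cont i)
    show "\<exists>S. finite S \<and> (\<forall>y. y \<notin> S \<longrightarrow> ((\<lambda>y. g ((x(i := y)) k) * f (x(i := y))) has_real_derivative
        g ((x(i := y)) k) * f' i (x(i := y))) (at y))"
      using ki by (intro exI[of _ "{x k}"]) (auto intro!: DERIV_cmult deriv i)
  qed (auto intro: poly_bounded_mult g f f' others_subset)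
  have eq: "((\<Sum>i\<in>others. g (x k) * f' i x) + g (x k) * f x *
      (\<beta> * (\<Sum>i\<in>others. \<Sum>j\<in>J - {i}. 1 / (x i - x j)) - \<beta> / 2 * (\<Sum>i\<in>others. x i))) * gibbs_weight x
      = g (x k) * ((\<Sum>i\<in>others. f' i x) + f x * (- \<beta> * stieltjes x - \<beta> / 2 * (\<Sum>i\<in>others. x i))) * gibbs_weight x" for x
    unfolding sum_forces_others sum_distrib_left[symmetric] by (simp add: algebra_simps)
  show ?thesis using hb unfolding eq .
qed

end

section \<open>A second-order inequality for the largest particle\<close>

context top_particle
begin

text \<open>Weak form of \<open>F'' \<ge> \<kappa> F\<close> for the density \<open>F\<close> of the top particle, with \<open>g0\<close> as test function
  and \<open>g1\<close>, \<open>g2\<close> as its derivatives. Six loop equations are combined so that, up to an error that vanishes with the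
  regularisation \<open>d\<close>, the difference of both sides is a sum of nonnegative terms. The error carries a factor of indefinite
  sign, \<open>m - 2 * x k\<close>, and is removed by dominated convergence.\<close>

lemma top_second_order:
  fixes g0 g1 g2 :: "real \<Rightarrow> real"
  assumes F: "finite F" and cont: "continuous_on UNIV g0" "continuous_on UNIV g1"
    and deriv0: "\<And>y. y \<notin> F \<Longrightarrow> (g0 has_real_derivative g1 y) (at y)"
    and deriv1: "\<And>y. y \<notin> F \<Longrightarrow> (g1 has_real_derivative g2 y) (at y)"
    and meas2: "g2 \<in> borel_measurable borel"
    and bound: "\<And>y. \<bar>g0 y\<bar> \<le> B" "\<And>y. \<bar>g1 y\<bar> \<le> B" "\<And>y. \<bar>g2 y\<bar> \<le> B"
    and nonneg: "\<And>y. 0 \<le> g0 y"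
  shows "weighted_integral (\<lambda>x. \<beta>\<^sup>2 / 4 * ((x k)\<^sup>2 - 4 * real (card others) - 2 / \<beta>) * g0 (x k)) \<le> weighted_integral (\<lambda>x. g2 (x k))"
proof -
  let ?M = "Pi\<^sub>M J (\<lambda>_. lborel :: real measure)"
  let ?m = "\<lambda>x. - (\<Sum>i\<in>others. x i)"
  let ?N = "real (card others)"
  have meas: "g0 \<in> borel_measurable borel" "g1 \<in> borel_measurable borel"
    using cont by (simp_all add: borel_measurable_continuous_onI)
  have pg: "poly_bounded J (\<lambda>x. g (x k))"
    if "g \<in> borel_measurable borel" "\<And>y. \<bar>g y\<bar> \<le> B" for g :: "real \<Rightarrow> real"
    by (rule poly_bounded_bounded[where C = B]) (rule measurable_compose[OF measurable_coordinate[OF k] that(1)], rule that(2))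
  note p0 = pg[OF meas(1) bound(1)] and p1 = pg[OF meas(2) bound(2)] and p2 = pg[OF meas2 bound(3)]
  have px: "poly_bounded J (\<lambda>x. x i)" if "i \<in> J" for i using poly_bounded_coordinate[OF finite_J that] .
  have pm: "poly_bounded J ?m"
    by (intro poly_bounded_uminus poly_bounded_sum px others_subset)
  have slice: "(\<Sum>j\<in>J. (x(i := y)) j) = y + (\<Sum>j\<in>J - {i}. x j)" if "i \<in> J" for x i and y :: real
  proof -
    have "(\<Sum>j\<in>J - {i}. (x(i := y)) j) = (\<Sum>j\<in>J - {i}. x j)" by (intro sum.cong) auto
    then show ?thesis using sum.remove[OF finite_J that, of "x(i := y)"] by simp
  qed
  have slice_others: "(\<Sum>j\<in>others. (x(i := y)) j) = y + (\<Sum>j\<in>others - {i}. x j)" if "i \<in> others" for x i and y :: real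
  proof -
    have "(\<Sum>j\<in>others - {i}. (x(i := y)) j) = (\<Sum>j\<in>others - {i}. x j)" by (intro sum.cong) auto
    then show ?thesis using sum.remove[OF finite_others that, of "x(i := y)"] by simp
  qed
  have no_force: "(\<Sum>i\<in>J. \<Sum>j\<in>J - {i}. 1 / (x i - x j)) = 0" for x :: "nat \<Rightarrow> real"
    by (rule sum_pair_forces_eq_0[OF finite_J])
  have card_J: "real (card J) = ?N + 1"
    using card_Suc_Diff1[OF finite_J k] unfolding others_def by simp

  \<comment> \<open>translation of all particles by \<open>g1\<close>\<close>
  define A1 where "A1 x = g2 (x k) - \<beta> / 2 * g1 (x k) * (\<Sum>i\<in>J. x i)" for x
  have "has_bochner_integral ?M (\<lambda>x. ((\<Sum>i\<in>J. if i = k then g2 (x k) else 0) + g1 (x k) *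
    (\<beta> * (\<Sum>i\<in>J. \<Sum>j\<in>J - {i}. 1 / (x i - x j)) - \<beta> / 2 * (\<Sum>i\<in>J. x i))) * gibbs_weight x) 0"
  proof (rule common_field_ibp)
    fix i x assume i: "i \<in> J"
    show "poly_bounded J (\<lambda>x. if i = k then g2 (x k) else 0)"
      by (cases "i = k") (simp_all add: p2 poly_bounded_const)
    show "continuous_on UNIV (\<lambda>y. g1 ((x(i := y)) k))" using cont by (cases "i = k") auto
    show "\<exists>S. finite S \<and> (\<forall>y. y \<notin> S \<longrightarrow> ((\<lambda>y. g1 ((x(i := y)) k)) has_real_derivative
        (if i = k then g2 ((x(i := y)) k) else 0)) (at y))"
      using F deriv1 by (intro exI[of _ F]) (cases "i = k"; auto)
  qed (simp_all add: p1)
  then have A1: "has_bochner_integral ?M (\<lambda>x. A1 x * gibbs_weight x) 0"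
    unfolding no_force using k finite_J by (simp add: A1_def mult_ac)

  \<comment> \<open>translation of all particles by \<open>g0\<close> times minus the sum of all particles\<close>
  define A2 where "A2 x = - g1 (x k) * (\<Sum>i\<in>J. x i) - (?N + 1) * g0 (x k) + \<beta> / 2 * g0 (x k) * (\<Sum>i\<in>J. x i)\<^sup>2" for x
  have "has_bochner_integral ?M (\<lambda>x. ((\<Sum>i\<in>J. (if i = k then g1 (x k) * - (\<Sum>j\<in>J. x j) else 0) - g0 (x k))
    + g0 (x k) * - (\<Sum>j\<in>J. x j) *
    (\<beta> * (\<Sum>i\<in>J. \<Sum>j\<in>J - {i}. 1 / (x i - x j)) - \<beta> / 2 * (\<Sum>i\<in>J. x i))) * gibbs_weight x) 0"
  proof (rule common_field_ibp)
    show "poly_bounded J (\<lambda>x. g0 (x k) * - (\<Sum>j\<in>J. x j))"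
      by (intro poly_bounded_mult poly_bounded_uminus poly_bounded_sum_coordinates p0)
    fix i x assume i: "i \<in> J"
    show "poly_bounded J (\<lambda>x. (if i = k then g1 (x k) * - (\<Sum>j\<in>J. x j) else 0) - g0 (x k))"
      by (cases "i = k")
         (auto intro!: poly_bounded_diff poly_bounded_mult poly_bounded_uminus poly_bounded_sum_coordinates
            p0 p1 poly_bounded_const simp del: mult_minus_right)
    show "continuous_on UNIV (\<lambda>y. g0 ((x(i := y)) k) * - (\<Sum>j\<in>J. (x(i := y)) j))"
      unfolding slice[OF i] using cont by (cases "i = k") (auto intro!: continuous_intros)
    show "\<exists>S. finite S \<and> (\<forall>y. y \<notin> S \<longrightarrow> ((\<lambda>y. g0 ((x(i := y)) k) * - (\<Sum>j\<in>J. (x(i := y)) j)) has_real_derivative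
        (if i = k then g1 ((x(i := y)) k) * - (\<Sum>j\<in>J. (x(i := y)) j) else 0) - g0 ((x(i := y)) k)) (at y))"
      unfolding slice[OF i] using F deriv0
      by (intro exI[of _ F]) (cases "i = k"; auto intro!: derivative_eq_intros simp: algebra_simps)
  qed simp
  then have A2: "has_bochner_integral ?M (\<lambda>x. A2 x * gibbs_weight x) 0"
    unfolding no_force using k finite_J
    by (simp add: A2_def sum_subtractf card_J power2_eq_square algebra_simps)

  \<comment> \<open>the particles below the top one, with field \<open>g0\<close> times minus their sum\<close>
  define A3 where "A3 x = g0 (x k) * (- ?N + ?m x * (- \<beta> * stieltjes x - \<beta> / 2 * (\<Sum>i\<in>others. x i)))" for x
  have "has_bochner_integral ?M (\<lambda>x. g0 (x k) * ((\<Sum>i\<in>others. - 1) + ?m x *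
      (- \<beta> * stieltjes x - \<beta> / 2 * (\<Sum>i\<in>others. x i))) * gibbs_weight x) 0"
  proof (rule top_field_ibp[OF p0 pm])
    fix i and x :: "nat \<Rightarrow> real" and y :: real assume i: "i \<in> others"
    show "continuous_on UNIV (\<lambda>y. - (\<Sum>j\<in>others. (x(i := y)) j))"
      unfolding slice_others[OF i] by (intro continuous_intros)
    show "((\<lambda>y. - (\<Sum>j\<in>others. (x(i := y)) j)) has_real_derivative - 1) (at y)"
      unfolding slice_others[OF i] by (auto intro!: derivative_eq_intros)
  qed (rule poly_bounded_const)
  then have A3: "has_bochner_integral ?M (\<lambda>x. A3 x * gibbs_weight x) 0"
    by (simp add: A3_def)

  \<comment> \<open>the particles below the top one, with field \<open>g0\<close> times the position of the top one\<close>
  define A6 where "A6 x = g0 (x k) * (x k * (- \<beta> * stieltjes x - \<beta> / 2 * (\<Sum>i\<in>others. x i)))" for x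
  have "has_bochner_integral ?M (\<lambda>x. g0 (x k) * ((\<Sum>i\<in>others. 0) + x k *
      (- \<beta> * stieltjes x - \<beta> / 2 * (\<Sum>i\<in>others. x i))) * gibbs_weight x) 0"
  proof (rule top_field_ibp[OF p0 px[OF k]])
    fix i and x :: "nat \<Rightarrow> real" and y :: real assume i: "i \<in> others"
    show "continuous_on UNIV (\<lambda>y. (x(i := y)) k)" "((\<lambda>y. (x(i := y)) k) has_real_derivative 0) (at y)"
      using others_neq[OF i] by auto
  qed (rule poly_bounded_const)
  then have A6: "has_bochner_integral ?M (\<lambda>x. A6 x * gibbs_weight x) 0"
    by (simp add: A6_def)

  \<comment> \<open>coefficient of the regularisation error \<open>stieltjes - stieltjes_reg\<close>\<close>
  define P where "P x = g0 (x k) * (\<beta>\<^sup>2 / 2 * (?m x - 2 * x k))" for x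
  have pP: "poly_bounded J P"
    unfolding P_def by (intro poly_bounded_mult p0 poly_bounded_diff poly_bounded_const pm px k)
  have intS: "integrable ?M (\<lambda>x. P x * stieltjes x * gibbs_weight x)"
  proof -
    have "integrable ?M (\<lambda>x. \<Sum>j\<in>others. P x / (x k - x j) * gibbs_weight x)"
      by (intro Bochner_Integration.integrable_sum poly_bounded_integrable_div pP k others_subset others_neq)
    moreover have "(\<Sum>j\<in>others. P x / (x k - x j) * gibbs_weight x) = P x * stieltjes x * gibbs_weight x" for x
      by (simp add: stieltjes_def sum_distrib_left sum_distrib_right)
    ultimately show ?thesis by simp
  qed
  have intSd: "integrable ?M (\<lambda>x. P x * stieltjes_reg d x * gibbs_weight x)" if "0 < d" for d
    by (intro poly_bounded_integrable poly_bounded_mult pP poly_bounded_stieltjes_reg that)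
  let ?err = "\<lambda>d x. P x * stieltjes x * gibbs_weight x - P x * stieltjes_reg d x * gibbs_weight x"
  let ?gap = "\<lambda>x. (g2 (x k) - \<beta>\<^sup>2 / 4 * ((x k)\<^sup>2 - 4 * ?N - 2 / \<beta>) * g0 (x k)) * gibbs_weight x"
  have pk: "poly_bounded J (\<lambda>x. \<beta>\<^sup>2 / 4 * ((x k)\<^sup>2 - 4 * ?N - 2 / \<beta>) * g0 (x k))"
    by (intro poly_bounded_mult p0 poly_bounded_diff poly_bounded_power poly_bounded_const px k)
  have lower: "(LINT x|?M. ?err d x) \<le> (LINT x|?M. ?gap x)" if d: "0 < d" for d
  proof -
    let ?r = "\<lambda>x i. resolvent (x k) d (x i)"
    let ?S2 = "\<lambda>x. \<Sum>i\<in>others. (?r x i)\<^sup>2" and ?T = "\<lambda>x. \<Sum>i\<in>others. ?r x i / (x k - x i)"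
    \<comment> \<open>the particles below the top one, with field \<open>g0\<close> times the regularised Stieltjes sum\<close>
    define A4 where "A4 x = g0 (x k) * ((\<Sum>i\<in>others. resolvent_slope (x k) d (x i)) + stieltjes_reg d x *
      (- \<beta> * stieltjes x - \<beta> / 2 * (\<Sum>i\<in>others. x i)))" for x
    have A4: "has_bochner_integral ?M (\<lambda>x. A4 x * gibbs_weight x) 0"
      unfolding A4_def
    proof (rule top_field_ibp[OF p0 poly_bounded_stieltjes_reg[OF d]])
      fix i and x :: "nat \<Rightarrow> real" and y :: real assume i: "i \<in> others"
      then have ki: "i \<noteq> k" using others_neq by auto
      show "poly_bounded J (\<lambda>x. resolvent_slope (x k) d (x i))"
        by (rule poly_bounded_resolvent_slope_top[OF d i])
      have slice_reg: "stieltjes_reg d (x(i := y)) = resolvent (x k) d y + (\<Sum>j\<in>others - {i}. resolvent (x k) d (x j))" for y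
      proof -
        have "(\<Sum>j\<in>others - {i}. resolvent ((x(i := y)) k) d ((x(i := y)) j)) = (\<Sum>j\<in>others - {i}. resolvent (x k) d (x j))"
          using ki by (intro sum.cong) auto
        then show ?thesis
          unfolding stieltjes_reg_def using sum.remove[OF finite_others i, of "\<lambda>j. resolvent ((x(i := y)) k) d ((x(i := y)) j)"] ki by simp
      qed
      show "continuous_on UNIV (\<lambda>y. stieltjes_reg d (x(i := y)))"
        unfolding slice_reg by (intro continuous_intros resolvent_cont d)
      show "((\<lambda>y. stieltjes_reg d (x(i := y))) has_real_derivative resolvent_slope ((x(i := y)) k) d ((x(i := y)) i)) (at y)"
        if "y \<noteq> x k"
        unfolding slice_reg using ki resolvent_deriv[OF d that] by (auto intro!: derivative_eq_intros)
    qed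
    \<comment> \<open>the particles below the top one, with field \<open>g0\<close> times their own resolvents\<close>
    define A5 where "A5 x = g0 (x k) * (?S2 x - \<beta> * ?T x + \<beta> / 2 * ((stieltjes_reg d x)\<^sup>2 - ?S2 x)
      - \<beta> / 2 * ((x k + d) * stieltjes_reg d x - ?N))" for x
    have A5: "has_bochner_integral ?M (\<lambda>x. A5 x * gibbs_weight x) 0"
      unfolding A5_def by (rule resolvent_field_ibp[OF d p0])
    define Y where "Y x = A1 x * gibbs_weight x - \<beta> / 2 * (A2 x * gibbs_weight x) + \<beta> / 2 * (A3 x * gibbs_weight x)
      + \<beta> * (A4 x * gibbs_weight x) + 2 * \<beta> * (A5 x * gibbs_weight x) - \<beta> * (A6 x * gibbs_weight x)" for x
    have "has_bochner_integral ?M Y (0 - \<beta> / 2 * 0 + \<beta> / 2 * 0 + \<beta> * 0 + 2 * \<beta> * 0 - \<beta> * 0)"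
      unfolding Y_def
      by (intro has_bochner_integral_add has_bochner_integral_diff has_bochner_integral_mult_right A1 A2 A3 A4 A5 A6)
    then have Y: "integrable ?M Y" "(LINT x|?M. Y x) = 0" by (simp_all add: has_bochner_integral_iff)
    have le: "Y x + ?err d x \<le> ?gap x" for x
    proof (cases "gibbs_weight x = 0")
      case False
      have lt: "x i < x k" if "i \<in> others" for i using top_support[OF False that] .
      have slope: "(\<Sum>i\<in>others. resolvent_slope (x k) d (x i)) = ?S2 x"
        using lt by (intro sum.cong) (auto simp: resolvent_slope_def)
      have r: "?r x i \<le> 1 / (x k - x i)" if "i \<in> others" for i
        using lt[OF that] d by (simp add: resolvent_def frac_le)
      have r0: "0 \<le> ?r x i" for i using resolvent_pos[OF d] by (simp add: less_imp_le)
      have T: "?S2 x \<le> ?T x"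
      proof (rule sum_mono)
        fix i assume "i \<in> others"
        from mult_left_mono[OF r[OF this] r0] show "(?r x i)\<^sup>2 \<le> ?r x i / (x k - x i)"
          by (simp add: power2_eq_square)
      qed
      have S2: "0 \<le> ?S2 x" by (intro sum_nonneg) simp
      have S: "stieltjes_reg d x \<le> stieltjes x"
        unfolding stieltjes_reg_def stieltjes_def by (intro sum_mono r)
      have Sd: "0 \<le> stieltjes_reg d x" unfolding stieltjes_reg_def by (intro sum_nonneg r0)
      have b: "12 / \<beta> \<le> 12" using beta_ge_1 by (simp add: divide_le_eq)
      have "0 \<le> 8 * ?T x + (4 - 12 / \<beta>) * ?S2 x"
      proof -
        have "(4 - 12 / \<beta>) * ?S2 x \<ge> (4 - 12) * ?S2 x" using b S2 by (intro mult_right_mono) auto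
        then show ?thesis using T by simp
      qed
      moreover have "0 \<le> 4 * stieltjes_reg d x * (stieltjes x - stieltjes_reg d x)" "0 \<le> 4 * d * stieltjes_reg d x"
        using S Sd d by auto
      ultimately have "0 \<le> 8 * ?T x + (4 - 12 / \<beta>) * ?S2 x
          + 4 * stieltjes_reg d x * (stieltjes x - stieltjes_reg d x) + 4 * d * stieltjes_reg d x"
        by linarith
      then have nn: "0 \<le> g0 (x k) * (\<beta>\<^sup>2 / 4) * (8 * ?T x + (4 - 12 / \<beta>) * ?S2 x
          + 4 * stieltjes_reg d x * (stieltjes x - stieltjes_reg d x) + 4 * d * stieltjes_reg d x)"
        using nonneg[of "x k"] by (intro mult_nonneg_nonneg) auto
      \<comment> \<open>the coefficients of the six loop equations are determined by eliminating \<open>h1\<close>, \<open>s\<^sup>2\<close>, \<open>s * Sd\<close>, \<open>Sd\<^sup>2\<close> and \<open>y * s\<close> in turn\<close>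
      have alg: "h2 - b\<^sup>2 / 4 * (y\<^sup>2 - 4 * N - 2 / b) * h0 =
          (h2 - b / 2 * h1 * (y + s)) - b / 2 * (- h1 * (y + s) - (N + 1) * h0 + b / 2 * h0 * (y + s)\<^sup>2)
          + b / 2 * (h0 * (- N + - s * (- b * S - b / 2 * s)))
          + b * (h0 * (S2 + Sd * (- b * S - b / 2 * s)))
          + 2 * b * (h0 * (S2 - b * T + b / 2 * (Sd\<^sup>2 - S2) - b / 2 * ((y + d) * Sd - N)))
          - b * (h0 * (y * (- b * S - b / 2 * s)))
          + h0 * (b\<^sup>2 / 4) * (8 * T + (4 - 12 / b) * S2 + 4 * Sd * (S - Sd) + 4 * d * Sd)
          + h0 * (b\<^sup>2 / 2 * (- s - 2 * y)) * (S - Sd)"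
        if "b \<noteq> 0" for h0 h1 h2 b y s N S Sd S2 T d :: real
        using that by (simp add: field_simps power2_eq_square)
      have "A1 x - \<beta> / 2 * A2 x + \<beta> / 2 * A3 x + \<beta> * A4 x + 2 * \<beta> * A5 x - \<beta> * A6 x
          + P x * (stieltjes x - stieltjes_reg d x)
          \<le> g2 (x k) - \<beta>\<^sup>2 / 4 * ((x k)\<^sup>2 - 4 * ?N - 2 / \<beta>) * g0 (x k)"
        using nn alg[of \<beta> "g2 (x k)" "x k" ?N "g0 (x k)" "g1 (x k)" "\<Sum>i\<in>others. x i" "stieltjes x" "?S2 x" "stieltjes_reg d x" "?T x" d]
          beta_ge_1
        unfolding A1_def A2_def A3_def A4_def A5_def A6_def P_def slope sum_J by linarith
      from mult_right_mono[OF this gibbs_weight_nonneg[of x]] show ?thesis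
        by (simp add: Y_def algebra_simps)
    qed (simp add: Y_def)
    have int_err: "integrable ?M (?err d)"
      by (intro Bochner_Integration.integrable_diff intS intSd d)
    have "(LINT x|?M. ?err d x) = (LINT x|?M. Y x + ?err d x)"
      by (simp only: Bochner_Integration.integral_add[OF Y(1) int_err] Y(2) add_0)
    also have "\<dots> \<le> (LINT x|?M. ?gap x)"
      by (rule integral_mono[OF Bochner_Integration.integrable_add[OF Y(1) int_err] _ le])
         (intro poly_bounded_integrable poly_bounded_diff p2 pk)
    finally show ?thesis .
  qed
  let ?d = "\<lambda>n::nat. 1 / (real n + 1)"
  have "(\<lambda>n. LINT x|?M. ?err (?d n) x) \<longlonglongrightarrow> (LINT x|?M. 0)"
  proof (rule integral_dominated_convergence[where w = "\<lambda>x. \<bar>P x * stieltjes x * gibbs_weight x\<bar>"])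
    show "AE x in ?M. (\<lambda>n. ?err (?d n) x) \<longlonglongrightarrow> 0"
    proof (rule AE_I2)
      fix x
      show "(\<lambda>n. ?err (?d n) x) \<longlonglongrightarrow> 0"
      proof (cases "gibbs_weight x = 0")
        case False
        have d0: "?d \<longlonglongrightarrow> 0" using lim_1_over_n LIMSEQ_inverse_real_of_nat by (simp add: inverse_eq_divide add.commute)
        have "(\<lambda>n. stieltjes_reg (?d n) x) \<longlonglongrightarrow> (\<Sum>j\<in>others. 1 / (0 + (x k - x j)))"
          unfolding stieltjes_reg_def
        proof (rule tendsto_sum)
          fix j assume "j \<in> others"
          then have lt: "x j < x k" by (rule top_support[OF False])
          have "(\<lambda>n. 1 / (?d n + (x k - x j))) \<longlonglongrightarrow> 1 / (0 + (x k - x j))"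
            using lt by (intro tendsto_intros d0) auto
          then show "(\<lambda>n. resolvent (x k) (?d n) (x j)) \<longlonglongrightarrow> 1 / (0 + (x k - x j))"
            using lt by (simp add: resolvent_def)
        qed
        then have "(\<lambda>n. stieltjes_reg (?d n) x) \<longlonglongrightarrow> stieltjes x" by (simp add: stieltjes_def)
        then have "(\<lambda>n. ?err (?d n) x) \<longlonglongrightarrow> P x * stieltjes x * gibbs_weight x - P x * stieltjes x * gibbs_weight x"
          by (intro tendsto_intros)
        then show ?thesis by simp
      qed simp
    qed
    show "AE x in ?M. norm (?err (?d n) x) \<le> \<bar>P x * stieltjes x * gibbs_weight x\<bar>" for n
    proof (rule AE_I2)
      fix x
      show "norm (?err (?d n) x) \<le> \<bar>P x * stieltjes x * gibbs_weight x\<bar>"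
      proof (cases "gibbs_weight x = 0")
        case False
        have "0 \<le> stieltjes_reg (?d n) x"
          unfolding stieltjes_reg_def by (intro sum_nonneg less_imp_le resolvent_pos) simp
        moreover have "stieltjes_reg (?d n) x \<le> stieltjes x"
          unfolding stieltjes_reg_def stieltjes_def
        proof (rule sum_mono)
          fix j assume "j \<in> others"
          then have "x j < x k" by (rule top_support[OF False])
          then show "resolvent (x k) (?d n) (x j) \<le> 1 / (x k - x j)" by (simp add: resolvent_def frac_le)
        qed
        ultimately have "\<bar>stieltjes x - stieltjes_reg (?d n) x\<bar> \<le> \<bar>stieltjes x\<bar>" by linarith
        then have "\<bar>P x * gibbs_weight x\<bar> * \<bar>stieltjes x - stieltjes_reg (?d n) x\<bar> \<le> \<bar>P x * gibbs_weight x\<bar> * \<bar>stieltjes x\<bar>"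
          by (intro mult_left_mono) auto
        then show ?thesis by (simp add: abs_mult[symmetric] algebra_simps)
      qed simp
    qed
    show "?err (?d n) \<in> borel_measurable ?M" for n
      using intS intSd[of "?d n"] by (intro borel_measurable_diff borel_measurable_integrable) auto
  qed (use intS in auto)
  then have "(\<lambda>n. LINT x|?M. ?err (?d n) x) \<longlonglongrightarrow> 0" by simp
  then have "0 \<le> (LINT x|?M. ?gap x)"
    by (rule LIMSEQ_le_const2) (intro exI allI impI lower, simp)
  also have "(LINT x|?M. ?gap x) = weighted_integral (\<lambda>x. g2 (x k) - \<beta>\<^sup>2 / 4 * ((x k)\<^sup>2 - 4 * ?N - 2 / \<beta>) * g0 (x k))"
    by (simp add: weighted_integral_def)
  also have "\<dots> = weighted_integral (\<lambda>x. g2 (x k)) - weighted_integral (\<lambda>x. \<beta>\<^sup>2 / 4 * ((x k)\<^sup>2 - 4 * ?N - 2 / \<beta>) * g0 (x k))"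
    by (rule weighted_integral_diff[OF p2 pk])
  finally show ?thesis by simp
qed

end

section \<open>Exponential decay: the upper tail\<close>

text \<open>The test function for exponential decay. On \<open>[a, a + L]\<close> it solves \<open>g'' - K\<^sup>2 g = K\<^sup>2\<close> with zero initial data, and
  beyond \<open>a + L\<close> it is the bounded \<open>C\<^sup>1\<close> continuation with \<open>g'' - K\<^sup>2 g\<close> constant; matching
  value and slope at \<open>a + L\<close> forces this constant to be \<open>K\<^sup>2 (1 - exp (K L))\<close>. The barrier therefore compares the mass beyond \<open>a + L\<close> with the
  mass beyond \<open>a\<close>.\<close>

lemma barrier_function:
  fixes K L a :: real
  assumes K: "0 < K" and L: "0 < L"
  obtains g0 g1 g2 :: "real \<Rightarrow> real" and B where
    "continuous_on UNIV g0" "continuous_on UNIV g1" "g2 \<in> borel_measurable borel"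
    "\<And>y. y \<notin> {a, a + L} \<Longrightarrow> (g0 has_real_derivative g1 y) (at y)"
    "\<And>y. y \<notin> {a, a + L} \<Longrightarrow> (g1 has_real_derivative g2 y) (at y)"
    "\<And>y. \<bar>g0 y\<bar> \<le> B" "\<And>y. \<bar>g1 y\<bar> \<le> B" "\<And>y. \<bar>g2 y\<bar> \<le> B"
    "\<And>y. 0 \<le> g0 y" "\<And>y. y < a \<Longrightarrow> g0 y = 0"
    "\<And>y. g2 y - K\<^sup>2 * g0 y = K\<^sup>2 * (of_bool (a \<le> y) - exp (K * L) * of_bool (a + L \<le> y))"
proof
  define b where "b = a + L"
  define u where "u y = max 0 (min (y - a) L)" for y
  define v where "v y = max 0 (y - b)" for y
  define g0 where "g0 y = cosh (K * u y) - 1 + sinh (K * L) * (1 - exp (- K * v y))" for y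
  define g1 where "g1 y = K * sinh (K * u y) * exp (- K * v y)" for y
  define g2 where "g2 y = (if y < a then 0 else if y < b then K\<^sup>2 * cosh (K * u y)
    else - K\<^sup>2 * sinh (K * L) * exp (- K * v y))" for y
  define B where "B = (1 + K + K\<^sup>2) * exp (K * L)"
  have uv: "continuous_on UNIV u" "continuous_on UNIV v"
    unfolding u_def v_def by (intro continuous_intros)+
  show "continuous_on UNIV g0" "continuous_on UNIV g1"
    unfolding g0_def g1_def by (intro continuous_intros uv)+
  have g2_eq: "g2 = (\<lambda>y. indicator {a..<b} y * (K\<^sup>2 * cosh (K * u y))
      - indicator {b..} y * (K\<^sup>2 * sinh (K * L) * exp (- K * v y)))"
    using L by (auto simp: fun_eq_iff g2_def b_def indicator_def)
  have c: "(\<lambda>y. K\<^sup>2 * cosh (K * u y)) \<in> borel_measurable borel"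
    "(\<lambda>y. K\<^sup>2 * sinh (K * L) * exp (- K * v y)) \<in> borel_measurable borel"
    by (intro borel_measurable_continuous_onI continuous_intros uv)+
  show "g2 \<in> borel_measurable borel"
    unfolding g2_eq
    by (rule borel_measurable_diff[OF borel_measurable_times[OF _ c(1)] borel_measurable_times[OF _ c(2)]];
        rule borel_measurable_indicator; simp)
  have low: "u y = 0" "v y = 0" if "y \<le> a" for y using that L by (auto simp: u_def v_def b_def)
  have mid: "u y = y - a" "v y = 0" if "a \<le> y" "y \<le> b" for y using that by (auto simp: u_def v_def b_def)
  have high: "u y = L" "v y = y - b" if "b \<le> y" for y using that L by (auto simp: u_def v_def b_def)
  have u: "0 \<le> u y" "u y \<le> L" and v: "0 \<le> v y" for y using L by (auto simp: u_def v_def)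
  have deriv: "(g0 has_real_derivative g1 y) (at y) \<and> (g1 has_real_derivative g2 y) (at y)"
    if y: "y \<notin> {a, a + L}" for y
  proof -
    consider "y < a" | "a < y" "y < b" | "b < y" using y unfolding b_def by force
    then show ?thesis
    proof cases
      case 1
      have "((\<lambda>y. 0 :: real) has_real_derivative 0) (at y)" by simp
      then have "(g0 has_real_derivative 0) (at y)" "(g1 has_real_derivative 0) (at y)"
        by (rule has_field_derivative_transform_within_open[where S = "{..<a}"]; use 1 low in \<open>simp add: g0_def g1_def\<close>)+
      then show ?thesis using 1 low[of y] by (simp add: g1_def g2_def)
    next
      case 2
      have "((\<lambda>y. cosh (K * (y - a)) - 1) has_real_derivative K * sinh (K * (y - a))) (at y)"
        by (auto intro!: derivative_eq_intros)
      then have "(g0 has_real_derivative K * sinh (K * (y - a))) (at y)"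
        by (rule has_field_derivative_transform_within_open[where S = "{a<..<b}"]) (use 2 mid in \<open>simp_all add: g0_def\<close>)
      moreover have "((\<lambda>y. K * sinh (K * (y - a))) has_real_derivative K\<^sup>2 * cosh (K * (y - a))) (at y)"
        by (auto intro!: derivative_eq_intros simp: power2_eq_square)
      then have "(g1 has_real_derivative K\<^sup>2 * cosh (K * (y - a))) (at y)"
        by (rule has_field_derivative_transform_within_open[where S = "{a<..<b}"]) (use 2 mid in \<open>simp_all add: g1_def\<close>)
      ultimately show ?thesis using 2 mid[of y] by (simp add: g1_def g2_def)
    next
      case 3
      have "((\<lambda>y. cosh (K * L) - 1 + sinh (K * L) * (1 - exp (- K * (y - b)))) has_real_derivative
          K * sinh (K * L) * exp (- K * (y - b))) (at y)"
        by (auto intro!: derivative_eq_intros)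
      then have "(g0 has_real_derivative K * sinh (K * L) * exp (- K * (y - b))) (at y)"
        by (rule has_field_derivative_transform_within_open[where S = "{b<..}"]) (use 3 high in \<open>simp_all add: g0_def\<close>)
      moreover have "((\<lambda>y. K * sinh (K * L) * exp (- K * (y - b))) has_real_derivative
          - K\<^sup>2 * sinh (K * L) * exp (- K * (y - b))) (at y)"
        by (auto intro!: derivative_eq_intros simp: power2_eq_square)
      then have "(g1 has_real_derivative - K\<^sup>2 * sinh (K * L) * exp (- K * (y - b))) (at y)"
        by (rule has_field_derivative_transform_within_open[where S = "{b<..}"]) (use 3 high in \<open>simp_all add: g1_def\<close>)
      ultimately show ?thesis using 3 high[of y] L by (simp add: g1_def g2_def b_def)
    qed
  qed
  show "(g0 has_real_derivative g1 y) (at y)" "(g1 has_real_derivative g2 y) (at y)"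
    if "y \<notin> {a, a + L}" for y using deriv[OF that] by auto
  have KL: "0 \<le> K * L" using K L by simp
  have Ku: "0 \<le> K * u y" "K * u y \<le> K * L" for y using u K by auto
  have ex: "exp (- K * v y) \<le> 1" for y using v[of y] K by simp
  have ch: "1 \<le> cosh (K * u y)" "cosh (K * u y) \<le> cosh (K * L)" for y
    using cosh_real_ge_1 Ku[of y] cosh_real_nonneg_le_iff[of "K * u y" "K * L"] KL by auto
  have sh: "0 \<le> sinh (K * u y)" "sinh (K * u y) \<le> sinh (K * L)" for y
    using Ku[of y] by auto
  have shL: "0 \<le> sinh (K * L)" using KL by simp
  have sum: "cosh (K * L) + sinh (K * L) = exp (K * L)" by (simp add: cosh_plus_sinh)
  have chL: "1 \<le> cosh (K * L)" by (rule cosh_real_ge_1)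
  have e: "sinh (K * L) \<le> exp (K * L)" "cosh (K * L) \<le> exp (K * L)" using sum shL chL by linarith+
  have B: "exp (K * L) \<le> B" "K * exp (K * L) \<le> B" "K\<^sup>2 * exp (K * L) \<le> B"
    using K unfolding B_def by (auto simp: distrib_right)
  show nonneg: "0 \<le> g0 y" for y
    using ch(1)[of y] ex[of y] mult_nonneg_nonneg[OF shL, of "1 - exp (- K * v y)"] by (simp add: g0_def)
  show "\<bar>g0 y\<bar> \<le> B" for y
  proof -
    have "sinh (K * L) * (1 - exp (- K * v y)) \<le> sinh (K * L) * 1"
      using shL by (intro mult_left_mono) auto
    then have "g0 y \<le> exp (K * L)" using ch(2)[of y] sum by (simp add: g0_def)
    then show ?thesis using nonneg[of y] B(1) by simp
  qed
  show "\<bar>g1 y\<bar> \<le> B" for y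
  proof -
    have "sinh (K * u y) * exp (- K * v y) \<le> exp (K * L) * 1"
      by (rule mult_mono[OF order_trans[OF sh(2) e(1)] ex]) simp_all
    then have "K * (sinh (K * u y) * exp (- K * v y)) \<le> K * exp (K * L)" using K by simp
    then have "g1 y \<le> B" using B(2) unfolding g1_def mult.assoc by (rule order_trans)
    moreover have "0 \<le> g1 y" using sh[of y] K by (simp add: g1_def)
    ultimately show ?thesis by simp
  qed
  show "\<bar>g2 y\<bar> \<le> B" for y
  proof -
    have "K\<^sup>2 * cosh (K * u y) \<le> K\<^sup>2 * exp (K * L)"
      using ch(2)[of y] e by (intro mult_left_mono) auto
    moreover have "0 \<le> K\<^sup>2 * cosh (K * u y)" by simp
    moreover have "sinh (K * L) * exp (- K * v y) \<le> exp (K * L) * 1"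
      by (rule mult_mono[OF e(1) ex]) simp_all
    then have "K\<^sup>2 * (sinh (K * L) * exp (- K * v y)) \<le> K\<^sup>2 * exp (K * L)"
      by (simp add: mult_left_mono)
    moreover have "0 \<le> K\<^sup>2 * (sinh (K * L) * exp (- K * v y))" using shL by simp
    moreover have "0 \<le> B" using K by (simp add: B_def)
    ultimately show ?thesis using B(3) by (auto simp: g2_def mult.assoc)
  qed
  show "g0 y = 0" if "y < a" for y using low[of y] that by (simp add: g0_def)
  show "g2 y - K\<^sup>2 * g0 y = K\<^sup>2 * (of_bool (a \<le> y) - exp (K * L) * of_bool (a + L \<le> y))" for y
  proof -
    consider "y < a" | "a \<le> y" "y < b" | "b \<le> y" by linarith
    then show ?thesis
    proof cases
      case 1
      then show ?thesis using low[of y] L by (simp add: g0_def g2_def)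
    next
      case 2
      then show ?thesis using mid[of y] by (simp add: g0_def g2_def b_def algebra_simps)
    next
      case 3
      then show ?thesis using high[of y] L
        by (simp add: g0_def g2_def b_def sum[symmetric] algebra_simps)
    qed
  qed
qed

context top_particle
begin

text \<open>Beyond \<open>a = 2\<surd>n (1 + \<epsilon>/2)\<close> the coefficient of the second-order inequality is at least
  \<open>(\<beta>\<^sup>2/4)(a\<^sup>2 - 4n) \<ge> \<beta>\<^sup>2 n \<epsilon> = K\<^sup>2\<close>, and the barrier of length \<open>L = \<surd>n \<epsilon>\<close> yields the factor
  \<open>exp (K * L)\<close>.\<close>

lemma top_tail:
  fixes \<epsilon> :: real
  defines "n \<equiv> real (card J)"
  assumes eps: "0 < \<epsilon>"
  shows "exp (\<beta> * n * (\<epsilon> * sqrt \<epsilon>)) * weighted_integral (\<lambda>x. of_bool (2 * sqrt n * (1 + \<epsilon>) \<le> x k))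
    \<le> weighted_integral (\<lambda>x. of_bool (2 * sqrt n * (1 + \<epsilon> / 2) \<le> x k))"
proof -
  have card_J: "n = real (card others) + 1"
    using card_Suc_Diff1[OF finite_J k] unfolding others_def n_def by simp
  have n: "0 < n" unfolding card_J by simp
  define r where "r = sqrt n"
  have r: "0 < r" "n = r\<^sup>2" using n by (auto simp: r_def)
  define K where "K = \<beta> * (r * sqrt \<epsilon>)"
  define L where "L = r * \<epsilon>"
  define a where "a = 2 * r * (1 + \<epsilon> / 2)"
  have K: "0 < K" "K\<^sup>2 = \<beta>\<^sup>2 * n * \<epsilon>" and L: "0 < L" and a: "0 < a"
    using r eps beta_ge_1 by (auto simp: K_def L_def a_def power_mult_distrib)
  obtain g0 g1 g2 :: "real \<Rightarrow> real" and B where g: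
    "continuous_on UNIV g0" "continuous_on UNIV g1" "g2 \<in> borel_measurable borel"
    "\<And>y. y \<notin> {a, a + L} \<Longrightarrow> (g0 has_real_derivative g1 y) (at y)"
    "\<And>y. y \<notin> {a, a + L} \<Longrightarrow> (g1 has_real_derivative g2 y) (at y)"
    "\<And>y. \<bar>g0 y\<bar> \<le> B" "\<And>y. \<bar>g1 y\<bar> \<le> B" "\<And>y. \<bar>g2 y\<bar> \<le> B"
    "\<And>y. 0 \<le> g0 y" "\<And>y. y < a \<Longrightarrow> g0 y = 0"
    "\<And>y. g2 y - K\<^sup>2 * g0 y = K\<^sup>2 * (of_bool (a \<le> y) - exp (K * L) * of_bool (a + L \<le> y))"
    using barrier_function[OF K(1) L, of a] by metis
  let ?\<kappa> = "\<lambda>y. \<beta>\<^sup>2 / 4 * (y\<^sup>2 - 4 * real (card others) - 2 / \<beta>)"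
  have kappa: "K\<^sup>2 * g0 y \<le> ?\<kappa> y * g0 y" for y
  proof (cases "y < a")
    case False
    then have "a\<^sup>2 \<le> y\<^sup>2" using a by (intro power_mono) auto
    moreover have "a\<^sup>2 = 4 * n + 4 * n * \<epsilon> + n * \<epsilon>\<^sup>2"
      unfolding r(2) a_def by (simp add: power2_eq_square algebra_simps)
    moreover have "0 \<le> n * \<epsilon>\<^sup>2" using n by simp
    moreover have "2 / \<beta> \<le> 2" using beta_ge_1 by (simp add: divide_le_eq)
    ultimately have "4 * n * \<epsilon> \<le> y\<^sup>2 - 4 * real (card others) - 2 / \<beta>" using card_J by linarith
    then have "\<beta>\<^sup>2 / 4 * (4 * n * \<epsilon>) \<le> ?\<kappa> y" by (intro mult_left_mono) auto
    then show ?thesis using g(9)[of y] unfolding K(2) by (intro mult_right_mono) auto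
  qed (simp add: g)
  have pb: "poly_bounded J (\<lambda>x. f (x k))" if "f \<in> borel_measurable borel" "\<And>y. \<bar>f y\<bar> \<le> D" for f :: "real \<Rightarrow> real" and D
    by (rule poly_bounded_bounded[where C = D]) (rule measurable_compose[OF measurable_coordinate[OF k] that(1)], rule that(2))
  have p0: "poly_bounded J (\<lambda>x. g0 (x k))"
    by (rule pb[OF borel_measurable_continuous_onI[OF g(1)] g(6)])
  have p2: "poly_bounded J (\<lambda>x. g2 (x k))" by (rule pb[OF g(3) g(8)])
  have pind: "poly_bounded J (\<lambda>x. of_bool (c \<le> x k))" for c
    by (rule pb[where D = 1]) auto
  have "weighted_integral (\<lambda>x. K\<^sup>2 * g0 (x k)) \<le> weighted_integral (\<lambda>x. ?\<kappa> (x k) * g0 (x k))"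
    by (intro weighted_integral_mono kappa)
       (intro poly_bounded_intros p0 poly_bounded_coordinate finite_J k)+
  also have "\<dots> \<le> weighted_integral (\<lambda>x. g2 (x k))"
    by (rule top_second_order[where F = "{a, a + L}" and ?g1.0 = g1 and B = B])
       (simp, (rule g(1-9); assumption?)+)
  finally have "0 \<le> weighted_integral (\<lambda>x. g2 (x k)) - weighted_integral (\<lambda>x. K\<^sup>2 * g0 (x k))" by simp
  also have "\<dots> = weighted_integral (\<lambda>x. g2 (x k) - K\<^sup>2 * g0 (x k))"
    by (rule weighted_integral_diff[symmetric]) (intro poly_bounded_intros p0 p2)+
  also have "\<dots> = weighted_integral (\<lambda>x. K\<^sup>2 * (of_bool (a \<le> x k) - exp (K * L) * of_bool (a + L \<le> x k)))"
    by (simp only: g(11))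
  also have "\<dots> = K\<^sup>2 * (weighted_integral (\<lambda>x. of_bool (a \<le> x k)) - exp (K * L) * weighted_integral (\<lambda>x. of_bool (a + L \<le> x k)))"
    by (simp only: weighted_integral_cmult weighted_integral_diff pind poly_bounded_mult poly_bounded_const)
  finally have "exp (K * L) * weighted_integral (\<lambda>x. of_bool (a + L \<le> x k)) \<le> weighted_integral (\<lambda>x. of_bool (a \<le> x k))"
    using K(1) by (simp add: zero_le_mult_iff)
  moreover have "K * L = \<beta> * n * (\<epsilon> * sqrt \<epsilon>)" unfolding r(2) by (simp add: K_def L_def power2_eq_square)
  moreover have "a + L = 2 * sqrt n * (1 + \<epsilon>)" by (simp add: a_def L_def r_def algebra_simps)
  ultimately show ?thesis by (simp add: a_def r_def)
qed

end

section \<open>The Hermite ensemble\<close>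

lemma abs_powr_deriv:
  fixes d \<beta> :: real
  assumes "d \<noteq> 0"
  shows "((\<lambda>d. \<bar>d\<bar> powr \<beta>) has_real_derivative \<beta> / d * \<bar>d\<bar> powr \<beta>) (at d)"
proof (cases "0 < d")
  case True
  have "((\<lambda>d. d powr \<beta>) has_real_derivative \<beta> / d * \<bar>d\<bar> powr \<beta>) (at d)"
    using True by (auto intro!: derivative_eq_intros simp: powr_diff)
  then show ?thesis
    by (rule has_field_derivative_transform_within_open[where S = "{0<..}"]) (use True in auto)
next
  case False
  then have neg: "d < 0" using assms by simp
  have "((\<lambda>d. (- d) powr \<beta>) has_real_derivative \<beta> / d * \<bar>d\<bar> powr \<beta>) (at d)"
    using neg by (auto intro!: derivative_eq_intros simp: powr_diff)
  then show ?thesis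
    by (rule has_field_derivative_transform_within_open[where S = "{..<0}"]) (use neg in auto)
qed

lemma pair_interaction_abs:
  assumes "1 \<le> \<beta>"
  shows "pair_interaction {1..n} \<beta> (\<lambda>i j d. \<bar>d\<bar> powr \<beta>)"
  by unfold_locales (use assms abs_powr_deriv in auto)

text \<open>The factors of pairs that involve \<open>k\<close> are cut off where \<open>k\<close> is not the larger of the two; all others are as in the
  Hermite weight.\<close>

definition top_kernel :: "real \<Rightarrow> nat \<Rightarrow> nat \<Rightarrow> nat \<Rightarrow> real \<Rightarrow> real" where
  "top_kernel \<beta> k i j d = (if i = k \<and> d \<le> 0 \<or> j = k \<and> 0 \<le> d then 0 else \<bar>d\<bar> powr \<beta>)"

lemma top_particle_kernel:
  assumes b: "1 \<le> \<beta>" and k: "k \<in> {1..n}"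
  shows "top_particle {1..n} \<beta> (top_kernel \<beta> k) k"
proof unfold_locales
  fix i j and d :: real
  show "top_kernel \<beta> k i j d = top_kernel \<beta> k j i (- d)" by (auto simp: top_kernel_def)
  assume d: "d \<noteq> 0"
  show "(top_kernel \<beta> k i j has_real_derivative \<beta> / d * top_kernel \<beta> k i j d) (at d)"
  proof (cases "i = k \<and> d \<le> 0 \<or> j = k \<and> 0 \<le> d")
    case True
    have "((\<lambda>d. 0 :: real) has_real_derivative 0) (at d)" by simp
    then have "(top_kernel \<beta> k i j has_real_derivative 0) (at d)"
      by (rule has_field_derivative_transform_within_open[where S = "if d < 0 then {..<0} else {0<..}"])
         (use True d in \<open>auto simp: top_kernel_def\<close>)
    moreover have "top_kernel \<beta> k i j d = 0" using True by (simp add: top_kernel_def)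
    ultimately show ?thesis by simp
  next
    case False
    from abs_powr_deriv[OF d] have "(top_kernel \<beta> k i j has_real_derivative \<beta> / d * \<bar>d\<bar> powr \<beta>) (at d)"
      by (rule has_field_derivative_transform_within_open[where S = "if d < 0 then {..<0} else {0<..}"])
         (use False d in \<open>auto simp: top_kernel_def\<close>)
    moreover have "top_kernel \<beta> k i j d = \<bar>d\<bar> powr \<beta>" using False by (auto simp: top_kernel_def)
    ultimately show ?thesis by simp
  qed
qed (use b k in \<open>auto simp: top_kernel_def\<close>)

lemma gibbs_weight_abs:
  assumes "1 \<le> \<beta>"
  shows "pair_interaction.gibbs_weight {1..n} \<beta> (\<lambda>i j d. \<bar>d\<bar> powr \<beta>) x = hermite_weight n \<beta> x"
proof -
  interpret pair_interaction "{1..n}" \<beta> "\<lambda>i j d. \<bar>d\<bar> powr \<beta>" by (rule pair_interaction_abs[OF assms])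
  have "{j \<in> {1..n}. j < i} = {1..<i}" if "i \<in> {1..n}" for i using that by auto
  then show ?thesis
    unfolding gibbs_weight_def interaction_def hermite_weight_def gauss_def
    by (intro arg_cong2[where f = "(*)"] prod.cong refl) auto
qed

lemma gibbs_weight_top:
  assumes b: "1 \<le> \<beta>" and k: "k \<in> {1..n}"
  shows "pair_interaction.gibbs_weight {1..n} \<beta> (top_kernel \<beta> k) x
    = (if \<forall>j\<in>{1..n} - {k}. x j < x k then hermite_weight n \<beta> x else 0)"
proof -
  note One_nat_def [simp del]
  interpret top_particle "{1..n}" \<beta> "top_kernel \<beta> k" k by (rule top_particle_kernel[OF assms])
  show ?thesis
  proof (cases "\<forall>j\<in>{1..n} - {k}. x j < x k")
    case True
    have "interaction {1..n} x = pair_interaction.interaction (\<lambda>i j d. \<bar>d\<bar> powr \<beta>) {1..n} x"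
      unfolding interaction_def pair_interaction.interaction_def[OF pair_interaction_abs[OF b]]
    proof (intro prod.cong refl)
      fix i j assume "i \<in> {1..n}" "j \<in> {j \<in> {1..n}. j < i}"
      then have "i = k \<Longrightarrow> x j < x i" "j = k \<Longrightarrow> x i < x j" using True by auto
      then show "top_kernel \<beta> k j i (x j - x i) = \<bar>x j - x i\<bar> powr \<beta>"
        by (auto simp: top_kernel_def)
    qed
    then show ?thesis
      using True gibbs_weight_abs[OF b, of n x]
      by (simp add: gibbs_weight_def pair_interaction.gibbs_weight_def[OF pair_interaction_abs[OF b]])
  next
    case False
    then obtain j where j: "j \<in> {1..n} - {k}" "\<not> x j < x k" by blast
    have "gibbs_weight x = 0" using top_support[of x j] j unfolding others_def by blast
    then show ?thesis unfolding if_not_P[OF False] .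
  qed
qed

lemma hermite_prob:
  assumes b: "0 < \<beta>" and A: "{x \<in> space (hermite_ensemble n \<beta>). Q x} \<in> sets (hermite_ensemble n \<beta>)"
  shows "\<P>(x in hermite_ensemble n \<beta>. Q x)
    = (LINT x|Pi\<^sub>M {1..n} (\<lambda>_. lborel). of_bool (Q x) * hermite_weight n \<beta> x) / hermite_Z n \<beta>"
proof -
  let ?M = "Pi\<^sub>M {1..n} (\<lambda>_. lborel :: real measure)"
  let ?H = "hermite_ensemble n \<beta>" and ?A = "{x \<in> space (hermite_ensemble n \<beta>). Q x}"
  have Z: "0 < hermite_Z n \<beta>" by (rule hermite_Z_pos[OF b])
  have sp: "space ?H = space ?M" by (simp add: hermite_ensemble_def)
  have "\<P>(x in ?H. Q x) = (LINT x|?H. indicator ?A x)"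
    using sets.sets_into_space[OF A] by (simp add: Int_absorb2)
  also have "\<dots> = (LINT x|?M. (1 / hermite_Z n \<beta> * hermite_weight n \<beta> x) * indicator ?A x)"
    unfolding hermite_ensemble_def
  proof (rule integral_real_density)
    show "indicator {x \<in> space (density ?M (\<lambda>x. ennreal (1 / hermite_Z n \<beta> * hermite_weight n \<beta> x))). Q x} \<in> borel_measurable ?M"
      using A unfolding hermite_ensemble_def by (intro borel_measurable_indicator) simp
    show "(\<lambda>x. 1 / hermite_Z n \<beta> * hermite_weight n \<beta> x) \<in> borel_measurable ?M"
      by (intro borel_measurable_times borel_measurable_const hermite_weight_measurable)
    show "AE x in ?M. 0 \<le> 1 / hermite_Z n \<beta> * hermite_weight n \<beta> x"
      using Z by (intro AE_I2) (simp add: hermite_weight_nonneg)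
  qed
  also have "\<dots> = (LINT x|?M. (1 / hermite_Z n \<beta>) * (of_bool (Q x) * hermite_weight n \<beta> x))"
    by (rule Bochner_Integration.integral_cong[OF refl]) (simp add: sp indicator_def)
  also have "\<dots> = (1 / hermite_Z n \<beta>) * (LINT x|?M. of_bool (Q x) * hermite_weight n \<beta> x)"
    by (rule integral_mult_right_zero)
  finally show ?thesis by simp
qed

lemma lambda_max_le_iff: "1 \<le> n \<Longrightarrow> lambda_max n x \<le> t \<longleftrightarrow> (\<forall>i\<in>{1..n}. x i \<le> t)"
  unfolding lambda_max_def by (subst Max_le_iff) auto

text \<open>The chambers in which particle \<open>k\<close> is the strict maximum are disjoint and exhaust the support of the
  weight. Adding the decay estimates over the chambers therefore costs no factor of \<open>n\<close>.\<close>

lemma hermite_right_tail: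
  fixes \<epsilon> :: real
  assumes n: "1 \<le> n" and eps: "0 < \<epsilon>" and b: "1 \<le> \<beta>"
  shows "\<P>(x in hermite_ensemble n \<beta>. lambda_max n x \<ge> 2 * sqrt (real n) * (1 + \<epsilon>))
    \<le> exp (- (\<beta> * real n * (\<epsilon> * sqrt \<epsilon>)))"
proof -
  note One_nat_def [simp del]
  let ?M = "Pi\<^sub>M {1..n} (\<lambda>_. lborel :: real measure)"
  let ?w = "hermite_weight n \<beta>"
  define s where "s = 2 * sqrt (real n) * (1 + \<epsilon>)"
  define E where "E = exp (- (\<beta> * real n * (\<epsilon> * sqrt \<epsilon>)))"
  define \<rho> where "\<rho> k x = (if \<forall>j\<in>{1..n} - {k}. x j < x k then ?w x else 0)" for k x
  have Z: "0 < hermite_Z n \<beta>" using b by (intro hermite_Z_pos) auto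
  have int_\<rho>: "integrable ?M (\<lambda>x. of_bool (c \<le> x k) * \<rho> k x)" "integrable ?M (\<rho> k)"
    and tail: "(LINT x|?M. of_bool (s \<le> x k) * \<rho> k x) \<le> E * (LINT x|?M. \<rho> k x)"
    if k: "k \<in> {1..n}" for k c
  proof -
    interpret top_particle "{1..n}" \<beta> "top_kernel \<beta> k" k by (rule top_particle_kernel[OF b k])
    have dens: "gibbs_weight = \<rho> k" by (simp add: fun_eq_iff \<rho>_def gibbs_weight_top[OF b k])
    have pind: "poly_bounded {1..n} (\<lambda>x. of_bool (c \<le> x k))" for c
      by (rule poly_bounded_bounded[where C = 1])
         (rule measurable_compose[OF measurable_coordinate[OF k], of "\<lambda>y. of_bool (c \<le> y)"], auto)
    show "integrable ?M (\<lambda>x. of_bool (c \<le> x k) * \<rho> k x)" for c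
      using poly_bounded_integrable[OF pind[of c]] by (simp add: dens)
    show "integrable ?M (\<rho> k)"
      using poly_bounded_integrable[OF poly_bounded_const[of _ 1]] by (simp add: dens)
    have "exp (\<beta> * real n * (\<epsilon> * sqrt \<epsilon>)) * weighted_integral (\<lambda>x. of_bool (s \<le> x k))
        \<le> weighted_integral (\<lambda>x. of_bool (2 * sqrt (real n) * (1 + \<epsilon> / 2) \<le> x k))"
      using top_tail[OF eps] by (simp add: s_def)
    also have "\<dots> \<le> weighted_integral (\<lambda>x. 1)"
      by (intro weighted_integral_mono pind poly_bounded_const) auto
    finally have "weighted_integral (\<lambda>x. of_bool (s \<le> x k)) \<le> E * weighted_integral (\<lambda>x. 1)"
      by (simp add: E_def exp_minus field_simps)
    then show "(LINT x|?M. of_bool (s \<le> x k) * \<rho> k x) \<le> E * (LINT x|?M. \<rho> k x)"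
      by (simp add: weighted_integral_def dens)
  qed
  have inj: "inj_on x {1..n}" if "?w x \<noteq> 0" for x
    using pair_interaction.gibbs_weight_support[OF pair_interaction_abs[OF b]] gibbs_weight_abs[OF b] that by metis
  have cover: "of_bool (s \<le> lambda_max n x) * ?w x \<le> (\<Sum>k\<in>{1..n}. of_bool (s \<le> x k) * \<rho> k x)" for x
  proof (cases "?w x = 0 \<or> \<not> s \<le> lambda_max n x")
    case True
    then show ?thesis by (auto intro!: sum_nonneg simp: \<rho>_def hermite_weight_nonneg)
  next
    case False
    then have w: "?w x \<noteq> 0" by simp
    have "lambda_max n x \<in> x ` {1..n}" unfolding lambda_max_def using n by (intro Max_in) auto
    then obtain k where k: "k \<in> {1..n}" "lambda_max n x = x k" by auto
    have "x j < x k" if j: "j \<in> {1..n} - {k}" for j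
    proof -
      have "x j \<le> x k" using lambda_max_le_iff[OF n, of x "x k"] k j by auto
      moreover have "x j \<noteq> x k" using inj_onD[OF inj[OF w], of j k] k(1) j by blast
      ultimately show ?thesis by simp
    qed
    then have "of_bool (s \<le> lambda_max n x) * ?w x = of_bool (s \<le> x k) * \<rho> k x" by (simp add: \<rho>_def k)
    also have "\<dots> \<le> (\<Sum>k\<in>{1..n}. of_bool (s \<le> x k) * \<rho> k x)"
      using k by (intro member_le_sum) (auto simp: \<rho>_def hermite_weight_nonneg)
    finally show ?thesis .
  qed
  have disjoint: "(\<Sum>k\<in>{1..n}. \<rho> k x) \<le> ?w x" for x
  proof (cases "\<exists>k\<in>{1..n}. \<rho> k x \<noteq> 0")
    case True
    then obtain k where k: "k \<in> {1..n}" "\<rho> k x \<noteq> 0" by blast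
    then have top: "\<forall>j\<in>{1..n} - {k}. x j < x k" by (auto simp: \<rho>_def split: if_splits)
    have "\<rho> l x = 0" if l: "l \<in> {1..n} - {k}" for l
    proof -
      have "x l < x k" "k \<in> {1..n} - {l}" using top l k by auto
      then show ?thesis unfolding \<rho>_def by (meson less_asym)
    qed
    then have "(\<Sum>k\<in>{1..n}. \<rho> k x) = \<rho> k x"
      using k by (subst sum.remove[of _ k]) auto
    then show ?thesis by (simp add: \<rho>_def hermite_weight_nonneg)
  next
    case False
    then show ?thesis by (simp add: hermite_weight_nonneg)
  qed
  have meas: "{x \<in> space (hermite_ensemble n \<beta>). s \<le> lambda_max n x} \<in> sets (hermite_ensemble n \<beta>)"
    using lambda_max_measurable[OF n] by measurable
  have "(LINT x|?M. of_bool (s \<le> lambda_max n x) * ?w x) \<le> (LINT x|?M. (\<Sum>k\<in>{1..n}. of_bool (s \<le> x k) * \<rho> k x))"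
  proof (rule integral_mono_AE')
    show "integrable ?M (\<lambda>x. \<Sum>k\<in>{1..n}. of_bool (s \<le> x k) * \<rho> k x)"
      by (intro Bochner_Integration.integrable_sum int_\<rho>)
    show "AE x in ?M. of_bool (s \<le> lambda_max n x) * ?w x \<le> (\<Sum>k\<in>{1..n}. of_bool (s \<le> x k) * \<rho> k x)"
      by (rule AE_I2) (rule cover)
    show "AE x in ?M. 0 \<le> (\<Sum>k\<in>{1..n}. of_bool (s \<le> x k) * \<rho> k x)"
      by (intro AE_I2 sum_nonneg mult_nonneg_nonneg) (simp_all add: \<rho>_def hermite_weight_nonneg)
  qed
  also have "\<dots> = (\<Sum>k\<in>{1..n}. (LINT x|?M. of_bool (s \<le> x k) * \<rho> k x))"
    by (intro Bochner_Integration.integral_sum int_\<rho>)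
  also have "\<dots> \<le> (\<Sum>k\<in>{1..n}. E * (LINT x|?M. \<rho> k x))"
    by (intro sum_mono tail)
  also have "\<dots> = E * (LINT x|?M. (\<Sum>k\<in>{1..n}. \<rho> k x))"
    by (subst Bochner_Integration.integral_sum) (simp_all add: int_\<rho> sum_distrib_left)
  also have "\<dots> \<le> E * hermite_Z n \<beta>"
    unfolding hermite_Z_def using b disjoint
    by (intro mult_left_mono integral_mono Bochner_Integration.integrable_sum int_\<rho> hermite_weight_integrable)
       (auto simp: E_def)
  finally have "(LINT x|?M. of_bool (s \<le> lambda_max n x) * ?w x) \<le> E * hermite_Z n \<beta>" .
  then show ?thesis
    using Z b unfolding s_def[symmetric] E_def[symmetric]
    by (subst hermite_prob[OF _ meas]) (auto simp: divide_le_eq)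
qed

lemma hermite_left_tail:
  fixes \<epsilon> :: real
  assumes n: "1 \<le> n" and eps: "0 < \<epsilon>" "\<epsilon> \<le> 1" and b: "1 \<le> \<beta>"
    and large: "34 \<le> real n * (\<epsilon> * sqrt \<epsilon>)"
  shows "\<P>(x in hermite_ensemble n \<beta>. lambda_max n x \<le> 2 * sqrt (real n) * (1 - \<epsilon>))
    \<le> exp (- (\<beta> * (real n)\<^sup>2 * \<epsilon> ^ 3 / 128))"
proof -
  note One_nat_def [simp del]
  let ?M = "Pi\<^sub>M {1..n} (\<lambda>_. lborel :: real measure)"
  let ?w = "hermite_weight n \<beta>"
  define t where "t = 2 * sqrt (real n) * (1 - \<epsilon>)"
  interpret pair_interaction "{1..n}" \<beta> "\<lambda>i j d. \<bar>d\<bar> powr \<beta>" by (rule pair_interaction_abs[OF b])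
  have Z: "0 < hermite_Z n \<beta>" using b by (intro hermite_Z_pos) auto
  have dens: "gibbs_weight = ?w" by (simp add: fun_eq_iff gibbs_weight_abs[OF b])
  have bool: "of_bool (lambda_max n x \<le> t) = below t x" for x
    by (simp add: below_eq lambda_max_le_iff[OF n])
  have "weighted_integral (below t) * exp (\<beta> * (real n)\<^sup>2 * \<epsilon> ^ 3 / 128) \<le> weighted_integral (below (t + sqrt (real n) * \<epsilon>))"
    using weighted_integral_below_left_tail[OF eps, of t] large by (simp add: t_def)
  also have "\<dots> \<le> weighted_integral (\<lambda>x. 1)"
    by (intro weighted_integral_mono poly_bounded_below poly_bounded_const) (simp add: below_eq)
  also have "\<dots> = hermite_Z n \<beta>" by (simp add: weighted_integral_def dens hermite_Z_def)
  finally have "weighted_integral (below t) / hermite_Z n \<beta> \<le> exp (- (\<beta> * (real n)\<^sup>2 * \<epsilon> ^ 3 / 128))"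
    using Z by (simp add: exp_minus field_simps)
  moreover have "(LINT x|?M. of_bool (lambda_max n x \<le> t) * ?w x) = weighted_integral (below t)"
    unfolding bool weighted_integral_def dens ..
  moreover have meas: "{x \<in> space (hermite_ensemble n \<beta>). lambda_max n x \<le> t} \<in> sets (hermite_ensemble n \<beta>)"
    using lambda_max_measurable[OF n] by measurable
  moreover have "0 < \<beta>" using b by simp
  ultimately show ?thesis
    unfolding t_def[symmetric] by (simp only: hermite_prob[OF _ meas])
qed

theorem theorem1:
  shows "\<exists>C::real. C > 0 \<and>
    (\<forall>(n::nat) (\<epsilon>::real) (\<beta>::real). n \<ge> 1 \<longrightarrow> 0 < \<epsilon> \<longrightarrow> \<epsilon> \<le> 1 \<longrightarrow> \<beta> \<ge> 1 \<longrightarrow>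
      \<P>(x in hermite_ensemble n \<beta>. lambda_max n x \<ge> 2 * sqrt (real n) * (1 + \<epsilon>))
        \<le> C * exp (- \<beta> * real n * \<epsilon> powr (3/2) / C) \<and>
      \<P>(x in hermite_ensemble n \<beta>. lambda_max n x \<le> 2 * sqrt (real n) * (1 - \<epsilon>))
        \<le> C powr \<beta> * exp (- \<beta> * (real n)\<^sup>2 * \<epsilon> ^ 3 / C))"
\<comment> \<open>\<open>1156 = 34\<^sup>2\<close> is the value of \<open>n\<^sup>2 \<epsilon>\<^sup>3\<close> up to which the lower bound is trivial\<close>
proof (intro exI[of _ 1156] conjI allI impI)
  fix n :: nat and \<epsilon> \<beta> :: real
  assume n: "1 \<le> n" and eps: "0 < \<epsilon>" "\<epsilon> \<le> 1" and b: "1 \<le> \<beta>"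
  have powr: "\<epsilon> powr (3 / 2) = \<epsilon> * sqrt \<epsilon>"
    using eps powr_add[of \<epsilon> 1 "1 / 2"] by (simp add: powr_half_sqrt)
  let ?r = "\<beta> * real n * (\<epsilon> * sqrt \<epsilon>)"
  have "0 \<le> ?r" using b eps by simp
  then have "exp (- ?r) \<le> exp (- ?r / 1156)" by (intro exp_le_cancel_iff[THEN iffD2]) linarith
  also have "\<dots> \<le> 1156 * exp (- ?r / 1156)" by simp
  finally show "\<P>(x in hermite_ensemble n \<beta>. lambda_max n x \<ge> 2 * sqrt (real n) * (1 + \<epsilon>))
      \<le> 1156 * exp (- \<beta> * real n * \<epsilon> powr (3 / 2) / 1156)"
    using hermite_right_tail[OF n eps(1) b] unfolding powr by simp
  let ?l = "(real n)\<^sup>2 * \<epsilon> ^ 3"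
  have l: "0 \<le> ?l" using eps by simp
  show "\<P>(x in hermite_ensemble n \<beta>. lambda_max n x \<le> 2 * sqrt (real n) * (1 - \<epsilon>))
      \<le> 1156 powr \<beta> * exp (- \<beta> * (real n)\<^sup>2 * \<epsilon> ^ 3 / 1156)"
  proof (cases "34 \<le> real n * (\<epsilon> * sqrt \<epsilon>)")
    case True
    have "0 \<le> \<beta> * ?l" using b l by simp
    then have "exp (- (\<beta> * ?l / 128)) \<le> exp (- (\<beta> * ?l) / 1156)"
      by (intro exp_le_cancel_iff[THEN iffD2]) linarith
    also have "\<dots> \<le> 1156 powr \<beta> * exp (- (\<beta> * ?l) / 1156)"
      using b ge_one_powr_ge_zero[of 1156 \<beta>] by simp
    finally show ?thesis
      using hermite_left_tail[OF n eps b True] by (simp add: mult.assoc)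
  next
    case False
    have "?l = (real n * (\<epsilon> * sqrt \<epsilon>))\<^sup>2"
      using eps by (simp add: power_mult_distrib power2_eq_square power3_eq_cube)
    also have "\<dots> \<le> 34\<^sup>2" using False eps by (intro power_mono) auto
    finally have "?l / 1156 \<le> 1" by simp
    then have "\<beta> * (?l / 1156) \<le> \<beta> * 1" using b by (intro mult_left_mono) auto
    moreover have "1 \<le> ln (1156 :: real)" using exp_le by (simp add: ln_ge_iff)
    then have "\<beta> * 1 \<le> \<beta> * ln 1156" using b by (intro mult_left_mono) auto
    ultimately have "0 \<le> \<beta> * ln 1156 - \<beta> * (?l / 1156)" by simp
    then have "1 \<le> exp (\<beta> * ln 1156 - \<beta> * (?l / 1156))" by simp
    also have "\<dots> = 1156 powr \<beta> * exp (- \<beta> * (real n)\<^sup>2 * \<epsilon> ^ 3 / 1156)"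
      by (simp add: powr_def exp_add[symmetric] algebra_simps)
    finally have "1 \<le> 1156 powr \<beta> * exp (- \<beta> * (real n)\<^sup>2 * \<epsilon> ^ 3 / 1156)" .
    moreover have "\<P>(x in hermite_ensemble n \<beta>. lambda_max n x \<le> 2 * sqrt (real n) * (1 - \<epsilon>)) \<le> 1"
      using prob_space.prob_le_1[OF prob_space_hermite_ensemble] b by simp
    ultimately show ?thesis by linarith
  qed
qed simp

end
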